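(* A compact set $E\subset\mathbb{R}^{N+1}$ is $\frac12$-fractional caloric removable if and only if $\gamma_\Theta^{1/2}(E)=0$.
   Context: $N\ge 1$; points of $\mathbb{R}^{N+1}$ are $\bar x=(x,t)$, $x\in\mathbb{R}^N$, $t\in\mathbb{R}$. $\Theta^{1/2}=(-\Delta_x)^{1/2}+\partial_t$, where $(-\Delta_x)^{1/2}$ acts in $x$ with Fourier multiplier $|\xi|$; the $\frac12$-fractional heat equation is $\Theta^{1/2}f=0$, understood in the sense of distributions. A compact set $E\subset\mathbb{R}^{N+1}$ is called $\frac12$-fractional caloric removable (removable for bounded $\frac12$-fractional caloric functions) if every bounded function $f:\mathbb{R}^{N+1}\to\mathbb{R}$ ($\|f\|_{L^\infty(\mathbb{R}^{N+1})}<\infty$) satisfying the $\frac12$-fractional heat equation in $\mathbb{R}^{N+1}\setminus E$ also satisfies it in the whole of $\mathbb{R}^{N+1}$. $P(x,t)=\frac{t}{(t^2+|x|^2)^{(N+1)/2}}$ for $t>0$ and $P(x,t)=0$ for $t\le0$ (up to a multiplicative constant, the fundamental solution of $\Theta^{1/2}$). For compact $E$, $\gamma_\Theta^{1/2}(E)=\sup|\langle\nu,1\rangle|$, the supremum being over all distributions $\nu$ in $\mathbb{R}^{N+1}$ with $\operatorname{supp}\nu\subset E$ and $\|P*\nu\|_{L^\infty(\mathbb{R}^{N+1})}\le1$. *)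

theory Defs
  imports "HOL-Analysis.Analysis" "HOL-Probability.Essential_Supremum"
begin

section \<open>Test functions and distributions\<close>

fun iter_deriv :: "'a::real_normed_vector list \<Rightarrow> ('a \<Rightarrow> real) \<Rightarrow> 'a \<Rightarrow> real" where
  "iter_deriv [] \<phi> = \<phi>"
| "iter_deriv (v # vs) \<phi> = (\<lambda>x. frechet_derivative (iter_deriv vs \<phi>) (at x) v)"

definition smooth :: "('a::real_normed_vector \<Rightarrow> real) \<Rightarrow> bool" where
  "smooth \<phi> \<longleftrightarrow> (\<forall>vs x. iter_deriv vs \<phi> differentiable (at x))"

definition fun_support :: "('a::topological_space \<Rightarrow> real) \<Rightarrow> 'a set" where
  "fun_support \<phi> = closure {x. \<phi> x \<noteq> 0}"

definition test_function :: "('a::real_normed_vector \<Rightarrow> real) \<Rightarrow> bool" where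
  "test_function \<phi> \<longleftrightarrow> smooth \<phi> \<and> compact (fun_support \<phi>)"

definition Ck_norm :: "nat \<Rightarrow> ('a::euclidean_space \<Rightarrow> real) \<Rightarrow> real" where
  "Ck_norm m \<phi> = (\<Sum>vs | set vs \<subseteq> Basis \<and> length vs \<le> m. SUP x. \<bar>iter_deriv vs \<phi> x\<bar>)"

text \<open>A distribution is modelled by a functional on all functions of which only the values on test
  functions are constrained. Continuity is expressed by the usual seminorm estimates.\<close>

definition distribution :: "(('a::euclidean_space \<Rightarrow> real) \<Rightarrow> real) \<Rightarrow> bool" where
  "distribution T \<longleftrightarrow>
     (\<forall>\<phi> \<psi>. test_function \<phi> \<longrightarrow> test_function \<psi> \<longrightarrow> T (\<lambda>x. \<phi> x + \<psi> x) = T \<phi> + T \<psi>) \<and>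
     (\<forall>c \<phi>. test_function \<phi> \<longrightarrow> T (\<lambda>x. c * \<phi> x) = c * T \<phi>) \<and>
     (\<forall>K. compact K \<longrightarrow>
        (\<exists>C m. \<forall>\<phi>. test_function \<phi> \<longrightarrow> fun_support \<phi> \<subseteq> K \<longrightarrow> \<bar>T \<phi>\<bar> \<le> C * Ck_norm m \<phi>))"

definition vanishes_on :: "(('a::real_normed_vector \<Rightarrow> real) \<Rightarrow> real) \<Rightarrow> 'a set \<Rightarrow> bool" where
  "vanishes_on T U \<longleftrightarrow> (\<forall>\<phi>. test_function \<phi> \<longrightarrow> fun_support \<phi> \<subseteq> U \<longrightarrow> T \<phi> = 0)"

definition dist_support :: "(('a::real_normed_vector \<Rightarrow> real) \<Rightarrow> real) \<Rightarrow> 'a set" where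
  "dist_support T = - \<Union>{U. open U \<and> vanishes_on T U}"

text \<open>The pairing of a compactly supported distribution with an arbitrary smooth function, through
  a cutoff equal to 1 near the support; the value does not depend on the cutoff chosen.\<close>

definition cutoff_near :: "'a::real_normed_vector set \<Rightarrow> ('a \<Rightarrow> real) \<Rightarrow> bool" where
  "cutoff_near S \<eta> \<longleftrightarrow>
     test_function \<eta> \<and> (\<exists>U. open U \<and> S \<subseteq> U \<and> (\<forall>x\<in>U. \<eta> x = 1))"

definition dist_pairing ::
    "(('a::real_normed_vector \<Rightarrow> real) \<Rightarrow> real) \<Rightarrow> ('a \<Rightarrow> real) \<Rightarrow> real" where
  "dist_pairing T \<psi> = (let \<eta> = (SOME \<eta>. cutoff_near (dist_support T) \<eta>) in T (\<lambda>x. \<eta> x * \<psi> x))"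

definition Linfty_norm :: "('a::euclidean_space \<Rightarrow> real) \<Rightarrow> ereal" where
  "Linfty_norm f = esssup lebesgue (\<lambda>x. ereal \<bar>f x\<bar>)"

text \<open>\<^term>\<open>dist_Linfty_le T c\<close>: the distribution \<^term>\<open>T\<close> is given by a function whose
  essential supremum norm is at most \<^term>\<open>c\<close>.\<close>

definition dist_Linfty_le :: "(('a::euclidean_space \<Rightarrow> real) \<Rightarrow> real) \<Rightarrow> real \<Rightarrow> bool" where
  "dist_Linfty_le T c \<longleftrightarrow>
     (\<exists>g \<in> borel_measurable lebesgue. Linfty_norm g \<le> ereal c \<and>
        (\<forall>\<phi>. test_function \<phi> \<longrightarrow> T \<phi> = (LINT x|lebesgue. g x * \<phi> x)))"

section \<open>The half-fractional heat operator\<close>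

text \<open>Points of space-time are pairs \<open>(x, t)\<close> with \<open>x \<in> \<real>\<^sup>N\<close> and \<open>N = CARD('n)\<close>.\<close>

definition space_fourier :: "((real^'n) \<times> real \<Rightarrow> real) \<Rightarrow> real^'n \<Rightarrow> real \<Rightarrow> complex" where
  "space_fourier \<phi> \<xi> t = (LINT y|lborel. complex_of_real (\<phi> (y, t)) * cis (- (y \<bullet> \<xi>)))"

text \<open>\<open>(-\<Delta>\<^sub>x)\<^bsup>1/2\<^esup> \<phi>\<close> as the Fourier multiplier \<open>|\<xi>|\<close> in the space variable. For real
  \<open>\<phi>\<close> the integral is real, so taking the real part only adjusts the type.\<close>

definition half_laplacian :: "((real^'n) \<times> real \<Rightarrow> real) \<Rightarrow> (real^'n) \<times> real \<Rightarrow> real" where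
  "half_laplacian \<phi> = (\<lambda>(x, t).
     Re (LINT \<xi>|lborel. complex_of_real (norm \<xi>) * space_fourier \<phi> \<xi> t * cis (x \<bullet> \<xi>))
       / (2 * pi) ^ CARD('n))"

definition time_deriv :: "((real^'n) \<times> real \<Rightarrow> real) \<Rightarrow> (real^'n) \<times> real \<Rightarrow> real" where
  "time_deriv \<phi> = (\<lambda>(x, t). deriv (\<lambda>s. \<phi> (x, s)) t)"

text \<open>The distribution \<open>\<Theta>\<^bsup>1/2\<^esup> f\<close> of a bounded function \<open>f\<close>: the operator is moved to
  the test function, \<open>(-\<Delta>\<^sub>x)\<^bsup>1/2\<^esup>\<close> being symmetric and \<open>\<partial>\<^sub>t\<close> antisymmetric. The half Laplacian
  of a test function is not compactly supported, but it decays like \<open>|x|\<^bsup>-N-1\<^esup>\<close>, so the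
  integral converges.\<close>

definition Theta_half ::
    "((real^'n) \<times> real \<Rightarrow> real) \<Rightarrow> ((real^'n) \<times> real \<Rightarrow> real) \<Rightarrow> real" where
  "Theta_half f \<phi> = (LINT z|lebesgue. f z * (half_laplacian \<phi> z - time_deriv \<phi> z))"

definition half_caloric_on ::
    "((real^'n) \<times> real) set \<Rightarrow> ((real^'n) \<times> real \<Rightarrow> real) \<Rightarrow> bool" where
  "half_caloric_on U f \<longleftrightarrow> vanishes_on (Theta_half f) U"

definition half_caloric_removable :: "((real^'n) \<times> real) set \<Rightarrow> bool" where
  "half_caloric_removable E \<longleftrightarrow>
     (\<forall>f \<in> borel_measurable lebesgue.
        Linfty_norm f < \<infinity> \<longrightarrow> half_caloric_on (- E) f \<longrightarrow> half_caloric_on UNIV f)"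

section \<open>The capacity\<close>

definition half_heat_kernel :: "(real^'n) \<times> real \<Rightarrow> real" where
  "half_heat_kernel = (\<lambda>(x, t).
     if t > 0 then t / (t\<^sup>2 + (norm x)\<^sup>2) powr ((real CARD('n) + 1) / 2) else 0)"

text \<open>The distribution \<open>P * \<nu>\<close> for compactly supported \<open>\<nu>\<close>: the pairing of \<open>\<nu>\<close> with the
  smooth function obtained by convolving the test function with the reflected kernel.\<close>

definition kernel_conv ::
    "(((real^'n) \<times> real \<Rightarrow> real) \<Rightarrow> real) \<Rightarrow> ((real^'n) \<times> real \<Rightarrow> real) \<Rightarrow> real" where
  "kernel_conv \<nu> \<phi> =
     dist_pairing \<nu> (\<lambda>w. LINT z|lebesgue. half_heat_kernel (z - w) * \<phi> z)"

definition admissible ::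
    "((real^'n) \<times> real) set \<Rightarrow> (((real^'n) \<times> real \<Rightarrow> real) \<Rightarrow> real) \<Rightarrow> bool" where
  "admissible E \<nu> \<longleftrightarrow>
     distribution \<nu> \<and> dist_support \<nu> \<subseteq> E \<and> dist_Linfty_le (kernel_conv \<nu>) 1"

definition half_caloric_capacity :: "((real^'n) \<times> real) set \<Rightarrow> ennreal" where
  "half_caloric_capacity E =
     (SUP \<nu> \<in> {\<nu>. admissible E \<nu>}. ennreal \<bar>dist_pairing \<nu> (\<lambda>_. 1)\<bar>)"

end

theory Submission
  imports Defs "HOL-Probability.Characteristic_Functions" "HOL-Real_Asymp.Real_Asymp"
begin

text \<open>Up to a constant \<open>\<kappa>\<close>, \<open>P\<close> is the fundamental solution of \<open>\<Theta>\<^bsup>1/2\<^esup>\<close>: on the Fourier side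
  \<open>P(\<cdot>, s)\<close> is \<open>\<kappa> exp (- s |\<xi>|)\<close>. So if \<open>\<nu>\<close> is admissible with bounded potential
  \<open>g = P * \<nu>\<close>, then \<open>\<Theta>\<^bsup>1/2\<^esup> g = \<kappa> \<nu>\<close>; removability forces \<open>\<nu> = 0\<close> and the capacity vanishes.

  Conversely, let \<open>f\<close> be bounded and half-caloric off \<open>E\<close> with \<open>\<langle>\<Theta>\<^bsup>1/2\<^esup> f, \<phi>\<rangle> \<noteq> 0\<close> for some test function
  \<open>\<phi>\<close>. Then \<open>\<nu> = \<phi> \<Theta>\<^bsup>1/2\<^esup> f\<close> is supported in \<open>E\<close> and \<open>\<langle>\<nu>, 1\<rangle> \<noteq> 0\<close>, so it suffices that \<open>P * \<nu>\<close> is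
  bounded. By duality this is a bound for the adjoint operator applied to \<open>\<phi> u\<close>, where \<open>u\<close> is an adjoint
  potential. The product rule for the half Laplacian leaves the bilinear term
  \<open>\<integral> (\<phi>(x) - \<phi>(x + h)) (u(x) - u(x + h)) |h|\<^bsup>-N-1\<^esup> dh\<close>, which is controlled by
  \<open>\<integral> |P(y, s) - P(y - h, s)| dy \<le> C (|h| / s)\<^bsup>1/2\<^esup>\<close>: the singularity in \<open>h\<close> becomes integrable and the price
  \<open>s\<^bsup>-1/2\<^esup>\<close> is integrable in time.\<close>

section \<open>Calculus of smooth functions\<close>

text \<open>The exponent 1/2 in the translation estimate is a compromise. Against the jump density
  |h|^(-N-1) the cutoff gains only min(|h|, 1). Bounding the kernel difference trivially leaves
  |h|^(-N) near 0, which diverges; the Lipschitz bound |h| / s leaves 1 / s, which diverges in time.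
  Any power strictly between 0 and 1 repairs both ends. The half Laplacian is given as a multiplier,
  while the product rule needs differences. The bridge is the derivative at s = 0 of averaging with
  P(., s): in frequency it produces |\<xi>|, in space the kernel |h|^(-N-1), and the comparison
  fixes the constant 1 / (2 \<kappa>). Half Laplacians of test functions are in general not
  compactly supported, whereas P * \<nu> is prescribed on test functions only. The first implication
  therefore truncates the jumps at size n and lets the continuity of \<nu> absorb the tail. In the
  second, the cutoff \<phi> keeps the function under the operator a test function.\<close>

definition dirderiv :: "'a::real_normed_vector \<Rightarrow> ('a \<Rightarrow> real) \<Rightarrow> 'a \<Rightarrow> real" where
  "dirderiv v \<phi> = (\<lambda>x. frechet_derivative \<phi> (at x) v)"

text \<open>\<open>smooth\<close> quantifies over words of all lengths at once. Cutting at length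
  \<open>n\<close> gives a predicate on which the product, inverse and translation rules can be
  proved by induction, because a derivative of a product is a sum of products one level
  lower.\<close>

definition diff_upto :: "nat \<Rightarrow> ('a::real_normed_vector \<Rightarrow> real) \<Rightarrow> bool" where
  "diff_upto n \<phi> \<longleftrightarrow> (\<forall>vs x. length vs \<le> n \<longrightarrow> iter_deriv vs \<phi> differentiable (at x))"

lemma iter_deriv_Cons: "iter_deriv (v # vs) \<phi> = dirderiv v (iter_deriv vs \<phi>)"
  by (simp add: dirderiv_def)

lemma iter_deriv_append: "iter_deriv (vs @ ws) \<phi> = iter_deriv vs (iter_deriv ws \<phi>)"
  by (induction vs) (simp_all)

lemma iter_deriv_snoc: "iter_deriv (vs @ [v]) \<phi> = iter_deriv vs (dirderiv v \<phi>)"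
  by (simp add: iter_deriv_append dirderiv_def)

lemma smooth_iff_diff_upto: "smooth \<phi> \<longleftrightarrow> (\<forall>n. diff_upto n \<phi>)"
  unfolding smooth_def diff_upto_def by blast

lemma diff_upto_0: "diff_upto 0 \<phi> \<longleftrightarrow> (\<forall>x. \<phi> differentiable (at x))"
  by (simp add: diff_upto_def)

text \<open>In \<open>iter_deriv\<close> the last entry of the list is differentiated first, so
  splitting the list at its end replaces \<open>\<phi>\<close> by one of its first derivatives and
  leaves the remaining word untouched.\<close>

lemma diff_upto_Suc:
  "diff_upto (Suc n) \<phi> \<longleftrightarrow> (\<forall>x. \<phi> differentiable (at x)) \<and> (\<forall>v. diff_upto n (dirderiv v \<phi>))"
proof
  assume *: "diff_upto (Suc n) \<phi>"
  have "\<phi> differentiable (at x)" for x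
    using *[unfolded diff_upto_def, rule_format, of "[]" x] by simp
  moreover have "diff_upto n (dirderiv v \<phi>)" for v
    using * unfolding diff_upto_def by (metis iter_deriv_snoc length_append_singleton Suc_le_mono)
  ultimately show "(\<forall>x. \<phi> differentiable (at x)) \<and> (\<forall>v. diff_upto n (dirderiv v \<phi>))" by blast
next
  assume *: "(\<forall>x. \<phi> differentiable (at x)) \<and> (\<forall>v. diff_upto n (dirderiv v \<phi>))"
  show "diff_upto (Suc n) \<phi>"
    unfolding diff_upto_def
  proof (intro allI impI)
    fix vs :: "'a list" and x assume "length vs \<le> Suc n"
    then show "iter_deriv vs \<phi> differentiable (at x)"
      using * by (cases vs rule: rev_cases) (auto simp: iter_deriv_snoc diff_upto_def)
  qed
qed

lemma diff_upto_mono: "diff_upto n \<phi> \<Longrightarrow> m \<le> n \<Longrightarrow> diff_upto m \<phi>"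
  by (auto simp: diff_upto_def)

lemma diff_upto_differentiable: "diff_upto n \<phi> \<Longrightarrow> \<phi> differentiable (at x)"
  using diff_upto_mono[of n \<phi> 0] by (auto simp: diff_upto_0)

lemma smooth_differentiable: "smooth \<phi> \<Longrightarrow> \<phi> differentiable (at x)"
  using diff_upto_differentiable[of 0 \<phi> x] by (simp add: smooth_iff_diff_upto)

lemma smooth_has_derivative:
  "smooth \<phi> \<Longrightarrow> (\<phi> has_derivative (\<lambda>v. dirderiv v \<phi> x)) (at x)"
  using smooth_differentiable[of \<phi> x] by (simp add: frechet_derivative_works dirderiv_def)

lemma smooth_iff: "smooth \<phi> \<longleftrightarrow> (\<forall>x. \<phi> differentiable (at x)) \<and> (\<forall>v. smooth (dirderiv v \<phi>))"
  unfolding smooth_iff_diff_upto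
proof safe
  fix n assume *: "\<forall>x. \<phi> differentiable (at x)" "\<forall>v n. diff_upto n (dirderiv v \<phi>)"
  then show "diff_upto n \<phi>" by (cases n) (simp_all add: diff_upto_0 diff_upto_Suc)
qed (metis diff_upto_Suc)+

lemma smooth_dirderiv: "smooth \<phi> \<Longrightarrow> smooth (dirderiv v \<phi>)"
  using smooth_iff by blast

lemma smooth_iter_deriv: "smooth \<phi> \<Longrightarrow> smooth (iter_deriv vs \<phi>)"
  by (induction vs) (simp_all only: iter_deriv_Cons smooth_dirderiv iter_deriv.simps(1))

lemma smooth_continuous_on: "smooth \<phi> \<Longrightarrow> continuous_on S \<phi>"
  by (meson continuous_at_imp_continuous_on differentiable_imp_continuous_within smooth_differentiable)

lemma dirderiv_eqI:
  assumes "\<And>x. (\<phi> has_derivative D x) (at x)"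
  shows "dirderiv v \<phi> = (\<lambda>x. D x v)"
  unfolding dirderiv_def using frechet_derivative_at[OF assms] by metis

lemma differentiable_has_dirderiv:
  "\<phi> differentiable (at x) \<Longrightarrow> (\<phi> has_derivative (\<lambda>v. dirderiv v \<phi> x)) (at x)"
  by (simp add: frechet_derivative_works dirderiv_def)

lemma dirderiv_const: "dirderiv v (\<lambda>x. c) = (\<lambda>x. 0)"
  by (rule dirderiv_eqI) (rule has_derivative_const)

lemma dirderiv_add:
  assumes "\<And>x. \<phi> differentiable (at x)" "\<And>x. \<psi> differentiable (at x)"
  shows "dirderiv v (\<lambda>x. \<phi> x + \<psi> x) = (\<lambda>x. dirderiv v \<phi> x + dirderiv v \<psi> x)"
  by (rule dirderiv_eqI) (rule has_derivative_add differentiable_has_dirderiv assms)+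

lemma dirderiv_mult:
  assumes "\<And>x. \<phi> differentiable (at x)" "\<And>x. \<psi> differentiable (at x)"
  shows "dirderiv v (\<lambda>x. \<phi> x * \<psi> x) = (\<lambda>x. \<phi> x * dirderiv v \<psi> x + dirderiv v \<phi> x * \<psi> x)"
  by (rule dirderiv_eqI) (rule has_derivative_mult differentiable_has_dirderiv assms)+

lemma dirderiv_cmult:
  assumes "\<And>x. \<phi> differentiable (at x)"
  shows "dirderiv v (\<lambda>x. c * \<phi> x) = (\<lambda>x. c * dirderiv v \<phi> x)"
  by (subst dirderiv_mult) (simp_all add: assms dirderiv_const)

lemma dirderiv_translate:
  assumes "\<And>x. \<phi> differentiable (at x)"
  shows "dirderiv v (\<lambda>x. \<phi> (x + a)) = (\<lambda>x. dirderiv v \<phi> (x + a))"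
proof (rule dirderiv_eqI)
  fix x
  have 1: "((\<lambda>x. x + a) has_derivative (\<lambda>v. v)) (at x)" by (auto intro!: derivative_eq_intros)
  show "((\<lambda>x. \<phi> (x + a)) has_derivative (\<lambda>v. dirderiv v \<phi> (x + a))) (at x)"
    using has_derivative_compose[OF 1 differentiable_has_dirderiv[OF assms]] by simp
qed

lemma diff_upto_const: "diff_upto n (\<lambda>x. c)"
  by (induction n arbitrary: c) (auto simp: diff_upto_Suc diff_upto_0 dirderiv_const)

lemma diff_upto_add: "diff_upto n \<phi> \<Longrightarrow> diff_upto n \<psi> \<Longrightarrow> diff_upto n (\<lambda>x. \<phi> x + \<psi> x)"
  by (induction n arbitrary: \<phi> \<psi>) (auto simp: diff_upto_Suc diff_upto_0 dirderiv_add)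

lemma diff_upto_mult: "diff_upto n \<phi> \<Longrightarrow> diff_upto n \<psi> \<Longrightarrow> diff_upto n (\<lambda>x. \<phi> x * \<psi> x)"
proof (induction n arbitrary: \<phi> \<psi>)
  case (Suc n)
  then have "diff_upto n \<phi>" "diff_upto n \<psi>" using diff_upto_mono[of "Suc n" _ n] by simp_all
  with Suc show ?case by (auto simp: diff_upto_Suc dirderiv_mult intro!: diff_upto_add)
qed (auto simp: diff_upto_0)

lemma smooth_const: "smooth (\<lambda>x. c)"
  and smooth_add: "smooth \<phi> \<Longrightarrow> smooth \<psi> \<Longrightarrow> smooth (\<lambda>x. \<phi> x + \<psi> x)"
  and smooth_mult: "smooth \<phi> \<Longrightarrow> smooth \<psi> \<Longrightarrow> smooth (\<lambda>x. \<phi> x * \<psi> x)"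
  by (auto simp: smooth_iff_diff_upto diff_upto_const diff_upto_add diff_upto_mult)

lemma smooth_cmult: "smooth \<phi> \<Longrightarrow> smooth (\<lambda>x. c * \<phi> x)"
  by (intro smooth_mult smooth_const)

lemma smooth_diff: "smooth \<phi> \<Longrightarrow> smooth \<psi> \<Longrightarrow> smooth (\<lambda>x. \<phi> x - \<psi> x)"
  using smooth_add[OF _ smooth_cmult[of \<psi> "-1"], of \<phi>] by simp

lemma smooth_sum: "(\<And>i. i \<in> I \<Longrightarrow> smooth (\<phi> i)) \<Longrightarrow> smooth (\<lambda>x. \<Sum>i\<in>I. \<phi> i x)"
  by (induction I rule: infinite_finite_induct) (auto intro: smooth_const smooth_add)

lemma smooth_prod: "(\<And>i. i \<in> I \<Longrightarrow> smooth (\<phi> i)) \<Longrightarrow> smooth (\<lambda>x. \<Prod>i\<in>I. \<phi> i x)"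
  by (induction I rule: infinite_finite_induct) (auto intro: smooth_const smooth_mult)

lemma smooth_translate:
  assumes "smooth \<phi>" shows "smooth (\<lambda>x. \<phi> (x + a))"
proof -
  have "diff_upto n \<phi> \<Longrightarrow> diff_upto n (\<lambda>x. \<phi> (x + a))" for n and \<phi> :: "'a \<Rightarrow> real"
  proof (induction n arbitrary: \<phi>)
    case 0
    have "(\<lambda>x. \<phi> (x + a)) differentiable (at x)" for x
      using differentiable_chain_at[of "\<lambda>x. x + a" x \<phi>] 0 by (auto simp: o_def diff_upto_0)
    then show ?case by (simp add: diff_upto_0)
  next
    case (Suc n)
    have "(\<lambda>x. \<phi> (x + a)) differentiable (at x)" for x
      using differentiable_chain_at[of "\<lambda>x. x + a" x \<phi>] Suc by (auto simp: o_def diff_upto_Suc)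
    with Suc show ?case by (auto simp: diff_upto_Suc dirderiv_translate)
  qed
  with assms show ?thesis by (simp add: smooth_iff_diff_upto)
qed

lemma smooth_bounded_linear:
  assumes "bounded_linear f" shows "smooth f"
  by (subst smooth_iff)
     (auto simp: dirderiv_eqI[OF bounded_linear_imp_has_derivative[OF assms]] smooth_const
       intro: bounded_linear_imp_differentiable assms)

lemma smooth_norm_square: "smooth (\<lambda>x::'a::euclidean_space. (norm (x - a))\<^sup>2)"
proof -
  have "(\<lambda>x::'a. (norm (x - a))\<^sup>2) = (\<lambda>x. \<Sum>b\<in>Basis. (x \<bullet> b - a \<bullet> b) * (x \<bullet> b - a \<bullet> b))"
    by (rule ext, subst power2_norm_eq_inner, subst euclidean_inner) (simp only: inner_diff_left)
  then show ?thesis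
    by (simp only:) (intro smooth_sum smooth_mult smooth_diff smooth_const smooth_bounded_linear bounded_linear_inner_left)
qed

text \<open>The derivative of 1/g is -(1/g)^2 g', again built from 1/g itself and smooth factors, so
  the induction on the order of differentiability feeds on its own hypothesis.\<close>

lemma smooth_inverse:
  assumes "smooth g" "\<And>x. g x \<noteq> 0"
  shows "smooth (\<lambda>x. inverse (g x))"
proof -
  have d: "((\<lambda>x. inverse (g x)) has_derivative (\<lambda>v. - (inverse (g x) * dirderiv v g x * inverse (g x)))) (at x)" for x
    by (rule Deriv.has_derivative_inverse) (use assms smooth_has_derivative[of g x] in simp_all)
  have d2: "(\<lambda>x. inverse (g x)) differentiable (at x)" for x using d[of x] unfolding differentiable_def by blast
  have "diff_upto n (\<lambda>x. inverse (g x))" for n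
  proof (induction n)
    case (Suc n)
    have "dirderiv v (\<lambda>x. inverse (g x)) =
       (\<lambda>x. (-1) * (inverse (g x) * (dirderiv v g x * inverse (g x))))" for v
      by (subst dirderiv_eqI[OF d]) (simp add: mult.assoc)
    moreover have "diff_upto n (dirderiv v g)" for v
      using smooth_dirderiv[OF assms(1)] by (simp add: smooth_iff_diff_upto)
    ultimately show ?case using Suc d2
      by (auto simp only: diff_upto_Suc intro!: diff_upto_mult diff_upto_const)
  qed (use d2 in \<open>auto simp: diff_upto_0\<close>)
  then show ?thesis by (simp add: smooth_iff_diff_upto)
qed

section \<open>Cutoffs, supports and distributions\<close>

text \<open>x^(-k) e^(-1/x), continued by 0. The whole family in \<open>k\<close> is carried because
  differentiation maps it into itself with larger \<open>k\<close>; \<open>k = 0\<close> is the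
  classical flat function.\<close>

definition flat_exp :: "nat \<Rightarrow> real \<Rightarrow> real" where
  "flat_exp k x = (if x > 0 then inverse x ^ k * exp (- inverse x) else 0)"

lemma flat_exp_nonneg: "flat_exp k x \<ge> 0"
  by (simp add: flat_exp_def)

lemma flat_exp_tendsto_0: "(flat_exp k \<longlongrightarrow> 0) (at 0)"
proof (rule filterlim_split_at)
  show "(flat_exp k \<longlongrightarrow> 0) (at_left 0)"
    by (rule Lim_transform_eventually[OF tendsto_const])
       (auto simp: flat_exp_def eventually_at_left_field intro!: exI[of _ "-1"])
  have "((\<lambda>x. inverse x ^ k / exp (inverse x)) \<longlongrightarrow> 0) (at_right (0::real))"
    by (rule filterlim_compose[OF tendsto_power_div_exp_0 filterlim_inverse_at_top_right])
  then show "(flat_exp k \<longlongrightarrow> 0) (at_right 0)"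
    by (rule Lim_transform_eventually)
       (auto simp: flat_exp_def exp_minus field_simps eventually_at_right_field intro!: exI[of _ 1])
qed

lemma flat_exp_deriv:
  "(flat_exp k has_real_derivative (flat_exp (k+2) x - k * flat_exp (k+1) x)) (at x)"
proof -
  consider "x > 0" | "x < 0" | "x = 0" by linarith
  then show ?thesis
  proof cases
    case 1
    have "((\<lambda>x. inverse x ^ k * exp (- inverse x)) has_real_derivative
       real k * inverse x ^ (k - 1) * (- (inverse x * inverse x)) * exp (- inverse x)
         + inverse x ^ k * (exp (- inverse x) * (inverse x * inverse x))) (at x)"
      using 1 by (auto intro!: derivative_eq_intros)
    also have "real k * inverse x ^ (k - 1) * (- (inverse x * inverse x)) * exp (- inverse x)
         + inverse x ^ k * (exp (- inverse x) * (inverse x * inverse x))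
         = flat_exp (k+2) x - k * flat_exp (k+1) x"
      using 1 by (cases k) (simp_all add: flat_exp_def algebra_simps)
    finally have "((\<lambda>x. inverse x ^ k * exp (- inverse x)) has_real_derivative
       (flat_exp (k+2) x - k * flat_exp (k+1) x)) (at x)" .
    then show ?thesis
      by (rule has_field_derivative_transform_within[where d = x])
         (use 1 in \<open>auto simp: flat_exp_def dist_real_def\<close>)
  next
    case 2
    have "((\<lambda>x. 0) has_real_derivative (flat_exp (k+2) x - k * flat_exp (k+1) x)) (at x)"
      using 2 by (simp add: flat_exp_def)
    then show ?thesis
      by (rule has_field_derivative_transform_within[where d = "-x"])
         (use 2 in \<open>auto simp: flat_exp_def dist_real_def\<close>)
  next
    case 3
    \<comment> \<open>At the origin the difference quotient of one member is exactly the next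
      member, so the derivative there is a limit already known.\<close>
    have "(\<lambda>h. (flat_exp k (0 + h) - flat_exp k 0) / h) = flat_exp (k+1)"
      by (auto simp: flat_exp_def field_simps)
    with flat_exp_tendsto_0[of "k+1"] have "(flat_exp k has_real_derivative 0) (at 0)"
      by (simp add: DERIV_def)
    with 3 show ?thesis by (simp add: flat_exp_def)
  qed
qed

lemma smooth_flat_exp:
  assumes "smooth \<rho>"
  shows "smooth (\<lambda>x. flat_exp k (\<rho> x))"
proof -
  have d: "((\<lambda>x. flat_exp k (\<rho> x)) has_derivative
      (\<lambda>v. (flat_exp (k+2) (\<rho> x) - k * flat_exp (k+1) (\<rho> x)) * dirderiv v \<rho> x)) (at x)" for k x
    using has_derivative_compose[OF smooth_has_derivative[OF assms]
        flat_exp_deriv[unfolded has_field_derivative_def]] by simp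
  have d2: "(\<lambda>x. flat_exp k (\<rho> x)) differentiable (at x)" for k x
    using d[of k x] unfolding differentiable_def by blast
  have "diff_upto n (\<lambda>x. flat_exp k (\<rho> x))" for n
  proof (induction n arbitrary: k)
    case (Suc n)
    have "dirderiv v (\<lambda>x. flat_exp k (\<rho> x)) =
       (\<lambda>x. (flat_exp (k+2) (\<rho> x) + (- real k) * flat_exp (k+1) (\<rho> x)) * dirderiv v \<rho> x)" for v
      by (subst dirderiv_eqI[OF d]) simp
    then show ?case using Suc d2 smooth_dirderiv[OF assms(1)]
      by (auto simp only: diff_upto_Suc smooth_iff_diff_upto intro!: diff_upto_mult diff_upto_add diff_upto_const)
  qed (use d2 in \<open>auto simp: diff_upto_0\<close>)
  then show ?thesis by (simp add: smooth_iff_diff_upto)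
qed

lemma exists_ball_cutoff:
  fixes a :: "'a::euclidean_space"
  assumes "r > 0"
  shows "\<exists>b. smooth b \<and> (\<forall>x\<in>ball a r. b x = 1) \<and> (\<forall>x. x \<notin> ball a (2 * r) \<longrightarrow> b x = 0)"
proof -
  \<comment> \<open>Affine in the squared distance, hence smooth also at the centre; normalised to
    be 1 at distance \<open>r\<close> and 0 at distance \<open>2 * r\<close>.\<close>
  define \<rho> where "\<rho> = (\<lambda>x::'a. (1 / (3 * r\<^sup>2)) * (4 * r\<^sup>2 - (norm (x - a))\<^sup>2))"
  \<comment> \<open>The quotient is 1 once \<rho> \<ge> 1 and 0 once \<rho> \<le> 0; its denominator
    never vanishes since \<rho> and 1 - \<rho> cannot both be nonpositive.\<close>
  define b where "b = (\<lambda>x. flat_exp 0 (\<rho> x) * inverse (flat_exp 0 (\<rho> x) + flat_exp 0 (1 - \<rho> x)))"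
  have \<rho>: "smooth \<rho>" unfolding \<rho>_def
    by (intro smooth_mult smooth_diff smooth_const smooth_norm_square)
  have pos: "flat_exp 0 (\<rho> x) + flat_exp 0 (1 - \<rho> x) \<noteq> 0" for x
  proof (cases "\<rho> x > 0")
    case False
    then have "flat_exp 0 (1 - \<rho> x) > 0" by (simp add: flat_exp_def)
    then show ?thesis using flat_exp_nonneg[of 0 "\<rho> x"] by linarith
  next
    case True
    then have "flat_exp 0 (\<rho> x) > 0" by (simp add: flat_exp_def)
    then show ?thesis using flat_exp_nonneg[of 0 "1 - \<rho> x"] by linarith
  qed
  have "smooth b" unfolding b_def
    by (intro smooth_mult smooth_inverse smooth_add smooth_flat_exp smooth_diff smooth_const \<rho> pos)
  moreover have "b x = 1" if "x \<in> ball a r" for x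
  proof -
    have "(norm (x - a))\<^sup>2 \<le> r\<^sup>2" using that
      by (intro power_mono) (simp_all add: dist_norm norm_minus_commute[of x a])
    then have "\<rho> x \<ge> 1" using assms by (simp add: \<rho>_def field_simps)
    then show ?thesis using pos[of x] by (simp add: b_def flat_exp_def)
  qed
  moreover have "b x = 0" if "x \<notin> ball a (2 * r)" for x
  proof -
    have "(2*r)\<^sup>2 \<le> (norm (x - a))\<^sup>2" using that assms
      by (intro power_mono) (simp_all add: dist_norm norm_minus_commute[of x a])
    then have "\<rho> x \<le> 0" using assms by (simp add: \<rho>_def divide_le_0_iff)
    then show ?thesis by (simp add: b_def flat_exp_def)
  qed
  ultimately show ?thesis by blast
qed

section \<open>Supports and test functions\<close>

lemma fun_support_subset: "closed K \<Longrightarrow> (\<And>x. \<phi> x \<noteq> 0 \<Longrightarrow> x \<in> K) \<Longrightarrow> fun_support \<phi> \<subseteq> K"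
  unfolding fun_support_def by (rule closure_minimal) auto

lemma not_in_fun_support: "x \<notin> fun_support \<phi> \<Longrightarrow> \<phi> x = 0"
  using closure_subset[of "{x. \<phi> x \<noteq> 0}"] by (auto simp: fun_support_def)

lemma closed_fun_support: "closed (fun_support \<phi>)"
  by (simp add: fun_support_def)

lemma test_functionI:
  assumes "smooth \<phi>" "compact K" "\<And>x. \<phi> x \<noteq> 0 \<Longrightarrow> x \<in> K"
  shows "test_function \<phi>"
proof -
  have "fun_support \<phi> \<subseteq> K" using assms by (intro fun_support_subset compact_imp_closed)
  then show ?thesis unfolding test_function_def using assms
    by (metis Int_absorb1 closed_fun_support compact_Int_closed)
qed

lemma exists_cutoff:
  fixes S :: "'a::euclidean_space set"
  assumes "compact S" "open U" "S \<subseteq> U"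
  shows "\<exists>\<eta> V. test_function \<eta> \<and> fun_support \<eta> \<subseteq> U \<and> open V \<and> S \<subseteq> V \<and> (\<forall>x\<in>V. \<eta> x = 1)"
proof -
  have "\<exists>r>0. cball x (2 * r) \<subseteq> U" if xS: "x \<in> S" for x
  proof -
    obtain e where "e > 0" "cball x e \<subseteq> U" using assms(2)[unfolded open_contains_cball] subsetD[OF assms(3) xS] by auto
    then have "e / 2 > 0 \<and> cball x (2 * (e / 2)) \<subseteq> U" by simp
    then show ?thesis by blast
  qed
  then obtain r where r: "\<And>x. x \<in> S \<Longrightarrow> r x > 0 \<and> cball x (2 * r x) \<subseteq> U" by metis
  have "\<forall>x\<in>S. \<exists>b. smooth b \<and> (\<forall>y\<in>ball x (r x). b y = (1::real)) \<and> (\<forall>y. y \<notin> ball x (2 * r x) \<longrightarrow> b y = 0)"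
    using exists_ball_cutoff r by blast
  then obtain b where b: "\<And>x. x \<in> S \<Longrightarrow> smooth (b x)"
      "\<And>x y. x \<in> S \<Longrightarrow> y \<in> ball x (r x) \<Longrightarrow> b x y = (1::real)"
      "\<And>x y. x \<in> S \<Longrightarrow> y \<notin> ball x (2 * r x) \<Longrightarrow> b x y = 0"
    by metis
  have "S \<subseteq> (\<Union>x\<in>S. ball x (r x))" using r by auto
  then obtain F where F: "F \<subseteq> S" "finite F" "S \<subseteq> (\<Union>x\<in>F. ball x (r x))"
    by (rule compactE_image[OF assms(1), rotated]) auto
  \<comment> \<open>This is 1 as soon as one bump equals 1, and 0 where all of them vanish; a plain
    sum of bumps could exceed 1 on overlaps.\<close>
  define \<eta> where "\<eta> = (\<lambda>y. 1 - (\<Prod>x\<in>F. 1 - b x y))"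
  define K where "K = (\<Union>x\<in>F. cball x (2 * r x))"
  have K: "compact K" "K \<subseteq> U" unfolding K_def using F r by (auto intro!: compact_UN)
  have sm: "smooth \<eta>" unfolding \<eta>_def
    using F b by (intro smooth_diff smooth_prod smooth_const) auto
  have z: "y \<in> K" if "\<eta> y \<noteq> 0" for y
  proof (rule ccontr)
    assume "y \<notin> K"
    then have "b x y = 0" if "x \<in> F" for x
      using that F(1) by (intro b(3)) (auto simp: K_def)
    then have "\<eta> y = 0" by (simp add: \<eta>_def)
    with that show False by blast
  qed
  have "\<eta> y = 1" if y: "y \<in> (\<Union>x\<in>F. ball x (r x))" for y
  proof -
    obtain x where "x \<in> F" "b x y = 1" using y F(1) b(2) by blast
    then have "(\<Prod>x\<in>F. 1 - b x y) = 0" using F(2) by (intro prod_zero) auto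
    then show ?thesis by (simp add: \<eta>_def)
  qed
  moreover have "test_function \<eta>" by (rule test_functionI[OF sm K(1) z])
  moreover have "fun_support \<eta> \<subseteq> U"
    using fun_support_subset[OF compact_imp_closed[OF K(1)] z] K(2) by blast
  moreover have "open (\<Union>x\<in>F. ball x (r x))" by blast
  ultimately show ?thesis using F(3) by blast
qed

lemma test_function_smooth: "test_function \<phi> \<Longrightarrow> smooth \<phi>"
  by (simp add: test_function_def)

lemma test_function_mult:
  assumes "test_function \<phi>" "smooth \<psi>"
  shows "test_function (\<lambda>x. \<phi> x * \<psi> x)" "test_function (\<lambda>x. \<psi> x * \<phi> x)"
  by (rule test_functionI[where K = "fun_support \<phi>"];
      use assms not_in_fun_support[of _ \<phi>] in \<open>force simp: test_function_def intro: smooth_mult\<close>)+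

lemma test_function_cmult: "test_function \<phi> \<Longrightarrow> test_function (\<lambda>x. c * \<phi> x)"
  by (intro test_function_mult smooth_const)

lemma test_function_add:
  assumes "test_function \<phi>" "test_function \<psi>"
  shows "test_function (\<lambda>x. \<phi> x + \<psi> x)"
proof (rule test_functionI[where K = "fun_support \<phi> \<union> fun_support \<psi>"])
  show "x \<in> fun_support \<phi> \<union> fun_support \<psi>" if "\<phi> x + \<psi> x \<noteq> 0" for x
    using that not_in_fun_support[of x \<phi>] not_in_fun_support[of x \<psi>] by (metis UnI1 UnI2 add_0)
qed (use assms in \<open>auto simp: test_function_def intro: smooth_add\<close>)

lemma test_function_diff:
  assumes "test_function \<phi>" "test_function \<psi>"
  shows "test_function (\<lambda>x. \<phi> x - \<psi> x)"
  using test_function_add[OF assms(1) test_function_cmult[OF assms(2), of "-1"]] by simp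

lemma fun_support_dirderiv:
  assumes "smooth \<phi>"
  shows "fun_support (dirderiv v \<phi>) \<subseteq> fun_support \<phi>"
proof (rule fun_support_subset[OF closed_fun_support])
  fix x assume *: "dirderiv v \<phi> x \<noteq> 0"
  show "x \<in> fun_support \<phi>"
  proof (rule ccontr)
    assume "x \<notin> fun_support \<phi>"
    moreover have "open (- fun_support \<phi>)" using closed_fun_support by auto
    ultimately obtain d where d: "d > 0" "ball x d \<subseteq> - fun_support \<phi>"
      by (meson ComplI open_contains_ball)
    have "((\<lambda>_. 0) has_derivative (\<lambda>v. dirderiv v \<phi> x)) (at x)"
      by (rule has_derivative_transform_within[OF smooth_has_derivative[OF assms] d(1)])
         (use d not_in_fun_support[of _ \<phi>] in \<open>auto simp: dist_commute subset_iff\<close>)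
    then have "(\<lambda>v. dirderiv v \<phi> x) = (\<lambda>_. 0)"
      by (rule has_derivative_unique[OF _ has_derivative_const])
    with * show False by metis
  qed
qed

lemma fun_support_iter_deriv: "smooth \<phi> \<Longrightarrow> fun_support (iter_deriv vs \<phi>) \<subseteq> fun_support \<phi>"
proof (induction vs)
  case (Cons v vs)
  then show ?case unfolding iter_deriv_Cons
    using fun_support_dirderiv[OF smooth_iter_deriv[OF Cons.prems], of v vs] by blast
qed simp

lemma test_function_iter_deriv:
  assumes "test_function \<phi>"
  shows "test_function (iter_deriv vs \<phi>)"
  using assms fun_support_iter_deriv[of \<phi> vs] smooth_iter_deriv[of \<phi> vs]
  by (metis Int_absorb1 closed_fun_support compact_Int_closed test_function_def)

lemma test_function_dirderiv: "test_function \<phi> \<Longrightarrow> test_function (dirderiv v \<phi>)"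
  using test_function_iter_deriv[of \<phi> "[v]"] by (simp add: dirderiv_def)

lemma test_function_bounded:
  fixes \<phi> :: "'a::euclidean_space \<Rightarrow> real"
  assumes "test_function \<phi>"
  shows "\<exists>B. \<forall>x. \<bar>\<phi> x\<bar> \<le> B"
proof -
  have "bounded (\<phi> ` fun_support \<phi>)"
    using assms unfolding test_function_def
    by (intro compact_imp_bounded compact_continuous_image smooth_continuous_on) auto
  then obtain B where B: "\<And>x. x \<in> fun_support \<phi> \<Longrightarrow> \<bar>\<phi> x\<bar> \<le> B"
    by (auto simp: bounded_iff)
  have "\<bar>\<phi> x\<bar> \<le> max B 0" for x
    using B[of x] not_in_fun_support[of x \<phi>] by (cases "x \<in> fun_support \<phi>") auto
  then show ?thesis by blast
qed

text \<open>Compact support is lost under half Laplacians and adjoint potentials. Bounds on every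
  derivative survive the former, and the latter for functions of bounded time support; they suffice
  for integrating second differences against a Levy kernel.\<close>

definition smooth_bounded :: "('a::real_normed_vector \<Rightarrow> real) \<Rightarrow> bool" where
  "smooth_bounded \<phi> \<longleftrightarrow> smooth \<phi> \<and> (\<forall>vs. \<exists>B. \<forall>x. \<bar>iter_deriv vs \<phi> x\<bar> \<le> B)"

lemma test_function_smooth_bounded: "test_function \<phi> \<Longrightarrow> smooth_bounded (\<phi> :: 'a::euclidean_space \<Rightarrow> real)"
  unfolding smooth_bounded_def
  using test_function_bounded test_function_iter_deriv test_function_smooth by blast

lemma smooth_bounded_iter_deriv: "smooth_bounded \<phi> \<Longrightarrow> smooth_bounded (iter_deriv vs \<phi>)"
  unfolding smooth_bounded_def by (metis iter_deriv_append smooth_iter_deriv)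

lemma smooth_bounded_dirderiv: "smooth_bounded \<phi> \<Longrightarrow> smooth_bounded (dirderiv v \<phi>)"
  using smooth_bounded_iter_deriv[of \<phi> "[v]"] by (simp add: dirderiv_def)

lemma smooth_bounded_smooth: "smooth_bounded \<phi> \<Longrightarrow> smooth \<phi>"
  by (simp add: smooth_bounded_def)

lemma iter_deriv_zero: "iter_deriv vs (\<lambda>x. 0) = (\<lambda>x. 0)"
  by (induction vs) (simp_all add: iter_deriv_Cons dirderiv_const del: iter_deriv.simps(2))

lemma iter_deriv_add:
  assumes "smooth \<phi>" "smooth \<psi>"
  shows "iter_deriv vs (\<lambda>x. \<phi> x + \<psi> x) = (\<lambda>x. iter_deriv vs \<phi> x + iter_deriv vs \<psi> x)"
  by (induction vs)
     (simp_all add: iter_deriv_Cons dirderiv_add smooth_differentiable smooth_iter_deriv assms del: iter_deriv.simps(2))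

lemma iter_deriv_cmult:
  assumes "smooth \<phi>"
  shows "iter_deriv vs (\<lambda>x. c * \<phi> x) = (\<lambda>x. c * iter_deriv vs \<phi> x)"
  by (induction vs)
     (simp_all add: iter_deriv_Cons dirderiv_cmult smooth_differentiable smooth_iter_deriv assms del: iter_deriv.simps(2))

lemma iter_deriv_sum:
  assumes "\<And>i. i \<in> I \<Longrightarrow> smooth (\<phi> i)"
  shows "iter_deriv vs (\<lambda>x. \<Sum>i\<in>I. \<phi> i x) = (\<lambda>x. \<Sum>i\<in>I. iter_deriv vs (\<phi> i) x)"
  using assms by (induction I rule: infinite_finite_induct)
    (simp_all add: iter_deriv_zero iter_deriv_add smooth_sum)

text \<open>Multilinearity: each of the \<open>k\<close> directions is expanded in the basis with
  coefficients at most its norm, which costs a factor \<open>DIM('a)\<close> per slot. This links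
  \<open>Ck_norm\<close>, which tests basis directions only, with differences along an arbitrary
  \<open>h\<close>.\<close>

lemma iter_deriv_bound:
  fixes \<phi> :: "'a::euclidean_space \<Rightarrow> real"
  assumes "smooth \<phi>" "\<And>vs x. set vs \<subseteq> Basis \<Longrightarrow> length vs = k \<Longrightarrow> \<bar>iter_deriv vs \<phi> x\<bar> \<le> B"
    and "length vs = k"
  shows "\<bar>iter_deriv vs \<phi> x\<bar> \<le> real DIM('a) ^ k * B * prod_list (map norm vs)"
  using assms
proof (induction k arbitrary: vs \<phi>)
  case 0
  then show ?case by force
next
  case (Suc k)
  obtain ws v where vs: "vs = ws @ [v]" "length ws = k"
    using Suc.prems(3) by (cases vs rule: rev_cases) auto
  have "dirderiv v \<phi> = (\<lambda>x. \<Sum>b\<in>Basis. (v \<bullet> b) * dirderiv b \<phi> x)"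
  proof
    fix x
    interpret bounded_linear "\<lambda>v. dirderiv v \<phi> x"
      using smooth_has_derivative[OF Suc.prems(1)] by (rule has_derivative_bounded_linear)
    show "dirderiv v \<phi> x = (\<Sum>b\<in>Basis. (v \<bullet> b) * dirderiv b \<phi> x)"
      using sum[of "\<lambda>b. (v \<bullet> b) *\<^sub>R b" Basis] by (simp add: euclidean_representation scale)
  qed
  then have "iter_deriv vs \<phi> = (\<lambda>x. \<Sum>b\<in>Basis. (v \<bullet> b) * iter_deriv ws (dirderiv b \<phi>) x)"
    using Suc.prems(1)
    by (simp add: vs iter_deriv_snoc iter_deriv_sum iter_deriv_cmult smooth_dirderiv smooth_cmult)
  then have "\<bar>iter_deriv vs \<phi> x\<bar> \<le> (\<Sum>b\<in>Basis. \<bar>v \<bullet> b\<bar> * \<bar>iter_deriv ws (dirderiv b \<phi>) x\<bar>)"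
    by (simp add: sum_abs[THEN order_trans] abs_mult)
  also have "\<dots> \<le> (\<Sum>b\<in>(Basis::'a set). norm v * (real DIM('a) ^ k * B * prod_list (map norm ws)))"
  proof (intro sum_mono mult_mono)
    fix b :: 'a assume b: "b \<in> Basis"
    show "\<bar>v \<bullet> b\<bar> \<le> norm v" using b by (rule Basis_le_norm)
    show "\<bar>iter_deriv ws (dirderiv b \<phi>) x\<bar> \<le> real DIM('a) ^ k * B * prod_list (map norm ws)"
    proof (rule Suc.IH)
      show "\<bar>iter_deriv us (dirderiv b \<phi>) x\<bar> \<le> B" if "set us \<subseteq> Basis" "length us = k" for us x
        using Suc.prems(2)[of "us @ [b]" x] that b by (simp add: iter_deriv_snoc)
    qed (use Suc.prems vs in \<open>auto intro: smooth_dirderiv\<close>)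
  qed auto
  also have "\<dots> = real DIM('a) ^ Suc k * B * prod_list (map norm vs)"
    by (simp add: vs algebra_simps)
  finally show ?case .
qed

lemma smooth_bounded_iter_deriv_bound:
  fixes \<phi> :: "'a::euclidean_space \<Rightarrow> real"
  assumes "smooth_bounded \<phi>"
  obtains B where "B \<ge> 0" "\<And>vs x. length vs = k \<Longrightarrow> \<bar>iter_deriv vs \<phi> x\<bar> \<le> B * prod_list (map norm vs)"
proof -
  define A where "A = {vs::'a list. set vs \<subseteq> Basis \<and> length vs = k}"
  have fin: "finite A" unfolding A_def by (rule finite_lists_length_eq) simp
  obtain C where C: "\<And>vs x. \<bar>iter_deriv vs \<phi> x\<bar> \<le> C vs"
    using assms unfolding smooth_bounded_def by metis
  have C0: "0 \<le> C vs" for vs using C[of vs undefined] by linarith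
  have "\<bar>iter_deriv vs \<phi> x\<bar> \<le> real DIM('a) ^ k * (\<Sum>vs\<in>A. C vs) * prod_list (map norm vs)"
    if "length vs = k" for vs x
  proof (rule iter_deriv_bound[OF _ _ that])
    show "\<bar>iter_deriv us \<phi> x\<bar> \<le> (\<Sum>vs\<in>A. C vs)" if "set us \<subseteq> Basis" "length us = k" for us x
      using C[of us x] member_le_sum[of us A C] fin C0 that unfolding A_def by force
  qed (use assms in \<open>simp add: smooth_bounded_def\<close>)
  then show ?thesis using that[of "real DIM('a) ^ k * (\<Sum>vs\<in>A. C vs)"] C0 by (simp add: sum_nonneg)
qed

lemma finite_Ck_index: "finite {vs::'a::euclidean_space list. set vs \<subseteq> Basis \<and> length vs \<le> m}"
  by (rule finite_lists_length_le) simp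

lemma iter_deriv_le_SUP:
  assumes "smooth_bounded \<phi>"
  shows "\<bar>iter_deriv vs \<phi> x\<bar> \<le> (SUP x. \<bar>iter_deriv vs \<phi> x\<bar>)"
proof -
  obtain B where "\<And>x. \<bar>iter_deriv vs \<phi> x\<bar> \<le> B" using assms unfolding smooth_bounded_def by blast
  then show ?thesis by (intro cSUP_upper bdd_aboveI2[where M = B]) auto
qed

lemma Ck_norm_upper:
  fixes \<phi> :: "'a::euclidean_space \<Rightarrow> real"
  assumes "smooth_bounded \<phi>" "set vs \<subseteq> Basis" "length vs \<le> m"
  shows "\<bar>iter_deriv vs \<phi> x\<bar> \<le> Ck_norm m \<phi>"
proof -
  have "0 \<le> (SUP x. \<bar>iter_deriv vs \<phi> x\<bar>)" for vs
    using iter_deriv_le_SUP[OF assms(1), of vs undefined] by linarith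
  then have "(SUP x. \<bar>iter_deriv vs \<phi> x\<bar>) \<le> Ck_norm m \<phi>"
    unfolding Ck_norm_def using finite_Ck_index[of m] assms(2,3)
    by (intro member_le_sum[where f = "\<lambda>vs. SUP x. \<bar>iter_deriv vs \<phi> x\<bar>"]) auto
  then show ?thesis using iter_deriv_le_SUP[OF assms(1), of vs x] by linarith
qed

lemma Ck_norm_le:
  fixes \<phi> :: "'a::euclidean_space \<Rightarrow> real"
  assumes "\<And>vs x. set vs \<subseteq> Basis \<Longrightarrow> length vs \<le> m \<Longrightarrow> \<bar>iter_deriv vs \<phi> x\<bar> \<le> B"
  shows "Ck_norm m \<phi> \<le> real (card {vs::'a list. set vs \<subseteq> Basis \<and> length vs \<le> m}) * B"
  unfolding Ck_norm_def using assms by (intro sum_bounded_above) (auto intro!: cSUP_least)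

text \<open>Leibniz rule without binomial bookkeeping: every derivative doubles the number of
  products, and each product stays below \<open>A * B\<close>.\<close>

lemma iter_deriv_mult_bound:
  fixes \<phi> \<psi> :: "'a::euclidean_space \<Rightarrow> real"
  assumes "smooth \<phi>" "smooth \<psi>"
    and "\<And>vs x. set vs \<subseteq> Basis \<Longrightarrow> length vs \<le> m \<Longrightarrow> \<bar>iter_deriv vs \<phi> x\<bar> \<le> A"
    and "\<And>vs x. set vs \<subseteq> Basis \<Longrightarrow> length vs \<le> m \<Longrightarrow> \<bar>iter_deriv vs \<psi> x\<bar> \<le> B"
    and "set vs \<subseteq> Basis" "length vs \<le> m"
  shows "\<bar>iter_deriv vs (\<lambda>x. \<phi> x * \<psi> x) x\<bar> \<le> 2 ^ m * (A * B)"
  using assms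
proof (induction m arbitrary: \<phi> \<psi> vs)
  case 0
  have *: "\<bar>\<phi> x\<bar> \<le> A" "\<bar>\<psi> x\<bar> \<le> B" using "0.prems"(3)[of "[]" x] "0.prems"(4)[of "[]" x] by auto
  then have "A \<ge> 0" by linarith
  with * 0 show ?case by (auto simp: abs_mult intro!: mult_mono)
next
  case (Suc m)
  have AB: "\<bar>\<phi> x\<bar> \<le> A" "\<bar>\<psi> x\<bar> \<le> B" using Suc.prems(3)[of "[]" x] Suc.prems(4)[of "[]" x] by auto
  then have AB0: "0 \<le> A * B" by (intro mult_nonneg_nonneg) linarith+
  show ?case
  proof (cases vs rule: rev_cases)
    case Nil
    have "A \<ge> 0" using AB by linarith
    then have "\<bar>\<phi> x * \<psi> x\<bar> \<le> A * B" using AB by (auto simp: abs_mult intro!: mult_mono)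
    also have "\<dots> \<le> 2 ^ Suc m * (A * B)"
      using mult_right_mono[OF one_le_power[of 2 "Suc m"] AB0] by simp
    finally show ?thesis using Nil by simp
  next
    case (snoc ws v)
    then have v: "v \<in> Basis" and ws: "set ws \<subseteq> Basis" "length ws \<le> m" using Suc.prems by auto
    have d: "smooth (dirderiv v \<phi>)" "smooth (dirderiv v \<psi>)" using Suc.prems(1,2) by (auto intro: smooth_dirderiv)
    have "iter_deriv vs (\<lambda>x. \<phi> x * \<psi> x) x =
        iter_deriv ws (\<lambda>x. \<phi> x * dirderiv v \<psi> x) x + iter_deriv ws (\<lambda>x. dirderiv v \<phi> x * \<psi> x) x"
      using Suc.prems(1,2) d
      by (simp add: snoc iter_deriv_snoc dirderiv_mult smooth_differentiable iter_deriv_add smooth_mult)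
    moreover have "\<bar>iter_deriv ws (\<lambda>x. \<phi> x * dirderiv v \<psi> x) x\<bar> \<le> 2 ^ m * (A * B)"
    proof (rule Suc.IH)
      show "\<bar>iter_deriv us (dirderiv v \<psi>) x\<bar> \<le> B" if "set us \<subseteq> Basis" "length us \<le> m" for us x
        using Suc.prems(4)[of "us @ [v]" x] that v by (simp add: iter_deriv_snoc)
    qed (use Suc.prems ws d in auto)
    moreover have "\<bar>iter_deriv ws (\<lambda>x. dirderiv v \<phi> x * \<psi> x) x\<bar> \<le> 2 ^ m * (A * B)"
    proof (rule Suc.IH)
      show "\<bar>iter_deriv us (dirderiv v \<phi>) x\<bar> \<le> A" if "set us \<subseteq> Basis" "length us \<le> m" for us x
        using Suc.prems(3)[of "us @ [v]" x] that v by (simp add: iter_deriv_snoc)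
    qed (use Suc.prems ws d in auto)
    ultimately show ?thesis by simp
  qed
qed

lemma dirderiv_lipschitz:
  assumes "smooth \<phi>" "\<And>v x. \<bar>dirderiv v \<phi> x\<bar> \<le> B * norm v"
    "B \<ge> 0"
  shows "\<bar>\<phi> x - \<phi> y\<bar> \<le> B * norm (x - y)"
proof -
  have "norm (\<phi> x - \<phi> y) \<le> B * norm (x - y)"
  proof (rule differentiable_bound[OF convex_UNIV])
    show "(\<phi> has_derivative (\<lambda>v. dirderiv v \<phi> x)) (at x within UNIV)" for x
      using smooth_has_derivative[OF assms(1)] by simp
    show "onorm (\<lambda>v. dirderiv v \<phi> x) \<le> B" for x
      by (rule onorm_bound) (use assms in auto)
  qed auto
  then show ?thesis by simp
qed

section \<open>Distributions: support, locality and pairing\<close>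

lemma distribution_zero:
  fixes T :: "('a::euclidean_space \<Rightarrow> real) \<Rightarrow> real"
  shows "distribution T \<Longrightarrow> T (\<lambda>x. 0) = 0"
proof -
  assume T: "distribution T"
  have "test_function (\<lambda>x::'a. 0)" by (rule test_functionI[OF smooth_const compact_empty]) simp
  with T have "T (\<lambda>x. 0 * 0) = 0 * T (\<lambda>x. 0)" unfolding distribution_def by blast
  then show ?thesis by simp
qed

lemma distribution_diff:
  assumes "distribution T" "test_function \<phi>" "test_function \<psi>"
  shows "T (\<lambda>x. \<phi> x - \<psi> x) = T \<phi> - T \<psi>"
proof -
  have "T (\<lambda>x. \<phi> x + (-1) * \<psi> x) = T \<phi> + (-1) * T \<psi>"
    using assms test_function_cmult[OF assms(3)] unfolding distribution_def by metis
  then show ?thesis by simp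
qed

text \<open>A two-piece partition of unity. The part of the support not covered by the other sets is
  compact and lies inside the new one, so a cutoff \<open>\<theta>\<close> near it splits
  \<open>\<phi>\<close> into a piece supported in the new set and a piece to which the induction
  hypothesis applies.\<close>

lemma vanishes_on_finite_Union:
  fixes T :: "('a::euclidean_space \<Rightarrow> real) \<Rightarrow> real"
  assumes "distribution T" "finite \<U>" "\<And>U. U \<in> \<U> \<Longrightarrow> open U \<and> vanishes_on T U"
  shows "vanishes_on T (\<Union>\<U>)"
  using assms(2,3)
proof (induction \<U>)
  case empty
  have "T \<phi> = 0" if "fun_support \<phi> \<subseteq> {}" for \<phi>
  proof -
    have "\<phi> = (\<lambda>x. 0)" using that not_in_fun_support[of _ \<phi>] by auto
    then show ?thesis using distribution_zero[OF assms(1)] by simp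
  qed
  then show ?case by (simp add: vanishes_on_def)
next
  case (insert U \<U>)
  show ?case unfolding vanishes_on_def
  proof (intro allI impI)
    fix \<phi> :: "'a \<Rightarrow> real" assume \<phi>: "test_function \<phi>" "fun_support \<phi> \<subseteq> \<Union> (insert U \<U>)"
    have op: "open (\<Union>\<U>)" "open U" using insert.prems by auto
    have c: "compact (fun_support \<phi> - \<Union>\<U>)" using \<phi>(1) op by (simp add: compact_diff test_function_def)
    have s: "fun_support \<phi> - \<Union>\<U> \<subseteq> U" using \<phi>(2) by auto
    obtain \<theta> V where \<theta>: "test_function \<theta>" "fun_support \<theta> \<subseteq> U" "open V"
        "fun_support \<phi> - \<Union>\<U> \<subseteq> V" "\<And>x. x \<in> V \<Longrightarrow> \<theta> x = 1"
      using exists_cutoff[OF c op(2) s] by blast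
    have t1: "test_function (\<lambda>x. \<theta> x * \<phi> x)" using \<theta> \<phi> by (intro test_function_mult test_function_smooth)
    have t2: "test_function (\<lambda>x. (1 - \<theta> x) * \<phi> x)"
      using \<theta> \<phi> by (intro test_function_mult smooth_diff smooth_const) (auto intro: test_function_smooth)
    have "fun_support (\<lambda>x. \<theta> x * \<phi> x) \<subseteq> fun_support \<theta>"
      by (rule fun_support_subset[OF closed_fun_support]) (use not_in_fun_support in fastforce)
    then have "T (\<lambda>x. \<theta> x * \<phi> x) = 0"
      using insert.prems[of U] t1 \<theta>(2) unfolding vanishes_on_def by blast
    moreover have "fun_support (\<lambda>x. (1 - \<theta> x) * \<phi> x) \<subseteq> fun_support \<phi> \<inter> - V"
      by (rule fun_support_subset) (use \<theta> not_in_fun_support[of _ \<phi>] in \<open>auto simp: closed_fun_support\<close>)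
    then have "T (\<lambda>x. (1 - \<theta> x) * \<phi> x) = 0"
      using insert.IH insert.prems t2 \<theta>(4) unfolding vanishes_on_def by blast
    moreover have "T (\<lambda>x. \<theta> x * \<phi> x + (1 - \<theta> x) * \<phi> x) = T (\<lambda>x. \<theta> x * \<phi> x) + T (\<lambda>x. (1 - \<theta> x) * \<phi> x)"
      using assms(1) t1 t2 unfolding distribution_def by blast
    ultimately show "T \<phi> = 0" by (simp add: algebra_simps)
  qed
qed

text \<open>The complement of the support is a union of arbitrarily many open sets on which
  \<open>T\<close> vanishes; compactness of the support of \<open>\<phi>\<close> reduces it to
  finitely many.\<close>

lemma vanishes_off_dist_support:
  fixes T :: "('a::euclidean_space \<Rightarrow> real) \<Rightarrow> real"
  assumes "distribution T" "test_function \<phi>" "fun_support \<phi> \<inter> dist_support T = {}"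
  shows "T \<phi> = 0"
proof -
  let ?\<U> = "{U. open U \<and> vanishes_on T U}"
  have "compact (fun_support \<phi>)" "fun_support \<phi> \<subseteq> \<Union>?\<U>"
    using assms by (auto simp: test_function_def dist_support_def)
  then obtain \<F> where "\<F> \<subseteq> ?\<U>" "finite \<F>" "fun_support \<phi> \<subseteq> \<Union>\<F>"
    using compactE[of "fun_support \<phi>" ?\<U>] by (metis (no_types, lifting) mem_Collect_eq)
  then show ?thesis
    using vanishes_on_finite_Union[OF assms(1), of \<F>] assms(2) unfolding vanishes_on_def by blast
qed

lemma closed_dist_support: "closed (dist_support T)"
  unfolding dist_support_def by (auto intro!: closed_Compl)

text \<open>The choice operator in \<open>dist_pairing\<close> returns a genuine cutoff only because
  one exists for a compact support; this extracts it once, so that later arguments see a fixed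
  \<open>\<eta>\<close>.\<close>

lemma dist_pairing_cutoff:
  fixes T :: "('a::euclidean_space \<Rightarrow> real) \<Rightarrow> real"
  assumes "compact (dist_support T)"
  obtains \<eta> where "cutoff_near (dist_support T) \<eta>" "\<And>\<psi>. dist_pairing T \<psi> = T (\<lambda>x. \<eta> x * \<psi> x)"
proof -
  obtain \<eta> V where "test_function \<eta>" "fun_support \<eta> \<subseteq> UNIV" "open V"
      "dist_support T \<subseteq> V" "\<And>x. x \<in> V \<Longrightarrow> \<eta> x = 1"
    using exists_cutoff[OF assms open_UNIV subset_UNIV] by blast
  then have "cutoff_near (dist_support T) \<eta>" unfolding cutoff_near_def by blast
  then have "cutoff_near (dist_support T) (SOME \<eta>. cutoff_near (dist_support T) \<eta>)"
    by (metis someI)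
  then show ?thesis using that unfolding dist_pairing_def Let_def by blast
qed

lemma distribution_cutoff_mult:
  fixes T :: "('a::euclidean_space \<Rightarrow> real) \<Rightarrow> real"
  assumes "distribution T" "cutoff_near (dist_support T) \<eta>" "test_function \<phi>"
  shows "T (\<lambda>x. \<eta> x * \<phi> x) = T \<phi>"
proof -
  obtain U where U: "open U" "dist_support T \<subseteq> U" "\<And>x. x \<in> U \<Longrightarrow> \<eta> x = 1" and \<eta>: "test_function \<eta>"
    using assms(2) unfolding cutoff_near_def by auto
  have t: "test_function (\<lambda>x. \<eta> x * \<phi> x)" using \<eta> assms(3) by (intro test_function_mult test_function_smooth)
  have "fun_support (\<lambda>x. \<phi> x - \<eta> x * \<phi> x) \<subseteq> - U"
    by (rule fun_support_subset) (use U in auto)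
  then have "T (\<lambda>x. \<phi> x - \<eta> x * \<phi> x) = 0"
    using U by (intro vanishes_off_dist_support[OF assms(1)] test_function_diff assms(3) t) auto
  then show ?thesis using distribution_diff[OF assms(1,3) t] by simp
qed

section \<open>Differentiation under the integral sign\<close>

lemma lborel_affine_unit:
  fixes t :: "'a::euclidean_space"
  assumes "\<bar>c\<bar> = 1"
  shows "distr lborel borel (\<lambda>x. t + c *\<^sub>R x) = lborel"
proof -
  have "c \<noteq> 0" using assms by auto
  then show ?thesis using lborel_affine[of c t] assms by (simp add: density_1)
qed

lemma nn_integral_lborel_affine_unit:
  fixes t :: "'a::euclidean_space"
  assumes "\<bar>c\<bar> = 1" "f \<in> borel_measurable borel"
  shows "(\<integral>\<^sup>+x. f (t + c *\<^sub>R x) \<partial>lborel) = (\<integral>\<^sup>+x. f x \<partial>lborel)"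
  by (subst (2) lborel_affine_unit[OF assms(1), of t, symmetric]) (simp add: nn_integral_distr assms(2))

lemma nn_integral_lborel_translate:
  fixes t :: "'a::euclidean_space"
  assumes "f \<in> borel_measurable borel"
  shows "(\<integral>\<^sup>+x. f (x + t) \<partial>lborel) = (\<integral>\<^sup>+x. f x \<partial>lborel)"
    and "(\<integral>\<^sup>+x. f (x - t) \<partial>lborel) = (\<integral>\<^sup>+x. f x \<partial>lborel)"
    and "(\<integral>\<^sup>+x. f (t - x) \<partial>lborel) = (\<integral>\<^sup>+x. f x \<partial>lborel)"
    and "(\<integral>\<^sup>+x. f (- x) \<partial>lborel) = (\<integral>\<^sup>+x. f x \<partial>lborel)"
  using nn_integral_lborel_affine_unit[of 1 f t] nn_integral_lborel_affine_unit[of 1 f "-t"]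
    nn_integral_lborel_affine_unit[of "-1" f t] nn_integral_lborel_affine_unit[of "-1" f 0] assms
  by (simp_all add: add.commute)

lemma integral_lborel_affine_unit:
  fixes t :: "'a::euclidean_space" and f :: "'a \<Rightarrow> 'b::{banach, second_countable_topology}"
  assumes "\<bar>c\<bar> = 1" "f \<in> borel_measurable borel"
  shows "(\<integral>x. f (t + c *\<^sub>R x) \<partial>lborel) = (\<integral>x. f x \<partial>lborel)"
    and "integrable lborel (\<lambda>x. f (t + c *\<^sub>R x)) \<longleftrightarrow> integrable lborel f"
  by (subst (2) lborel_affine_unit[OF assms(1), of t, symmetric], simp add: integral_distr integrable_distr_eq assms(2))+

lemma integral_lborel_translate:
  fixes t :: "'a::euclidean_space" and f :: "'a \<Rightarrow> 'b::{banach, second_countable_topology}"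
  assumes "f \<in> borel_measurable borel"
  shows "(\<integral>x. f (x + t) \<partial>lborel) = (\<integral>x. f x \<partial>lborel)"
    and "(\<integral>x. f (t - x) \<partial>lborel) = (\<integral>x. f x \<partial>lborel)"
    and "(\<integral>x. f (- x) \<partial>lborel) = (\<integral>x. f x \<partial>lborel)"
  using integral_lborel_affine_unit[of 1 f t]
    integral_lborel_affine_unit[of "-1" f t] integral_lborel_affine_unit[of "-1" f 0] assms
  by (simp_all add: add.commute)

lemma integrable_lborel_translate:
  fixes t :: "'a::euclidean_space" and f :: "'a \<Rightarrow> 'b::{banach, second_countable_topology}"
  assumes "f \<in> borel_measurable borel"
  shows "integrable lborel (\<lambda>x. f (x + t)) \<longleftrightarrow> integrable lborel f"
    and "integrable lborel (\<lambda>x. f (t - x)) \<longleftrightarrow> integrable lborel f"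
    and "integrable lborel (\<lambda>x. f (- x)) \<longleftrightarrow> integrable lborel f"
  using integral_lborel_affine_unit[of 1 f t]
    integral_lborel_affine_unit[of "-1" f t] integral_lborel_affine_unit[of "-1" f 0] assms
  by (simp_all add: add.commute)

lemma nn_integral_lborel_pair:
  fixes f :: "'a::euclidean_space \<times> 'b::euclidean_space \<Rightarrow> ennreal"
  assumes [measurable]: "f \<in> borel_measurable borel"
  shows "(\<integral>\<^sup>+z. f z \<partial>lborel) = (\<integral>\<^sup>+x. \<integral>\<^sup>+y. f (x, y) \<partial>lborel \<partial>lborel)"
    and "(\<integral>\<^sup>+z. f z \<partial>lborel) = (\<integral>\<^sup>+y. \<integral>\<^sup>+x. f (x, y) \<partial>lborel \<partial>lborel)"
proof -
  have m: "f \<in> borel_measurable (lborel \<Otimes>\<^sub>M lborel)" by (simp add: lborel_prod)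
  show "(\<integral>\<^sup>+z. f z \<partial>lborel) = (\<integral>\<^sup>+x. \<integral>\<^sup>+y. f (x, y) \<partial>lborel \<partial>lborel)"
    using lborel.nn_integral_fst[OF m] by (simp add: lborel_prod)
  show "(\<integral>\<^sup>+z. f z \<partial>lborel) = (\<integral>\<^sup>+y. \<integral>\<^sup>+x. f (x, y) \<partial>lborel \<partial>lborel)"
    using lborel_pair.nn_integral_snd[OF m] by (simp add: lborel_prod)
qed

lemma integral_lborel_pair:
  fixes f :: "'a::euclidean_space \<times> 'b::euclidean_space \<Rightarrow> 'c::{banach, second_countable_topology}"
  assumes "integrable lborel f"
  shows "(\<integral>z. f z \<partial>lborel) = (\<integral>x. \<integral>y. f (x, y) \<partial>lborel \<partial>lborel)"
    and "(\<integral>z. f z \<partial>lborel) = (\<integral>y. \<integral>x. f (x, y) \<partial>lborel \<partial>lborel)"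
proof -
  have m: "integrable (lborel \<Otimes>\<^sub>M lborel) f" using assms by (simp add: lborel_prod)
  then show "(\<integral>z. f z \<partial>lborel) = (\<integral>x. \<integral>y. f (x, y) \<partial>lborel \<partial>lborel)"
    using lborel_pair.integral_fst'[OF m] by (simp add: lborel_prod)
  show "(\<integral>z. f z \<partial>lborel) = (\<integral>y. \<integral>x. f (x, y) \<partial>lborel \<partial>lborel)"
    using lborel_pair.integral_snd[of "\<lambda>x y. f (x, y)"] m by (simp add: lborel_prod)
qed

lemma bochner_integral_norm_le:
  fixes f :: "'y \<Rightarrow> 'b::{banach, second_countable_topology}"
  assumes "integrable M f" "integrable M g" "\<And>x. norm (f x) \<le> g x"
  shows "norm (\<integral>x. f x \<partial>M) \<le> (\<integral>x. g x \<partial>M)"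
  by (rule order_trans[OF integral_norm_bound integral_mono]) (use assms in auto)

text \<open>A Lipschitz bound on the derivative makes the first order remainder quadratic with
  constant \<open>m y\<close>. Integrating that pointwise estimate gives a quadratic remainder for
  the integral, which is more than differentiability asks for.\<close>

lemma has_derivative_integral_lipschitz:
  fixes f :: "'y \<Rightarrow> 'a::euclidean_space \<Rightarrow> real"
  assumes d: "\<And>y z. (f y has_derivative f' y z) (at z)"
    and i: "\<And>z. integrable M (\<lambda>y. f y z)" "\<And>z v. integrable M (\<lambda>y. f' y z v)"
    and lip: "\<And>y z z' v. \<bar>f' y z v - f' y z' v\<bar> \<le> m y * norm v * norm (z - z')"
    and m: "integrable M m" "\<And>y. m y \<ge> 0"
  shows "((\<lambda>z. \<integral>y. f y z \<partial>M) has_derivative (\<lambda>v. \<integral>y. f' y z v \<partial>M)) (at z)"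
proof -
  have lin: "linear (f' y z)" for y z
    using has_derivative_linear[OF d] .
  have "linear (\<lambda>v. \<integral>y. f' y z v \<partial>M)"
    using i by (intro linearI) (simp_all add: linear_add[OF lin] linear_scale[OF lin])
  then have bl: "bounded_linear (\<lambda>v. \<integral>y. f' y z v \<partial>M)"
    by (simp add: linear_conv_bounded_linear)
  have rem: "\<bar>f y w - f y z - f' y z (w - z)\<bar> \<le> m y * (norm (w - z))\<^sup>2" for y w
  proof -
    have "norm (f y w - f y z - f' y z (w - z)) \<le> norm (w - z) * (m y * norm (w - z))"
    proof (rule differentiable_bound_linearization[where S = "cball z (norm (w - z))"])
      show "z + t *\<^sub>R (w - z) \<in> cball z (norm (w - z))" if "t \<in> {0..1}" for t
        using that by (simp add: dist_norm mult_left_le_one_le)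
      show "(f y has_derivative f' y x) (at x within cball z (norm (w - z)))" for x
        using d by (rule has_derivative_at_withinI)
      fix x assume x: "x \<in> cball z (norm (w - z))"
      show "onorm (f' y x - f' y z) \<le> m y * norm (w - z)"
      proof (rule onorm_bound)
        fix v :: 'a
        have "m y * norm v * norm (x - z) \<le> m y * norm v * norm (w - z)"
          using x m(2)[of y] by (intro mult_left_mono) (auto simp: dist_norm norm_minus_commute)
        then show "norm ((f' y x - f' y z) v) \<le> m y * norm (w - z) * norm v"
          using lip[of y x v z] by (simp add: mult_ac)
      qed (use m in simp)
    qed auto
    then show ?thesis by (simp add: power2_eq_square mult_ac)
  qed
  let ?I = "\<integral>y. m y \<partial>M"
  show ?thesis unfolding has_derivative_iff_norm
  proof (intro conjI bl)
    let ?q = "\<lambda>w. norm ((\<integral>y. f y w \<partial>M) - (\<integral>y. f y z \<partial>M) - (\<integral>y. f' y z (w - z) \<partial>M)) / norm (w - z)"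
    have q: "?q w \<le> ?I * norm (w - z)" for w
    proof -
      have "(\<integral>y. f y w \<partial>M) - (\<integral>y. f y z \<partial>M) - (\<integral>y. f' y z (w - z) \<partial>M)
          = (\<integral>y. f y w - f y z - f' y z (w - z) \<partial>M)"
        using i by simp
      also have "norm \<dots> \<le> (\<integral>y. m y * (norm (w - z))\<^sup>2 \<partial>M)"
        using i m rem by (intro bochner_integral_norm_le) auto
      finally show ?thesis using m
        by (cases "w = z") (auto simp: divide_simps power2_eq_square mult_ac)
    qed
    have "((\<lambda>w. ?I * norm (w - z)) \<longlongrightarrow> ?I * norm (z - z)) (at z)" by (intro tendsto_intros)
    then have "((\<lambda>w. ?I * norm (w - z)) \<longlongrightarrow> 0) (at z)" by simp
    then show "(?q \<longlongrightarrow> 0) (at z)"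
      by (rule tendsto_sandwich[OF _ _ tendsto_const, rotated 2]) (use q in auto)
  qed
qed

text \<open>Abstracts translation invariance: an operator that passes derivatives on to its
  argument, on a class stable under derivatives, can be differentiated to all orders. The instances
  are \<open>levy_op k\<close> on \<open>smooth_bounded\<close> and \<open>heat_adjoint\<close> on
  \<open>time_bounded R\<close>.\<close>

lemma smooth_operator:
  assumes "\<And>g v. Q g \<Longrightarrow> Q (dirderiv v g)"
    and "\<And>g z. Q g \<Longrightarrow> (A g has_derivative (\<lambda>v. A (dirderiv v g) z)) (at z)"
    and "Q g"
  shows "smooth (A g)" and "iter_deriv vs (A g) = A (iter_deriv vs g)"
proof -
  have *: "iter_deriv vs (A g) = A (iter_deriv vs g) \<and> Q (iter_deriv vs g)" for vs
    using assms by (induction vs) (auto simp: iter_deriv_Cons simp del: iter_deriv.simps(2) intro!: dirderiv_eqI)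
  then show "iter_deriv vs (A g) = A (iter_deriv vs g)" by blast
  show "smooth (A g)" unfolding smooth_def
    using * assms(2) differentiableI by metis
qed

section \<open>Second differences\<close>

lemma iter_deriv_two: "iter_deriv [u, v] g = dirderiv u (dirderiv v g)"
  by (simp add: dirderiv_def)

text \<open>The sign is that of -\<Delta>, and the symmetric form removes the first order Taylor
  term: second differences of a smooth function have size |h|^2 where a one-sided difference would
  only give |h|.\<close>

definition sdiff :: "'a::real_normed_vector \<Rightarrow> ('a \<Rightarrow> real) \<Rightarrow> 'a \<Rightarrow> real" where
  "sdiff h g z = 2 * g z - g (z + h) - g (z - h)"

lemma smooth_sdiff: "smooth g \<Longrightarrow> smooth (sdiff h g)"
  using smooth_diff[OF smooth_diff[OF smooth_cmult[of g 2] smooth_translate[of g h]] smooth_translate[of g "-h"]]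
  by (simp add: sdiff_def[abs_def])

lemma dirderiv_diff:
  assumes "\<And>x. \<phi> differentiable (at x)" "\<And>x. \<psi> differentiable (at x)"
  shows "dirderiv v (\<lambda>x. \<phi> x - \<psi> x) = (\<lambda>x. dirderiv v \<phi> x - dirderiv v \<psi> x)"
  by (rule dirderiv_eqI) (rule has_derivative_diff differentiable_has_dirderiv assms)+

lemma dirderiv_sdiff:
  assumes "smooth g"
  shows "dirderiv v (sdiff h g) = sdiff h (dirderiv v g)"
proof -
  have "sdiff h g = (\<lambda>z. (2 * g z - g (z + h)) - g (z + (- h)))"
    by (simp add: sdiff_def[abs_def])
  moreover have "dirderiv v (\<lambda>z. (2 * g z - g (z + h)) - g (z + (- h))) = (\<lambda>x. dirderiv v (\<lambda>x. 2 * g x - g (x + h)) x - dirderiv v (\<lambda>x. g (x + (- h))) x)"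
    by (intro dirderiv_diff smooth_differentiable smooth_diff smooth_cmult smooth_translate assms)
  moreover have "dirderiv v (\<lambda>x. 2 * g x - g (x + h)) = (\<lambda>x. dirderiv v (\<lambda>x. 2 * g x) x - dirderiv v (\<lambda>x. g (x + h)) x)"
    by (intro dirderiv_diff smooth_differentiable smooth_diff smooth_cmult smooth_translate assms)
  ultimately show ?thesis
    using smooth_differentiable[OF assms]
    by (simp only: dirderiv_cmult dirderiv_translate) (simp add: sdiff_def[abs_def])
qed

text \<open>A second difference is the increment, from \<open>z\<close> to \<open>z - h\<close>, of
  the function \<open>\<lambda>x. g (x + h) - g x\<close>, whose gradient is at most
  \<open>C * norm h\<close>. For large \<open>h\<close> the values of \<open>g\<close>, four with
  multiplicity, are bounded separately.\<close>

lemma sdiff_bound: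
  fixes g :: "'a::euclidean_space \<Rightarrow> real"
  assumes g: "smooth g" and B0: "\<And>z. \<bar>g z\<bar> \<le> B" and B2: "\<And>u v z. \<bar>iter_deriv [u, v] g z\<bar> \<le> C * norm u * norm v"
    and "C \<ge> 0"
  shows "\<bar>sdiff h g z\<bar> \<le> (4 * B + C) * min ((norm h)\<^sup>2) 1"
proof -
  have 1: "\<bar>dirderiv v g x - dirderiv v g y\<bar> \<le> (C * norm v) * norm (x - y)" for v x y
    by (rule dirderiv_lipschitz[OF smooth_dirderiv[OF g]])
       (use B2 assms(4) in \<open>auto simp: iter_deriv_two mult_ac simp del: iter_deriv.simps(2)\<close>)
  have 2: "\<bar>(g (z - h + h) - g (z - h)) - (g (z + h) - g z)\<bar> \<le> (C * norm h) * norm (z - h - z)"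
  proof (rule dirderiv_lipschitz[where \<phi> = "\<lambda>x. g (x + h) - g x"])
    show "smooth (\<lambda>x. g (x + h) - g x)" by (intro smooth_diff smooth_translate g)
    fix v x
    have "dirderiv v (\<lambda>x. g (x + h) - g x) x = dirderiv v g (x + h) - dirderiv v g x"
      using g by (simp add: dirderiv_diff dirderiv_translate smooth_differentiable smooth_translate)
    then show "\<bar>dirderiv v (\<lambda>x. g (x + h) - g x) x\<bar> \<le> (C * norm h) * norm v"
      using 1[of v "x + h" x] by (simp add: mult_ac)
  qed (use assms(4) in simp)
  then have "\<bar>sdiff h g z\<bar> \<le> C * (norm h)\<^sup>2" by (simp add: sdiff_def power2_eq_square mult_ac)
  moreover have "\<bar>sdiff h g z\<bar> \<le> 4 * B"
    using B0[of z] B0[of "z+h"] B0[of "z-h"] by (simp add: sdiff_def)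
  moreover have "B \<ge> 0" using B0[of z] by linarith
  moreover have "C * (norm h)\<^sup>2 \<le> (4 * B + C) * (norm h)\<^sup>2"
    using \<open>B \<ge> 0\<close> by (intro mult_right_mono) auto
  ultimately show ?thesis using assms(4)
    by (cases "(norm h)\<^sup>2 \<le> 1") (simp_all add: min_def)
qed

lemma smooth_bounded_sdiff_bound:
  fixes g :: "'a::euclidean_space \<Rightarrow> real"
  assumes "smooth_bounded g"
  shows "\<exists>C\<ge>0. \<forall>u v z h. \<bar>sdiff h (dirderiv u (dirderiv v g)) z\<bar> \<le> C * norm u * norm v * min ((norm h)\<^sup>2) 1"
    and "\<exists>C\<ge>0. \<forall>z h. \<bar>sdiff h g z\<bar> \<le> C * min ((norm h)\<^sup>2) 1"
proof -
  have s: "smooth g" using assms by (rule smooth_bounded_smooth)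
  obtain B4 where B4: "B4 \<ge> 0" "\<And>vs x. length vs = 4 \<Longrightarrow> \<bar>iter_deriv vs g x\<bar> \<le> B4 * prod_list (map norm vs)"
    using smooth_bounded_iter_deriv_bound[OF assms] by metis
  obtain B2 where B2: "B2 \<ge> 0" "\<And>vs x. length vs = 2 \<Longrightarrow> \<bar>iter_deriv vs g x\<bar> \<le> B2 * prod_list (map norm vs)"
    using smooth_bounded_iter_deriv_bound[OF assms] by metis
  obtain B0 where B0: "B0 \<ge> 0" "\<And>vs x. length vs = 0 \<Longrightarrow> \<bar>iter_deriv vs g x\<bar> \<le> B0 * prod_list (map norm vs)"
    using smooth_bounded_iter_deriv_bound[OF assms] by metis
  have "\<bar>sdiff h (dirderiv u (dirderiv v g)) z\<bar> \<le> (4 * (B2 * norm u * norm v) + B4 * norm u * norm v) * min ((norm h)\<^sup>2) 1"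
    for u v z h
  proof (rule sdiff_bound)
    show "\<bar>dirderiv u (dirderiv v g) z\<bar> \<le> B2 * norm u * norm v" for z
      using B2(2)[of "[u, v]" z] by (simp add: dirderiv_def mult_ac)
    show "\<bar>iter_deriv [u', v'] (dirderiv u (dirderiv v g)) z\<bar> \<le> B4 * norm u * norm v * norm u' * norm v'" for u' v' z
      using B4(2)[of "[u', v', u, v]" z] by (simp add: dirderiv_def mult_ac)
  qed (use B4 s in \<open>auto intro: smooth_dirderiv\<close>)
  then have "\<bar>sdiff h (dirderiv u (dirderiv v g)) z\<bar> \<le> (4 * B2 + B4) * norm u * norm v * min ((norm h)\<^sup>2) 1" for u v z h
    by (simp add: algebra_simps)
  then show "\<exists>C\<ge>0. \<forall>u v z h. \<bar>sdiff h (dirderiv u (dirderiv v g)) z\<bar> \<le> C * norm u * norm v * min ((norm h)\<^sup>2) 1"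
    using B2 B4 by (intro exI[of _ "4 * B2 + B4"]) auto
  have "\<bar>sdiff h g z\<bar> \<le> (4 * B0 + B2) * min ((norm h)\<^sup>2) 1" for z h
  proof (rule sdiff_bound[OF s])
    show "\<bar>g z\<bar> \<le> B0" for z using B0(2)[of "[]" z] by simp
    show "\<bar>iter_deriv [u', v'] g z\<bar> \<le> B2 * norm u' * norm v'" for u' v' z
      using B2(2)[of "[u', v']" z] by (simp add: mult_ac)
  qed (use B2 in auto)
  then show "\<exists>C\<ge>0. \<forall>z h. \<bar>sdiff h g z\<bar> \<le> C * min ((norm h)\<^sup>2) 1"
    using B0 B2 by (intro exI[of _ "4 * B0 + B2"]) auto
qed

text \<open>A correlation rather than a convolution: this is the adjoint of convolution with
  \<open>k\<close>, which is what duality arguments meet.\<close>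

definition translate_avg :: "('a::euclidean_space \<Rightarrow> real) \<Rightarrow> ('a \<Rightarrow> real) \<Rightarrow> 'a \<Rightarrow> real" where
  "translate_avg k g w = (\<integral>y. k y * g (y + w) \<partial>lborel)"

lemma smooth_bounded_bound: "smooth_bounded g \<Longrightarrow> \<exists>B. \<forall>z. \<bar>g z\<bar> \<le> B"
  unfolding smooth_bounded_def by (metis iter_deriv.simps(1))

lemma smooth_borel_measurable: "smooth g \<Longrightarrow> g \<in> borel_measurable borel"
  for g :: "'a::euclidean_space \<Rightarrow> real"
  by (intro borel_measurable_continuous_onI smooth_continuous_on)

lemma integrable_mult_bounded:
  fixes k g :: "'a \<Rightarrow> real"
  assumes "integrable M k" "g \<in> borel_measurable M" "\<And>y. \<bar>g y\<bar> \<le> B"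
  shows "integrable M (\<lambda>y. k y * g y)"
proof (rule Bochner_Integration.integrable_bound)
  show "integrable M (\<lambda>y. B * k y)" using assms(1) by simp
  have "\<bar>k y\<bar> * \<bar>g y\<bar> \<le> \<bar>k y\<bar> * \<bar>B\<bar>" for y using assms(3)[of y] by (intro mult_left_mono) auto
  then show "AE y in M. norm (k y * g y) \<le> norm (B * k y)" by (simp add: abs_mult mult_ac)
qed (use assms in measurable)

lemma integrable_translate_avg:
  assumes "integrable lborel k" "smooth_bounded g"
  shows "integrable lborel (\<lambda>y. k y * g (y + w))"
proof -
  obtain B where "\<And>z. \<bar>g z\<bar> \<le> B" using smooth_bounded_bound[OF assms(2)] by blast
  moreover have "(\<lambda>y. g (y + w)) \<in> borel_measurable lborel"
    using smooth_borel_measurable[OF smooth_translate[OF smooth_bounded_smooth[OF assms(2)], of w]] by simp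
  ultimately show ?thesis using assms(1) by (intro integrable_mult_bounded) auto
qed

lemma translate_avg_has_derivative:
  assumes k: "integrable lborel k" and g: "smooth_bounded g"
  shows "(translate_avg k g has_derivative (\<lambda>v. translate_avg k (dirderiv v g) w)) (at w)"
  unfolding translate_avg_def[abs_def]
proof -
  obtain B2 where B2: "B2 \<ge> 0" "\<And>vs x. length vs = 2 \<Longrightarrow> \<bar>iter_deriv vs g x\<bar> \<le> B2 * prod_list (map norm vs)"
    using smooth_bounded_iter_deriv_bound[OF g] by metis
  have s: "smooth g" using g by (rule smooth_bounded_smooth)
  show "((\<lambda>w. \<integral>y. k y * g (y + w) \<partial>lborel) has_derivative
    (\<lambda>v. \<integral>y. k y * dirderiv v g (y + w) \<partial>lborel)) (at w)"
  proof (rule has_derivative_integral_lipschitz)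
    show "((\<lambda>w. k y * g (y + w)) has_derivative (\<lambda>v. k y * dirderiv v g (y + z))) (at z)" for y z
      using has_derivative_mult_right[OF smooth_has_derivative[OF smooth_translate[OF s, of y]], of "k y" z] s
      by (simp add: dirderiv_translate smooth_differentiable add.commute)
    show "integrable lborel (\<lambda>y. k y * g (y + z))" for z by (rule integrable_translate_avg[OF k g])
    show "integrable lborel (\<lambda>y. k y * dirderiv v g (y + z))" for z v
      by (rule integrable_translate_avg[OF k smooth_bounded_dirderiv[OF g]])
    show "integrable lborel (\<lambda>y. B2 * \<bar>k y\<bar>)" using k by simp
    show "B2 * \<bar>k y\<bar> \<ge> 0" for y using B2 by simp
    fix y z z' v
    have "\<bar>dirderiv v g (y + z) - dirderiv v g (y + z')\<bar> \<le> (B2 * norm v) * norm (y + z - (y + z'))"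
    proof (rule dirderiv_lipschitz)
      show "\<bar>dirderiv u (dirderiv v g) x\<bar> \<le> B2 * norm v * norm u" for u x
        using B2(2)[of "[u, v]" x] by (simp add: dirderiv_def mult_ac)
    qed (use B2 s in \<open>auto intro: smooth_dirderiv\<close>)
    from mult_left_mono[OF this, of "\<bar>k y\<bar>"]
    show "\<bar>k y * dirderiv v g (y + z) - k y * dirderiv v g (y + z')\<bar> \<le> B2 * \<bar>k y\<bar> * norm v * norm (z - z')"
      by (simp add: abs_mult right_diff_distrib[symmetric] mult_ac)
  qed
qed

text \<open>For even \<open>k\<close> this is minus the generator of the symmetric jump process in
  the first variable with jump density \<open>2 * k\<close>. The kernel is a parameter because the
  half Laplacian is later cut into bounded jumps and a tail.\<close>

definition levy_op :: "('b::euclidean_space \<Rightarrow> real) \<Rightarrow> ('b \<times> 'c::euclidean_space \<Rightarrow> real) \<Rightarrow> 'b \<times> 'c \<Rightarrow> real" where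
  "levy_op k g z = (\<integral>h. k h * sdiff (h, 0) g z \<partial>lborel)"

definition levy_kernel :: "('b::euclidean_space \<Rightarrow> real) \<Rightarrow> bool" where
  "levy_kernel k \<longleftrightarrow> k \<in> borel_measurable borel \<and> (\<forall>h. 0 \<le> k h) \<and> integrable lborel (\<lambda>h. k h * min ((norm h)\<^sup>2) 1)"

lemma borel_measurable_sdiff:
  fixes g :: "'b::euclidean_space \<times> 'c::euclidean_space \<Rightarrow> real"
  assumes [measurable]: "g \<in> borel_measurable borel"
  shows "(\<lambda>h. sdiff (h, 0) g z) \<in> borel_measurable borel"
    and "(\<lambda>p. sdiff (snd p, 0) g (fst p)) \<in> borel_measurable (borel \<Otimes>\<^sub>M borel)"
  unfolding sdiff_def by measurable

lemma levy_op_integrable: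
  fixes g :: "'b::euclidean_space \<times> 'c::euclidean_space \<Rightarrow> real"
  assumes k: "levy_kernel k" and g: "smooth_bounded g"
  shows "integrable lborel (\<lambda>h. k h * sdiff (h, 0) g z)"
proof -
  obtain C where C: "C \<ge> 0" "\<And>z h. \<bar>sdiff h g z\<bar> \<le> C * min ((norm h)\<^sup>2) 1"
    using smooth_bounded_sdiff_bound(2)[OF g] by metis
  have [measurable]: "k \<in> borel_measurable borel" "g \<in> borel_measurable borel"
    using k smooth_borel_measurable[OF smooth_bounded_smooth[OF g]] by (auto simp: levy_kernel_def)
  note [measurable] = borel_measurable_sdiff(1)
  show ?thesis
  proof (rule Bochner_Integration.integrable_bound)
    show "integrable lborel (\<lambda>h. C * (k h * min ((norm h)\<^sup>2) 1))"
      using k by (simp add: levy_kernel_def)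
    have "\<bar>k h * sdiff (h, 0) g z\<bar> \<le> \<bar>C * (k h * min ((norm h)\<^sup>2) 1)\<bar>" for h
    proof -
      have "k h * \<bar>sdiff (h, 0) g z\<bar> \<le> k h * (C * min ((norm h)\<^sup>2) 1)"
        using C(2)[of "(h, 0)" z] k by (intro mult_left_mono) (auto simp: levy_kernel_def norm_Pair)
      then show ?thesis using C(1) k by (simp add: abs_mult levy_kernel_def mult_ac min_def)
    qed
    then show "AE h in lborel. norm (k h * sdiff (h, 0) g z) \<le> norm (C * (k h * min ((norm h)\<^sup>2) 1))"
      by simp
  qed simp
qed

lemma levy_op_has_derivative:
  fixes g :: "'b::euclidean_space \<times> 'c::euclidean_space \<Rightarrow> real"
  assumes k: "levy_kernel k" and g: "smooth_bounded g"
  shows "(levy_op k g has_derivative (\<lambda>v. levy_op k (dirderiv v g) z)) (at z)"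
  unfolding levy_op_def[abs_def]
proof -
  have s: "smooth g" using g by (rule smooth_bounded_smooth)
  have k0: "k h \<ge> 0" for h using k by (simp add: levy_kernel_def)
  obtain C where C: "C \<ge> 0" "\<And>u v z h. \<bar>sdiff h (dirderiv u (dirderiv v g)) z\<bar> \<le> C * norm u * norm v * min ((norm h)\<^sup>2) 1"
    using smooth_bounded_sdiff_bound(1)[OF g] by metis
  show "((\<lambda>z. \<integral>h. k h * sdiff (h, 0) g z \<partial>lborel) has_derivative
    (\<lambda>v. \<integral>h. k h * sdiff (h, 0) (dirderiv v g) z \<partial>lborel)) (at z)"
  proof (rule has_derivative_integral_lipschitz)
    show "((\<lambda>z. k h * sdiff (h, 0) g z) has_derivative (\<lambda>v. k h * sdiff (h, 0) (dirderiv v g) z)) (at z)" for h z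
      using has_derivative_mult_right[OF smooth_has_derivative[OF smooth_sdiff[OF s]], of "k h" "(h, 0)" z]
      by (simp add: dirderiv_sdiff[OF s])
    show "integrable lborel (\<lambda>h. k h * sdiff (h, 0) g z)" for z by (rule levy_op_integrable[OF k g])
    show "integrable lborel (\<lambda>h. k h * sdiff (h, 0) (dirderiv v g) z)" for z v
      by (rule levy_op_integrable[OF k smooth_bounded_dirderiv[OF g]])
    show "integrable lborel (\<lambda>h. C * (k h * min ((norm h)\<^sup>2) 1))"
      using k by (simp add: levy_kernel_def)
    show "C * (k h * min ((norm h)\<^sup>2) 1) \<ge> 0" for h using C k0 by simp
    fix h z z' v
    have "\<bar>sdiff (h, 0) (dirderiv v g) z - sdiff (h, 0) (dirderiv v g) z'\<bar>
        \<le> (C * norm v * min ((norm h)\<^sup>2) 1) * norm (z - z')"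
    proof (rule dirderiv_lipschitz)
      show "\<bar>dirderiv u (sdiff (h, 0) (dirderiv v g)) x\<bar> \<le> C * norm v * min ((norm h)\<^sup>2) 1 * norm u" for u x
        using C(2)[of "(h, 0)" u v x] s by (simp add: dirderiv_sdiff smooth_dirderiv norm_Pair mult_ac)
    qed (use C s in \<open>auto intro: smooth_dirderiv smooth_sdiff\<close>)
    from mult_left_mono[OF this k0]
    show "\<bar>k h * sdiff (h, 0) (dirderiv v g) z - k h * sdiff (h, 0) (dirderiv v g) z'\<bar>
        \<le> C * (k h * min ((norm h)\<^sup>2) 1) * norm v * norm (z - z')"
      using k0[of h] by (simp add: abs_mult right_diff_distrib[symmetric] mult_ac)
  qed
qed

lemma levy_op_smooth:
  fixes g :: "'b::euclidean_space \<times> 'c::euclidean_space \<Rightarrow> real"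
  assumes "levy_kernel k" "smooth_bounded g"
  shows "smooth (levy_op k g)" "iter_deriv vs (levy_op k g) = levy_op k (iter_deriv vs g)"
  using smooth_operator[of smooth_bounded "levy_op k", OF smooth_bounded_dirderiv
      levy_op_has_derivative[OF assms(1)] assms(2)] by auto

lemma levy_op_bound:
  fixes g :: "'b::euclidean_space \<times> 'c::euclidean_space \<Rightarrow> real"
  assumes k: "levy_kernel k" and g: "smooth_bounded g"
  shows "\<exists>B. \<forall>z. \<bar>levy_op k g z\<bar> \<le> B"
proof -
  obtain C where C: "C \<ge> 0" "\<And>z h. \<bar>sdiff h g z\<bar> \<le> C * min ((norm h)\<^sup>2) 1"
    using smooth_bounded_sdiff_bound(2)[OF g] by metis
  have "norm (levy_op k g z) \<le> (\<integral>h. C * (k h * min ((norm h)\<^sup>2) 1) \<partial>lborel)" for z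
    unfolding levy_op_def
  proof (rule bochner_integral_norm_le)
    show "norm (k h * sdiff (h, 0) g z) \<le> C * (k h * min ((norm h)\<^sup>2) 1)" for h
      using mult_left_mono[OF C(2)[of "(h, 0)" z], of "k h"] k
      by (auto simp: levy_kernel_def norm_Pair abs_mult mult_ac)
  qed (use k levy_op_integrable[OF k g] in \<open>auto simp: levy_kernel_def\<close>)
  then show ?thesis by auto
qed

lemma levy_op_smooth_bounded:
  fixes g :: "'b::euclidean_space \<times> 'c::euclidean_space \<Rightarrow> real"
  assumes "levy_kernel k" "smooth_bounded g"
  shows "smooth_bounded (levy_op k g)"
  unfolding smooth_bounded_def levy_op_smooth(2)[OF assms]
  using levy_op_smooth(1)[OF assms] levy_op_bound[OF assms(1) smooth_bounded_iter_deriv[OF assms(2)]] by blast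

lemma translate_avg_bound:
  assumes k: "integrable lborel k" and g: "\<And>z. \<bar>g z\<bar> \<le> B"
  shows "\<bar>translate_avg k g w\<bar> \<le> (\<integral>y. \<bar>k y\<bar> \<partial>lborel) * B"
proof -
  have "norm (translate_avg k g w) \<le> (\<integral>y. norm (k y * g (y + w)) \<partial>lborel)"
    unfolding translate_avg_def by (rule integral_norm_bound)
  also have "\<dots> \<le> (\<integral>y. \<bar>k y\<bar> * B \<partial>lborel)"
  proof (rule integral_mono')
    show "norm (k y * g (y + w)) \<le> \<bar>k y\<bar> * B" for y
      using g by (simp add: abs_mult mult_left_mono)
    show "0 \<le> \<bar>k y\<bar> * B" for y
      using order_trans[OF abs_ge_zero g[of 0]] by simp
  qed (use k in simp)
  finally show ?thesis by simp
qed

section \<open>Gaussians and the Poisson kernel\<close>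

lemma gaussian_integral: "has_bochner_integral lborel (\<lambda>x::real. exp (- x\<^sup>2)) (sqrt pi)"
  using has_bochner_integral_even_function[OF gaussian_moment_0] by simp

definition gauss_erf :: "real \<Rightarrow> real" where
  "gauss_erf x = (LBINT y=ereal 0..ereal x. exp (- y\<^sup>2))"

lemma gauss_erf_deriv: "(gauss_erf has_real_derivative exp (- x\<^sup>2)) (at x)"
proof -
  have "(gauss_erf has_vector_derivative exp (- x\<^sup>2)) (at x within {min 0 (x - 1)..max 0 (x + 1)})"
    unfolding gauss_erf_def[abs_def]
    by (rule interval_integral_FTC2) (auto intro!: continuous_intros)
  moreover have "at x within {min 0 (x - 1)..max 0 (x + 1)} = at x"
    by (rule at_within_Icc_at) auto
  ultimately show ?thesis by (simp add: has_real_derivative_iff_has_vector_derivative)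
qed

lemma gauss_erf_at_top: "(gauss_erf \<longlongrightarrow> sqrt pi / 2) at_top"
proof -
  have i: "set_integrable lborel {0..} (\<lambda>x::real. exp (- x\<^sup>2))" "set_lebesgue_integral lborel {0..} (\<lambda>x::real. exp (- x\<^sup>2)) = sqrt pi / 2"
    using gaussian_moment_0
    by (auto simp: set_integrable_def set_lebesgue_integral_def has_bochner_integral_iff)
  have "((\<lambda>b. set_lebesgue_integral lborel {0..b} (\<lambda>x::real. exp (- x\<^sup>2))) \<longlongrightarrow> sqrt pi / 2) at_top"
    using tendsto_set_lebesgue_integral_at_top[OF _ i(1)] i(2) by simp
  then show ?thesis
    by (rule Lim_transform_eventually)
       (auto intro!: eventually_mono[OF eventually_ge_at_top[of 0]] simp: gauss_erf_def interval_integral_Icc)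
qed

lemma gauss_erf_minus: "gauss_erf (- x) = - gauss_erf x"
proof -
  have "(LBINT y=ereal 0..ereal (-x). exp (- y\<^sup>2)) = (LBINT y=ereal x..ereal 0. exp (- y\<^sup>2))"
    by (subst interval_integral_reflect) simp
  then show ?thesis unfolding gauss_erf_def by (subst (2) interval_integral_endpoints_reverse) simp
qed

lemma gauss_erf_at_bot: "(gauss_erf \<longlongrightarrow> - (sqrt pi / 2)) at_bot"
  unfolding filterlim_at_bot_mirror gauss_erf_minus by (intro tendsto_minus gauss_erf_at_top)

text \<open>The Glasser-type integral behind the subordination of the Poisson kernel to Gaussians: an
  antiderivative is a combination of error functions of \<open>s v - c / v\<close> and \<open>s v + c / v\<close>.\<close>

lemma subordination_integral_pos:
  assumes s: "s > 0" and c: "c > 0"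
  shows "set_integrable lborel (einterval 0 \<infinity>) (\<lambda>v. exp (- (s * v - c / v)\<^sup>2))"
    and "(LBINT v=0..\<infinity>. exp (- (s * v - c / v)\<^sup>2)) = sqrt pi / (2 * s)"
proof -
  \<comment> \<open>The factor \<open>exp (4 * s * c)\<close> converts exp(-(s v + c/v)^2) into
    exp(-(s v - c/v)^2), and the inner derivatives s - c/v^2 and s + c/v^2 then add up to 2 s. In
    the boundary values the second error function has the same limit at both ends and
    cancels.\<close>
  define F where "F = (\<lambda>v. (gauss_erf (s * v - c / v) + exp (4 * s * c) * gauss_erf (s * v + c / v)) / (2 * s))"
  have top1: "filterlim (\<lambda>v. s * v - c / v) at_top at_top" "filterlim (\<lambda>v. s * v + c / v) at_top at_top"
    using s c by real_asymp+
  have bot1: "filterlim (\<lambda>v. s * v - c / v) at_bot (at_right 0)" "filterlim (\<lambda>v. s * v + c / v) at_top (at_right 0)"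
    using s c by real_asymp+
  have A: "((F \<circ> real_of_ereal) \<longlongrightarrow> (- (sqrt pi / 2) + exp (4 * s * c) * (sqrt pi / 2)) / (2 * s)) (at_right 0)"
    unfolding zero_ereal_def ereal_tendsto_simps F_def
    using s by (intro tendsto_intros filterlim_compose[OF gauss_erf_at_bot] filterlim_compose[OF gauss_erf_at_top] bot1) auto
  have B: "((F \<circ> real_of_ereal) \<longlongrightarrow> (sqrt pi / 2 + exp (4 * s * c) * (sqrt pi / 2)) / (2 * s)) (at_left \<infinity>)"
    unfolding ereal_tendsto_simps F_def
    using s by (intro tendsto_intros filterlim_compose[OF gauss_erf_at_top] top1) auto
  have D: "DERIV F v :> exp (- (s * v - c / v)\<^sup>2)" if "0 < v" for v
  proof -
    have e: "exp (4 * s * c) * exp (- (s * v + c / v)\<^sup>2) = exp (- (s * v - c / v)\<^sup>2)"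
      using that by (simp add: exp_add[symmetric] power2_eq_square field_simps)
    have "DERIV F v :> (exp (- (s * v - c / v)\<^sup>2) * (s + c / (v * v)) + exp (4 * s * c) * (exp (- (s * v + c / v)\<^sup>2) * (s - c / (v * v)))) / (2 * s)"
      unfolding F_def using s that
      by (auto intro!: derivative_eq_intros DERIV_chain2[OF gauss_erf_deriv]; simp add: field_simps)
    moreover have "(exp (- (s * v - c / v)\<^sup>2) * (s + c / (v * v)) + exp (4 * s * c) * (exp (- (s * v + c / v)\<^sup>2) * (s - c / (v * v)))) / (2 * s) = exp (- (s * v - c / v)\<^sup>2)"
      using s by (simp only: mult.assoc[symmetric] e) (simp add: field_simps)
    ultimately show ?thesis by simp
  qed
  have nn: "AE x in lborel. (0::ereal) < ereal x \<longrightarrow> ereal x < \<infinity> \<longrightarrow> 0 \<le> exp (- (s * x - c / x)\<^sup>2)" by simp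
  have ic: "isCont (\<lambda>v. exp (- (s * v - c / v)\<^sup>2)) v" if "0 < v" for v
    using that by (intro continuous_intros) auto
  note * = interval_integral_FTC_nonneg[of 0 \<infinity> F "\<lambda>v. exp (- (s * v - c / v)\<^sup>2)", OF _ D ic nn A B]
  show "set_integrable lborel (einterval 0 \<infinity>) (\<lambda>v. exp (- (s * v - c / v)\<^sup>2))"
    by (rule *) auto
  have "(LBINT v=0..\<infinity>. exp (- (s * v - c / v)\<^sup>2)) =
      (sqrt pi / 2 + exp (4 * s * c) * (sqrt pi / 2)) / (2 * s) - (- (sqrt pi / 2) + exp (4 * s * c) * (sqrt pi / 2)) / (2 * s)"
    by (rule *) auto
  also have "\<dots> = sqrt pi / (2 * s)" using s by (simp add: field_simps)
  finally show "(LBINT v=0..\<infinity>. exp (- (s * v - c / v)\<^sup>2)) = sqrt pi / (2 * s)" .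
qed

lemma subordination_integral:
  assumes s: "s > 0" and r: "r \<ge> 0"
  shows "has_bochner_integral lborel (\<lambda>v. indicator {0<..} v * exp (- (s\<^sup>2 * v\<^sup>2) - r\<^sup>2 / (4 * v\<^sup>2)))
    (sqrt pi / (2 * s) * exp (- (s * r)))"
proof (cases "r = 0")
  case True
  have "has_bochner_integral lborel (\<lambda>v::real. indicator {0..} (0 + s * v) *\<^sub>R exp (- (0 + s * v)\<^sup>2)) ((sqrt pi / 2) /\<^sub>R \<bar>s\<bar>)"
    using gaussian_moment_0 s by (subst lborel_has_bochner_integral_real_affine_iff[symmetric]) auto
  moreover have "AE v in lborel. indicator {0..} (0 + s * v) *\<^sub>R exp (- (0 + s * v)\<^sup>2)
      = indicator {0<..} v * exp (- (s\<^sup>2 * v\<^sup>2) - r\<^sup>2 / (4 * v\<^sup>2))"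
    by (rule AE_mp[OF AE_lborel_singleton[of 0]])
       (use s True in \<open>auto simp: indicator_def power_mult_distrib zero_le_mult_iff\<close>)
  ultimately show ?thesis using s True
    by (subst has_bochner_integral_cong_AE[symmetric]) (auto simp: field_simps)
next
  case False
  define c where "c = r / 2"
  have c: "c > 0" using False r by (simp add: c_def)
  \<comment> \<open>Completing the square; the cross term is 2 (s v) (c / v) = s r.\<close>
  have e: "exp (- (s\<^sup>2 * v\<^sup>2) - r\<^sup>2 / (4 * v\<^sup>2)) = exp (- (s * r)) * exp (- (s * v - c / v)\<^sup>2)" if "v > 0" for v
    using that by (simp add: exp_add[symmetric] c_def power2_eq_square field_simps)
  have "has_bochner_integral lborel (\<lambda>v. indicator {0<..} v * exp (- (s * v - c / v)\<^sup>2)) (sqrt pi / (2 * s))"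
    using subordination_integral_pos[OF s c]
    by (simp add: has_bochner_integral_iff set_integrable_def interval_lebesgue_integral_def
        set_lebesgue_integral_def einterval_def greaterThan_def zero_ereal_def)
  then have "has_bochner_integral lborel (\<lambda>v. exp (- (s * r)) * (indicator {0<..} v * exp (- (s * v - c / v)\<^sup>2))) (exp (- (s * r)) * (sqrt pi / (2 * s)))"
    by (rule has_bochner_integral_mult_right)
  moreover have "(\<lambda>v. exp (- (s * r)) * (indicator {0<..} v * exp (- (s * v - c / v)\<^sup>2))) = (\<lambda>v. indicator {0<..} v * exp (- (s\<^sup>2 * v\<^sup>2) - r\<^sup>2 / (4 * v\<^sup>2)))"
    using e by (auto simp: indicator_def)
  ultimately show ?thesis by (simp only: mult.commute[of "exp (- (s * r))" "sqrt pi / (2 * s)"])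
qed

text \<open>Rescaling by sqrt(2 a) turns the Gaussian into the standard normal density, whose
  characteristic function is known.\<close>

lemma gaussian_fourier_real:
  assumes a: "a > 0"
  shows "integrable lborel (\<lambda>x::real. complex_of_real (exp (- (a * x\<^sup>2))) * cis (- (x * \<xi>)))"
    and "(\<integral>x. complex_of_real (exp (- (a * x\<^sup>2))) * cis (- (x * \<xi>)) \<partial>lborel)
      = complex_of_real (sqrt (pi / a) * exp (- (\<xi>\<^sup>2 / (4 * a))))"
proof -
  have "integrable lborel (\<lambda>x::real. exp (- (0 + sqrt a * x)\<^sup>2))"
    using gaussian_integral a by (subst lborel_integrable_real_affine_iff) (auto simp: has_bochner_integral_iff)
  then have i: "integrable lborel (\<lambda>x::real. exp (- (a * x\<^sup>2)))"
    using a by (simp add: power_mult_distrib)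
  show "integrable lborel (\<lambda>x::real. complex_of_real (exp (- (a * x\<^sup>2))) * cis (- (x * \<xi>)))"
    by (rule Bochner_Integration.integrable_bound[OF i]) (auto simp: norm_mult cis_conv_exp)
  \<comment> \<open>Chosen so that t sqrt(2 a) x = - x \<xi>.\<close>
  define t where "t = - (\<xi> / sqrt (2 * a))"
  have "char std_normal_distribution t = complex_of_real (exp (- (t\<^sup>2) / 2))"
    by (simp add: char_std_normal_distribution)
  moreover have "char std_normal_distribution t = (\<integral>x. std_normal_density x *\<^sub>R iexp (t * x) \<partial>lborel)"
    unfolding char_def by (subst integral_density) auto
  also have "\<dots> = \<bar>sqrt (2 * a)\<bar> *\<^sub>R (\<integral>x. std_normal_density (0 + sqrt (2 * a) * x) *\<^sub>R iexp (t * (0 + sqrt (2 * a) * x)) \<partial>lborel)"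
    using a by (intro lborel_integral_real_affine) auto
  also have "\<dots> = sqrt (2 * a) *\<^sub>R (\<integral>x. (1 / sqrt (2 * pi)) *\<^sub>R (complex_of_real (exp (- (a * x\<^sup>2))) * cis (- (x * \<xi>))) \<partial>lborel)"
    using a by (simp add: normal_density_def t_def power_mult_distrib cis_conv_exp scaleR_conv_of_real mult_ac)
  also have "\<dots> = (sqrt (2 * a) / sqrt (2 * pi)) *\<^sub>R (\<integral>x. (complex_of_real (exp (- (a * x\<^sup>2))) * cis (- (x * \<xi>))) \<partial>lborel)"
    by simp
  finally have "(sqrt (2 * a) / sqrt (2 * pi)) *\<^sub>R (\<integral>x. (complex_of_real (exp (- (a * x\<^sup>2))) * cis (- (x * \<xi>))) \<partial>lborel) = complex_of_real (exp (- (t\<^sup>2) / 2))"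
    by simp
  then have "(\<integral>x. (complex_of_real (exp (- (a * x\<^sup>2))) * cis (- (x * \<xi>))) \<partial>lborel) = (sqrt (2 * pi) / sqrt (2 * a)) *\<^sub>R complex_of_real (exp (- (t\<^sup>2) / 2))"
    using a by (metis (no_types, lifting) divide_eq_0_iff inverse_divide mult_eq_0_iff not_less_iff_gr_or_eq pi_gt_zero real_sqrt_eq_zero_cancel_iff real_vector.scale_scale scaleR_one left_inverse zero_neq_numeral)
  also have "(sqrt (2 * pi) / sqrt (2 * a)) = sqrt (pi / a)"
    by (simp add: real_sqrt_divide[symmetric])
  also have "- (t\<^sup>2) / 2 = - (\<xi>\<^sup>2 / (4 * a))" using a by (simp add: t_def power_divide)
  finally show "(\<integral>x. complex_of_real (exp (- (a * x\<^sup>2))) * cis (- (x * \<xi>)) \<partial>lborel)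
      = complex_of_real (sqrt (pi / a) * exp (- (\<xi>\<^sup>2 / (4 * a))))"
    by (simp add: scaleR_conv_of_real)
qed

lemma lborel_integral_prod_Basis:
  fixes f :: "'a::euclidean_space \<Rightarrow> real \<Rightarrow> complex"
  assumes i: "\<And>b. b \<in> Basis \<Longrightarrow> integrable lborel (f b)"
  shows "(\<integral>x. (\<Prod>b\<in>Basis. f b (x \<bullet> b)) \<partial>lborel) = (\<Prod>b\<in>Basis. \<integral>x. f b x \<partial>lborel)"
    and "integrable lborel (\<lambda>x. \<Prod>b\<in>Basis. f b (x \<bullet> b))"
proof -
  have [measurable]: "f b \<in> borel_measurable borel" if "b \<in> Basis" for b
    using borel_measurable_integrable[OF i[OF that]] by simp
  interpret P: product_sigma_finite "\<lambda>b::'a. lborel :: real measure" ..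
  have e: "(\<Prod>b\<in>Basis. f b ((\<Sum>c\<in>Basis. g c *\<^sub>R c) \<bullet> b)) = (\<Prod>b\<in>Basis. f b (g b))" for g
    by (intro prod.cong refl) simp
  show "(\<integral>x. (\<Prod>b\<in>Basis. f b (x \<bullet> b)) \<partial>lborel) = (\<Prod>b\<in>Basis. \<integral>x. f b x \<partial>lborel)"
    by (subst lborel_eq) (simp add: integral_distr e P.product_integral_prod i)
  show "integrable lborel (\<lambda>x. \<Prod>b\<in>Basis. f b (x \<bullet> b))"
    by (subst lborel_eq) (simp add: integrable_distr_eq e P.product_integrable_prod i)
qed

lemma cis_sum: "finite A \<Longrightarrow> cis (\<Sum>i\<in>A. f i) = (\<Prod>i\<in>A. cis (f i))"
  by (induction A rule: finite_induct) (auto simp: cis_mult[symmetric])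

lemma gaussian_fourier:
  fixes \<xi> :: "'a::euclidean_space"
  assumes a: "a > 0"
  shows "integrable lborel (\<lambda>x::'a. complex_of_real (exp (- (a * (norm x)\<^sup>2))) * cis (- (x \<bullet> \<xi>)))"
    and "(\<integral>x. complex_of_real (exp (- (a * (norm x)\<^sup>2))) * cis (- (x \<bullet> \<xi>)) \<partial>lborel)
      = complex_of_real (sqrt (pi / a) ^ DIM('a) * exp (- ((norm \<xi>)\<^sup>2 / (4 * a))))"
proof -
  let ?f = "\<lambda>b x. complex_of_real (exp (- (a * x\<^sup>2))) * cis (- (x * (\<xi> \<bullet> b)))"
  have n: "(norm x)\<^sup>2 = (\<Sum>b\<in>Basis. (x \<bullet> b)\<^sup>2)" for x :: 'a
    by (subst power2_norm_eq_inner, subst euclidean_inner) (simp add: power2_eq_square)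
  have e: "complex_of_real (exp (- (a * (norm x)\<^sup>2))) * cis (- (x \<bullet> \<xi>)) = (\<Prod>b\<in>Basis. ?f b (x \<bullet> b))" for x :: 'a
  proof -
    have "exp (- (a * (norm x)\<^sup>2)) = (\<Prod>b\<in>Basis. exp (- (a * (x \<bullet> b)\<^sup>2)))"
      by (simp add: n sum_distrib_left exp_sum[symmetric] sum_negf)
    moreover have "cis (- (x \<bullet> \<xi>)) = (\<Prod>b\<in>Basis. cis (- ((x \<bullet> b) * (\<xi> \<bullet> b))))"
      by (simp add: cis_sum[symmetric] sum_negf euclidean_inner[of x \<xi>])
    ultimately show ?thesis by (simp add: prod.distrib)
  qed
  show "integrable lborel (\<lambda>x::'a. complex_of_real (exp (- (a * (norm x)\<^sup>2))) * cis (- (x \<bullet> \<xi>)))"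
    unfolding e by (rule lborel_integral_prod_Basis(2)) (rule gaussian_fourier_real(1)[OF a])
  have "(\<integral>x. complex_of_real (exp (- (a * (norm x)\<^sup>2))) * cis (- (x \<bullet> \<xi>)) \<partial>lborel)
      = (\<Prod>b\<in>Basis. complex_of_real (sqrt (pi / a) * exp (- ((\<xi> \<bullet> b)\<^sup>2 / (4 * a)))))"
    unfolding e by (subst lborel_integral_prod_Basis(1)) (simp_all only: gaussian_fourier_real[OF a])
  also have "\<dots> = complex_of_real (sqrt (pi / a) ^ DIM('a) * exp (- ((norm \<xi>)\<^sup>2 / (4 * a))))"
    by (simp add: prod.distrib n exp_sum[symmetric] sum_negf sum_divide_distrib of_real_prod[symmetric] del: of_real_prod of_real_mult)
  finally show "(\<integral>x. complex_of_real (exp (- (a * (norm x)\<^sup>2))) * cis (- (x \<bullet> \<xi>)) \<partial>lborel)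
      = complex_of_real (sqrt (pi / a) ^ DIM('a) * exp (- ((norm \<xi>)\<^sup>2 / (4 * a))))" .
qed

lemma gaussian_integral_euclidean:
  assumes a: "a > 0"
  shows "has_bochner_integral lborel (\<lambda>x::'a::euclidean_space. exp (- (a * (norm x)\<^sup>2))) (sqrt (pi / a) ^ DIM('a))"
proof -
  have "has_bochner_integral lborel (\<lambda>x::'a. complex_of_real (exp (- (a * (norm x)\<^sup>2)))) (complex_of_real (sqrt (pi / a) ^ DIM('a)))"
    using gaussian_fourier[OF a, where \<xi> = "0::'a"] by (simp add: has_bochner_integral_iff)
  from has_bochner_integral_Re[OF this] show ?thesis by simp
qed

text \<open>Half of Gamma((n + 1) / 2), carried as a symbol through its positivity and
  scaling.\<close>

definition gamma_moment :: "nat \<Rightarrow> real" where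
  "gamma_moment n = (\<integral>v. indicator {0<..} v * (v ^ n * exp (- v\<^sup>2)) \<partial>lborel)"

lemma gamma_moment:
  "has_bochner_integral lborel (\<lambda>v::real. indicator {0<..} v * (v ^ n * exp (- v\<^sup>2))) (gamma_moment n)"
  and gamma_moment_pos: "gamma_moment n > 0"
proof -
  have "\<exists>c>0. has_bochner_integral lborel (\<lambda>v::real. indicator {0..} v *\<^sub>R (exp (- v\<^sup>2) * v ^ n)) c"
  proof (cases "even n")
    case True
    then obtain k where "n = 2 * k" by (elim evenE)
    then show ?thesis using gaussian_moment_even_pos[of k]
      by (intro exI[of _ "sqrt pi / 2 * (fact (2 * k) / (2 ^ (2 * k) * fact k))"]) simp
  next
    case False
    then obtain k where "n = 2 * k + 1" by (elim oddE)
    then show ?thesis using gaussian_moment_odd_pos[of k]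
      by (intro exI[of _ "fact k / 2"]) simp
  qed
  then obtain c where c: "c > 0" "has_bochner_integral lborel (\<lambda>v::real. indicator {0..} v *\<^sub>R (exp (- v\<^sup>2) * v ^ n)) c"
    by blast
  have "AE v in lborel. indicator {0..} v *\<^sub>R (exp (- v\<^sup>2) * (v::real) ^ n) = indicator {0<..} v * (v ^ n * exp (- v\<^sup>2))"
    by (rule AE_mp[OF AE_lborel_singleton[of 0]]) (intro AE_I2, auto simp: indicator_def less_le mult.commute)
  then have "has_bochner_integral lborel (\<lambda>v::real. indicator {0<..} v * (v ^ n * exp (- v\<^sup>2))) c"
    using c(2) by (subst has_bochner_integral_cong_AE[symmetric]) auto
  then have "has_bochner_integral lborel (\<lambda>v::real. indicator {0<..} v * (v ^ n * exp (- v\<^sup>2))) (gamma_moment n) \<and> gamma_moment n > 0"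
    using c(1) by (auto simp: gamma_moment_def has_bochner_integral_iff)
  then show "has_bochner_integral lborel (\<lambda>v::real. indicator {0<..} v * (v ^ n * exp (- v\<^sup>2))) (gamma_moment n)" "gamma_moment n > 0"
    by auto
qed

lemma gamma_moment_scaled:
  assumes "r > 0"
  shows "has_bochner_integral lborel (\<lambda>v::real. indicator {0<..} v * (v ^ n * exp (- (v\<^sup>2 * r\<^sup>2)))) (gamma_moment n / r ^ Suc n)"
proof -
  have "has_bochner_integral lborel (\<lambda>v::real. indicator {0<..} (0 + r * v) * ((0 + r * v) ^ n * exp (- (0 + r * v)\<^sup>2))) (gamma_moment n /\<^sub>R \<bar>r\<bar>)"
    using gamma_moment[of n] assms by (subst lborel_has_bochner_integral_real_affine_iff[symmetric]) auto
  then have "has_bochner_integral lborel (\<lambda>v::real. (1 / r ^ n) * (indicator {0<..} (0 + r * v) * ((0 + r * v) ^ n * exp (- (0 + r * v)\<^sup>2)))) ((1 / r ^ n) * (gamma_moment n /\<^sub>R \<bar>r\<bar>))"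
    by (rule has_bochner_integral_mult_right)
  moreover have "(\<lambda>v::real. (1 / r ^ n) * (indicator {0<..} (0 + r * v) * ((0 + r * v) ^ n * exp (- (0 + r * v)\<^sup>2))))
      = (\<lambda>v. indicator {0<..} v * (v ^ n * exp (- (v\<^sup>2 * r\<^sup>2))))"
    using assms by (auto simp: indicator_def power_mult_distrib zero_less_mult_iff mult.commute)
  ultimately show ?thesis using assms by (simp add: field_simps)
qed

text \<open>The time slice of P at height \<open>s\<close>, on an arbitrary Euclidean space. The
  integer power of a square root stands for the real power (N + 1) / 2.\<close>

definition poisson_kernel :: "real \<Rightarrow> 'a::euclidean_space \<Rightarrow> real" where
  "poisson_kernel s y = s / sqrt (s\<^sup>2 + (norm y)\<^sup>2) ^ Suc DIM('a)"

text \<open>In closed form \<pi>^((N+1)/2) / Gamma((N+1)/2). This is the total mass of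
  \<open>poisson_kernel s\<close> for every \<open>s > 0\<close> and the constant \<kappa> of the
  overview; the type argument fixes N.\<close>

definition poisson_mass :: "'a::euclidean_space itself \<Rightarrow> real" where
  "poisson_mass _ = sqrt pi ^ Suc DIM('a) / (2 * gamma_moment DIM('a))"

lemma poisson_mass_pos: "poisson_mass TYPE('a::euclidean_space) > 0"
  using gamma_moment_pos[of "DIM('a)"] by (simp add: poisson_mass_def)

lemma poisson_kernel_nonneg: "s \<ge> 0 \<Longrightarrow> poisson_kernel s y \<ge> 0"
  by (simp add: poisson_kernel_def)

lemma poisson_kernel_minus: "poisson_kernel s (- y) = poisson_kernel s y"
  by (simp add: poisson_kernel_def)

lemma poisson_kernel_measurable [measurable]:
  "(\<lambda>(s, y::'a::euclidean_space). poisson_kernel s y) \<in> borel_measurable (borel \<Otimes>\<^sub>M borel)"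
  "poisson_kernel s \<in> borel_measurable (borel :: 'a measure)"
  unfolding poisson_kernel_def by measurable

text \<open>With r^2 = s^2 + |y|^2 the scaled moment integral produces r^(-N-1). The exponential
  factors into a part in \<open>s\<close> and a Gaussian in \<open>y\<close>, so P is a
  superposition of Gaussians.\<close>

lemma poisson_kernel_gaussians:
  fixes y :: "'a::euclidean_space"
  assumes "s > 0"
  shows "has_bochner_integral lborel (\<lambda>v. indicator {0<..} v * (v ^ DIM('a) * exp (- (v\<^sup>2 * (s\<^sup>2 + (norm y)\<^sup>2)))))
    (gamma_moment DIM('a) / s * poisson_kernel s y)"
proof -
  have "s\<^sup>2 + (norm y)\<^sup>2 > 0" using assms by (simp add: add_pos_nonneg)
  then show ?thesis using gamma_moment_scaled[of "sqrt (s\<^sup>2 + (norm y)\<^sup>2)" "DIM('a)"] assms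
    by (simp add: poisson_kernel_def)
qed

text \<open>The superposed Gaussians are transformed one by one. The weight v^N is cancelled by the
  v^(-N) of the Gaussian transform, and the remaining integral over \<open>v\<close> is the
  subordination integral, which yields exp(-s |\<xi>|).\<close>

lemma poisson_fourier:
  fixes \<xi> :: "'a::euclidean_space"
  assumes s: "s > 0"
  shows "integrable lborel (\<lambda>y::'a. poisson_kernel s y)"
    and "(\<integral>y. complex_of_real (poisson_kernel s y) * cis (- (y \<bullet> \<xi>)) \<partial>lborel)
      = complex_of_real (poisson_mass TYPE('a) * exp (- (s * norm \<xi>)))"
proof -
  let ?N = "DIM('a)"
  let ?c = "gamma_moment ?N"
  define g where "g = (\<lambda>p::real \<times> 'a. indicator {0<..} (fst p) * (fst p ^ ?N * exp (- ((fst p)\<^sup>2 * (s\<^sup>2 + (norm (snd p))\<^sup>2)))))"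
  have g0: "g p \<ge> 0" for p by (simp add: g_def indicator_def)
  have [measurable]: "g \<in> borel_measurable borel"
    unfolding g_def borel_prod[symmetric] by measurable
  have c0: "?c > 0" by (rule gamma_moment_pos)
  have vint: "has_bochner_integral lborel (\<lambda>v. g (v, y)) (?c / s * poisson_kernel s y)" for y
    using poisson_kernel_gaussians[OF s, of y] by (simp add: g_def)
  have ge: "g (v, y) = (indicator {0<..} v * (v ^ ?N * exp (- (s\<^sup>2 * v\<^sup>2)))) * exp (- (v\<^sup>2 * (norm y)\<^sup>2))" for v y
    by (simp add: g_def exp_add[symmetric] algebra_simps)
  have yint: "has_bochner_integral lborel (\<lambda>y. g (v, y)) (indicator {0<..} v * (sqrt pi ^ ?N * exp (- (s\<^sup>2 * v\<^sup>2))))" for v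
  proof (cases "v > 0")
    case True
    have "has_bochner_integral lborel (\<lambda>y::'a. (v ^ ?N * exp (- (s\<^sup>2 * v\<^sup>2))) * exp (- (v\<^sup>2 * (norm y)\<^sup>2)))
      ((v ^ ?N * exp (- (s\<^sup>2 * v\<^sup>2))) * sqrt (pi / v\<^sup>2) ^ ?N)"
      by (rule has_bochner_integral_mult_right) (rule gaussian_integral_euclidean, use True in simp)
    then show ?thesis using True
      by (simp add: ge real_sqrt_divide power_divide mult.commute)
  qed (simp add: ge has_bochner_integral_zero)
  have "has_bochner_integral lborel (\<lambda>v. sqrt pi ^ ?N * (indicator {0<..} v * exp (- (s\<^sup>2 * v\<^sup>2) - 0\<^sup>2 / (4 * v\<^sup>2))))
     (sqrt pi ^ ?N * (sqrt pi / (2 * s) * exp (- (s * 0))))"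
    by (rule has_bochner_integral_mult_right) (rule subordination_integral[OF s], simp)
  then have fin: "integrable lborel (\<lambda>v. indicator {0<..} v * (sqrt pi ^ ?N * exp (- (s\<^sup>2 * v\<^sup>2))))"
    by (simp add: has_bochner_integral_iff mult_ac)
  \<comment> \<open>Absolute integrability is the case \<xi> = 0 of the same computation: the
    integrand is nonnegative and its iterated integral is finite.\<close>
  have gi: "integrable lborel g"
    unfolding lborel_prod[symmetric]
  proof (rule lborel_pair.Fubini_integrable)
    show "integrable lborel (\<lambda>v. \<integral>y. norm (g (v, y)) \<partial>lborel)"
      using fin yint g0 by (simp add: has_bochner_integral_iff)
    show "AE v in lborel. integrable lborel (\<lambda>y. g (v, y))"
      using yint by (simp add: has_bochner_integral_iff)
  qed (simp add: lborel_prod)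
  have "integrable lborel (\<lambda>y. \<integral>v. g (v, y) \<partial>lborel)"
    using lborel_pair.integrable_snd[of "\<lambda>x y. g (x, y)"] gi by (simp add: lborel_prod)
  then have "integrable lborel (\<lambda>y::'a. ?c / s * poisson_kernel s y)"
    using vint by (simp add: has_bochner_integral_iff)
  from integrable_mult_right[OF this, of "s / ?c"] show "integrable lborel (\<lambda>y::'a. poisson_kernel s y)"
    using s c0 by simp
  let ?G = "\<lambda>p. complex_of_real (g p) * cis (- (snd p \<bullet> \<xi>))"
  have Gi: "integrable lborel ?G"
  proof (rule Bochner_Integration.integrable_bound[OF gi])
    have [measurable]: "(\<lambda>p::real \<times> 'a. cis (- (snd p \<bullet> \<xi>))) \<in> borel_measurable borel"
      by (intro borel_measurable_continuous_onI continuous_intros)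
    show "?G \<in> borel_measurable lborel" by measurable
  qed (auto simp: norm_mult)
  have "(\<integral>y. complex_of_real (?c / s * poisson_kernel s y) * cis (- (y \<bullet> \<xi>)) \<partial>lborel) = (\<integral>y. \<integral>v. ?G (v, y) \<partial>lborel \<partial>lborel)"
    using vint by (simp add: has_bochner_integral_iff)
  also have "\<dots> = (\<integral>v. \<integral>y. ?G (v, y) \<partial>lborel \<partial>lborel)"
    using integral_lborel_pair[OF Gi] by simp
  also have "\<dots> = (\<integral>v. complex_of_real (sqrt pi ^ ?N * (indicator {0<..} v * exp (- (s\<^sup>2 * v\<^sup>2) - (norm \<xi>)\<^sup>2 / (4 * v\<^sup>2)))) \<partial>lborel)"
  proof (rule Bochner_Integration.integral_cong[OF refl])
    fix v :: real
    show "(\<integral>y. ?G (v, y) \<partial>lborel) = complex_of_real (sqrt pi ^ ?N * (indicator {0<..} v * exp (- (s\<^sup>2 * v\<^sup>2) - (norm \<xi>)\<^sup>2 / (4 * v\<^sup>2))))"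
    proof (cases "v > 0")
      case True
      have "(\<integral>y. ?G (v, y) \<partial>lborel) = complex_of_real (v ^ ?N * exp (- (s\<^sup>2 * v\<^sup>2))) * (\<integral>y. complex_of_real (exp (- (v\<^sup>2 * (norm (y::'a))\<^sup>2))) * cis (- (y \<bullet> \<xi>)) \<partial>lborel)"
        using True by (simp add: ge mult.assoc)
      also have "\<dots> = complex_of_real (v ^ ?N * exp (- (s\<^sup>2 * v\<^sup>2))) * complex_of_real (sqrt (pi / v\<^sup>2) ^ ?N * exp (- ((norm \<xi>)\<^sup>2 / (4 * v\<^sup>2))))"
        using True by (subst gaussian_fourier(2)) auto
      also have "\<dots> = complex_of_real (sqrt pi ^ ?N * (exp (- (s\<^sup>2 * v\<^sup>2)) * exp (- ((norm \<xi>)\<^sup>2 / (4 * v\<^sup>2)))))"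
        unfolding of_real_mult[symmetric] of_real_eq_iff
        using True by (simp add: real_sqrt_divide power_divide)
      also have "exp (- (s\<^sup>2 * v\<^sup>2)) * exp (- ((norm \<xi>)\<^sup>2 / (4 * v\<^sup>2))) = exp (- (s\<^sup>2 * v\<^sup>2) - (norm \<xi>)\<^sup>2 / (4 * v\<^sup>2))"
        by (simp add: exp_add[symmetric])
      finally show ?thesis using True by simp
    qed (simp add: ge)
  qed
  also have "\<dots> = complex_of_real (sqrt pi ^ ?N * (sqrt pi / (2 * s) * exp (- (s * norm \<xi>))))"
    using has_bochner_integral_mult_right[OF subordination_integral[OF s norm_ge_zero[of \<xi>]], of "sqrt pi ^ ?N"]
    by (simp only: integral_complex_of_real has_bochner_integral_iff)
  finally have "complex_of_real (s / ?c) * (\<integral>y. complex_of_real (?c / s * poisson_kernel s y) * cis (- (y \<bullet> \<xi>)) \<partial>lborel)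
      = complex_of_real (s / ?c) * complex_of_real (sqrt pi ^ ?N * (sqrt pi / (2 * s) * exp (- (s * norm \<xi>))))" by simp
  then show "(\<integral>y. complex_of_real (poisson_kernel s y) * cis (- (y \<bullet> \<xi>)) \<partial>lborel)
      = complex_of_real (poisson_mass TYPE('a) * exp (- (s * norm \<xi>)))"
    using s c0 by (simp add: poisson_mass_def mult.assoc) (simp add: mult_ac divide_simps)
qed

lemma poisson_integral:
  assumes "s > 0"
  shows "has_bochner_integral lborel (\<lambda>y::'a::euclidean_space. poisson_kernel s y) (poisson_mass TYPE('a))"
proof -
  have "complex_of_real (\<integral>y. poisson_kernel s (y::'a) \<partial>lborel) = complex_of_real (poisson_mass TYPE('a))"
    using poisson_fourier(2)[OF assms, where \<xi> = "0::'a"] by simp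
  then show ?thesis using poisson_fourier(1)[OF assms] by (simp only: has_bochner_integral_iff of_real_eq_iff)
qed

section \<open>Fourier transforms of test functions\<close>

definition fourier :: "('b::euclidean_space \<Rightarrow> real) \<Rightarrow> 'b \<Rightarrow> complex" where
  "fourier g \<xi> = (\<integral>y. complex_of_real (g y) * cis (- (y \<bullet> \<xi>)) \<partial>lborel)"

lemma cis_measurable [measurable]: "cis \<in> borel_measurable borel"
  by (intro borel_measurable_continuous_onI continuous_intros)

lemma integrable_mult_cis:
  assumes "integrable M f" "h \<in> borel_measurable M"
  shows "integrable M (\<lambda>x. f x * cis (h x))"
proof (rule Bochner_Integration.integrable_bound[OF assms(1)])
  have [measurable]: "f \<in> borel_measurable M" "h \<in> borel_measurable M"
    using assms by auto
  show "(\<lambda>x. f x * cis (h x)) \<in> borel_measurable M" by measurable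
qed (simp add: norm_mult)

lemma fourier_measurable:
  assumes [measurable]: "g \<in> borel_measurable borel"
  shows "fourier g \<in> borel_measurable borel"
  unfolding fourier_def by measurable

lemma norm_fourier_le:
  assumes "integrable lborel g"
  shows "norm (fourier g \<xi>) \<le> (\<integral>y. \<bar>g y\<bar> \<partial>lborel)"
proof -
  have "norm (fourier g \<xi>) \<le> (\<integral>y. norm (complex_of_real (g y) * cis (- (y \<bullet> \<xi>))) \<partial>lborel)"
    unfolding fourier_def by (rule integral_norm_bound)
  then show ?thesis by (simp add: norm_mult)
qed

lemma integral_lborel_scale:
  fixes f :: "'b::euclidean_space \<Rightarrow> 'c::{banach, second_countable_topology}"
  assumes c: "c \<noteq> 0" and [measurable]: "f \<in> borel_measurable borel"
  shows "(\<integral>x. f x \<partial>lborel) = \<bar>c\<bar> ^ DIM('b) *\<^sub>R (\<integral>x. f (t + c *\<^sub>R x) \<partial>lborel)"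
  by (subst lborel_affine[OF c, of t]) (simp add: integral_density integral_distr)

text \<open>Gaussian regularisation: the factor exp(-e^2 |\<xi>|^2) makes the double integral
  absolutely convergent, Fubini rewrites it as an average of \<open>g\<close> around
  \<open>x\<close> at scale e, and both forms converge as e tends to 0 by dominated
  convergence.\<close>

theorem fourier_inversion:
  fixes g :: "'b::euclidean_space \<Rightarrow> real"
  assumes g: "continuous_on UNIV g" "integrable lborel g" "\<And>y. \<bar>g y\<bar> \<le> B"
    and F: "integrable lborel (fourier g)"
  shows "(\<integral>\<xi>. fourier g \<xi> * cis (x \<bullet> \<xi>) \<partial>lborel) = complex_of_real ((2 * pi) ^ DIM('b) * g x)"
proof -
  let ?N = "DIM('b)"
  have [measurable]: "g \<in> borel_measurable borel" by (rule borel_measurable_continuous_onI[OF g(1)])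
  have [measurable]: "fourier g \<in> borel_measurable borel" by (rule fourier_measurable) measurable
  define e where "e = (\<lambda>n::nat. inverse (real (Suc n)))"
  have e0: "e n > 0" for n by (simp add: e_def)
  have elim: "e \<longlonglongrightarrow> 0" unfolding e_def by (rule LIMSEQ_inverse_real_of_nat)
  define I where "I = (\<lambda>n. \<integral>\<xi>. complex_of_real (exp (- ((e n)\<^sup>2 * (norm \<xi>)\<^sup>2))) * (fourier g \<xi> * cis (x \<bullet> \<xi>)) \<partial>lborel)"
  have lim1: "I \<longlonglongrightarrow> (\<integral>\<xi>. fourier g \<xi> * cis (x \<bullet> \<xi>) \<partial>lborel)"
    unfolding I_def
  proof (rule integral_dominated_convergence)
    show "integrable lborel (\<lambda>\<xi>. norm (fourier g \<xi>))" using F by simp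
    have "(\<lambda>n. complex_of_real (exp (- ((e n)\<^sup>2 * (norm \<xi>)\<^sup>2))) * (fourier g \<xi> * cis (x \<bullet> \<xi>)))
        \<longlonglongrightarrow> complex_of_real (exp (- (0\<^sup>2 * (norm \<xi>)\<^sup>2))) * (fourier g \<xi> * cis (x \<bullet> \<xi>))" for \<xi>
      by (intro tendsto_intros elim)
    then show "AE \<xi> in lborel. (\<lambda>n. complex_of_real (exp (- ((e n)\<^sup>2 * (norm \<xi>)\<^sup>2))) * (fourier g \<xi> * cis (x \<bullet> \<xi>)))
        \<longlonglongrightarrow> fourier g \<xi> * cis (x \<bullet> \<xi>)" by simp
    show "AE \<xi> in lborel. norm (complex_of_real (exp (- ((e n)\<^sup>2 * (norm \<xi>)\<^sup>2))) * (fourier g \<xi> * cis (x \<bullet> \<xi>))) \<le> norm (fourier g \<xi>)" for n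
      by (simp add: norm_mult mult_left_le_one_le)
  qed measurable
  have I: "I n = complex_of_real ((2 * sqrt pi) ^ ?N * (\<integral>z. g (x + (2 * e n) *\<^sub>R z) * exp (- (1 * (norm z)\<^sup>2)) \<partial>lborel))" for n
  proof -
    let ?a = "(e n)\<^sup>2"
    have a: "?a > 0" using e0[of n] by simp
    let ?H = "\<lambda>p. (complex_of_real (exp (- (?a * (norm (fst p))\<^sup>2)) * g (snd p))) * cis ((x - snd p) \<bullet> fst p)"
    have Hi: "integrable lborel ?H"
    proof (rule integrable_mult_cis)
      have "integrable (lborel \<Otimes>\<^sub>M lborel) (\<lambda>p::'b\<times>'b. exp (- (?a * (norm (fst p))\<^sup>2)) * g (snd p))"
      proof (rule lborel_pair.Fubini_integrable)
        show "integrable lborel (\<lambda>\<xi>::'b. \<integral>y. norm (exp (- (?a * (norm (fst (\<xi>, y)))\<^sup>2)) * g (snd (\<xi>, y))) \<partial>lborel)"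
          using gaussian_integral_euclidean[where 'a = 'b, OF a] by (simp add: abs_mult has_bochner_integral_iff)
        show "AE \<xi> in lborel. integrable lborel (\<lambda>y. exp (- (?a * (norm (fst (\<xi>, y)))\<^sup>2)) * g (snd (\<xi>, y)))"
          using g(2) by simp
      qed measurable
      then show "integrable lborel (\<lambda>p::'b\<times>'b. complex_of_real (exp (- (?a * (norm (fst p))\<^sup>2)) * g (snd p)))"
        by (intro integrable_of_real) (simp add: lborel_prod)
      have "(\<lambda>p::'b\<times>'b. (x - snd p) \<bullet> fst p) \<in> borel_measurable (borel \<Otimes>\<^sub>M borel)" by measurable
      then show "(\<lambda>p::'b\<times>'b. (x - snd p) \<bullet> fst p) \<in> borel_measurable lborel" by (simp add: borel_prod)
    qed
    have c: "cis (- (y \<bullet> \<xi>)) * cis (x \<bullet> \<xi>) = cis ((x - y) \<bullet> \<xi>)" for y \<xi> by (simp add: cis_mult inner_diff_left)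
    have "I n = (\<integral>\<xi>. \<integral>y. ?H (\<xi>, y) \<partial>lborel \<partial>lborel)"
      unfolding I_def
    proof (rule Bochner_Integration.integral_cong[OF refl])
      fix \<xi> :: 'b
      have "complex_of_real (exp (- (?a * (norm \<xi>)\<^sup>2))) * (fourier g \<xi> * cis (x \<bullet> \<xi>))
         = (\<integral>y. complex_of_real (exp (- (?a * (norm \<xi>)\<^sup>2))) * ((complex_of_real (g y) * cis (- (y \<bullet> \<xi>))) * cis (x \<bullet> \<xi>)) \<partial>lborel)"
        unfolding fourier_def by simp
      also have "\<dots> = (\<integral>y. ?H (\<xi>, y) \<partial>lborel)"
        by (simp add: c mult.assoc)
      finally show "complex_of_real (exp (- (?a * (norm \<xi>)\<^sup>2))) * (fourier g \<xi> * cis (x \<bullet> \<xi>)) = (\<integral>y. ?H (\<xi>, y) \<partial>lborel)" .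
    qed
    also have "\<dots> = (\<integral>y. \<integral>\<xi>. ?H (\<xi>, y) \<partial>lborel \<partial>lborel)"
      using integral_lborel_pair[OF Hi] by simp
    also have "\<dots> = (\<integral>y. complex_of_real (g y * (sqrt (pi / ?a) ^ ?N * exp (- ((norm (y - x))\<^sup>2 / (4 * ?a))))) \<partial>lborel)"
    proof (rule Bochner_Integration.integral_cong[OF refl])
      fix y :: 'b
      have "(\<integral>\<xi>. ?H (\<xi>, y) \<partial>lborel) = complex_of_real (g y) * (\<integral>\<xi>. complex_of_real (exp (- (?a * (norm \<xi>)\<^sup>2))) * cis (- (\<xi> \<bullet> (y - x))) \<partial>lborel)"
        by (subst integral_mult_right_zero[symmetric]) (simp add: inner_commute inner_diff_left algebra_simps)
      then show "(\<integral>\<xi>. ?H (\<xi>, y) \<partial>lborel) = complex_of_real (g y * (sqrt (pi / ?a) ^ ?N * exp (- ((norm (y - x))\<^sup>2 / (4 * ?a)))))"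
        by (simp only: gaussian_fourier(2)[OF a] of_real_mult)
    qed
    also have "\<dots> = complex_of_real (\<integral>y. g y * (sqrt (pi / ?a) ^ ?N * exp (- ((norm (y - x))\<^sup>2 / (4 * ?a)))) \<partial>lborel)"
      by (rule integral_complex_of_real)
    \<comment> \<open>Substituting y = x + 2 e z makes the Gaussian independent of e. The Jacobian
      (2 e)^N meets (sqrt pi / e)^N, so the scale disappears from the constant.\<close>
    also have "(\<integral>y. g y * (sqrt (pi / ?a) ^ ?N * exp (- ((norm (y - x))\<^sup>2 / (4 * ?a)))) \<partial>lborel)
       = \<bar>2 * e n\<bar> ^ ?N *\<^sub>R (\<integral>z. g (x + (2 * e n) *\<^sub>R z) * (sqrt (pi / ?a) ^ ?N * exp (- ((norm ((x + (2 * e n) *\<^sub>R z) - x))\<^sup>2 / (4 * ?a)))) \<partial>lborel)"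
      using e0[of n] by (intro integral_lborel_scale) auto
    also have "\<dots> = (2 * e n) ^ ?N * ((sqrt pi / e n) ^ ?N * (\<integral>z. g (x + (2 * e n) *\<^sub>R z) * exp (- (1 * (norm z)\<^sup>2)) \<partial>lborel))"
    proof -
      have "(norm ((x + (2 * e n) *\<^sub>R z) - x))\<^sup>2 / (4 * ?a) = (norm z)\<^sup>2" for z :: 'b
        using e0[of n] by (simp add: power_mult_distrib)
      moreover have "sqrt (pi / ?a) = sqrt pi / e n" using e0[of n] by (simp add: real_sqrt_divide)
      ultimately show ?thesis using e0[of n]
        by (simp only: integral_mult_right_zero[symmetric]) (simp add: mult_ac)
    qed
    also have "\<dots> = (2 * sqrt pi) ^ ?N * (\<integral>z. g (x + (2 * e n) *\<^sub>R z) * exp (- (1 * (norm z)\<^sup>2)) \<partial>lborel)"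
      using e0[of n] by (simp add: power_mult_distrib power_divide)
    finally show ?thesis .
  qed
  have gi: "has_bochner_integral lborel (\<lambda>z::'b. exp (- (1 * (norm z)\<^sup>2))) (sqrt (pi / 1) ^ ?N)"
    by (rule gaussian_integral_euclidean) simp
  have "(\<lambda>n. \<integral>z. g (x + (2 * e n) *\<^sub>R z) * exp (- (1 * (norm z)\<^sup>2)) \<partial>lborel) \<longlonglongrightarrow> (\<integral>z. g x * exp (- (1 * (norm (z::'b))\<^sup>2)) \<partial>lborel)"
  proof (rule integral_dominated_convergence)
    show "integrable lborel (\<lambda>z::'b. B * exp (- (1 * (norm z)\<^sup>2)))" using gi by (simp add: has_bochner_integral_iff)
    have "(\<lambda>n. g (x + (2 * e n) *\<^sub>R z) * exp (- (1 * (norm z)\<^sup>2))) \<longlonglongrightarrow> g (x + (2 * 0) *\<^sub>R z) * exp (- (1 * (norm z)\<^sup>2))" for z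
      by (intro tendsto_mult tendsto_const continuous_on_tendsto_compose[OF g(1)] tendsto_intros elim) auto
    then show "AE z in lborel. (\<lambda>n. g (x + (2 * e n) *\<^sub>R z) * exp (- (1 * (norm z)\<^sup>2))) \<longlonglongrightarrow> g x * exp (- (1 * (norm z)\<^sup>2))" by simp
    show "AE z in lborel. norm (g (x + (2 * e n) *\<^sub>R z) * exp (- (1 * (norm z)\<^sup>2))) \<le> B * exp (- (1 * (norm z)\<^sup>2))" for n
      using g(3) by (auto simp: abs_mult intro!: mult_right_mono)
  qed measurable
  then have "(\<lambda>n. \<integral>z. g (x + (2 * e n) *\<^sub>R z) * exp (- (1 * (norm z)\<^sup>2)) \<partial>lborel) \<longlonglongrightarrow> g x * sqrt pi ^ ?N"
    using gi by (simp add: has_bochner_integral_iff)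
  then have "I \<longlonglongrightarrow> complex_of_real ((2 * sqrt pi) ^ ?N * (g x * sqrt pi ^ ?N))"
    unfolding I by (intro tendsto_intros)
  moreover have "(2 * sqrt pi) ^ ?N * (g x * sqrt pi ^ ?N) = (2 * pi) ^ ?N * g x"
  proof -
    have "(2 * sqrt pi) ^ ?N * sqrt pi ^ ?N = (2 * pi) ^ ?N"
      by (simp only: power_mult_distrib[symmetric] mult.assoc real_sqrt_mult_self) simp
    then show ?thesis by (metis mult.assoc mult.commute)
  qed
  ultimately show ?thesis using LIMSEQ_unique[OF lim1] by metis
qed

lemma poisson_average:
  fixes F :: "'b::euclidean_space \<Rightarrow> complex"
  assumes F: "integrable lborel F" and s: "s > 0"
  shows "(\<integral>y. complex_of_real (poisson_kernel s y) * (\<integral>\<xi>. F \<xi> * cis ((x + y) \<bullet> \<xi>) \<partial>lborel) \<partial>lborel)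
    = complex_of_real (poisson_mass TYPE('b)) * (\<integral>\<xi>. complex_of_real (exp (- (s * norm \<xi>))) * F \<xi> * cis (x \<bullet> \<xi>) \<partial>lborel)"
proof -
  have [measurable]: "F \<in> borel_measurable borel" using F by auto
  let ?H = "\<lambda>p. complex_of_real (poisson_kernel s (fst p)) * F (snd p) * cis ((x + fst p) \<bullet> snd p)"
  have P: "integrable lborel (\<lambda>y::'b. poisson_kernel s y)" by (rule poisson_fourier(1)[OF s])
  have Hi: "integrable lborel ?H"
  proof (rule integrable_mult_cis)
    have "integrable (lborel \<Otimes>\<^sub>M lborel) (\<lambda>p::'b\<times>'b. complex_of_real (poisson_kernel s (fst p)) * F (snd p))"
    proof (rule lborel_pair.Fubini_integrable)
      show "integrable lborel (\<lambda>y::'b. \<integral>\<xi>. norm (complex_of_real (poisson_kernel s (fst (y, \<xi>))) * F (snd (y, \<xi>))) \<partial>lborel)"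
        using integrable_norm[OF P] s by (simp add: norm_mult)
      show "AE y in lborel. integrable lborel (\<lambda>\<xi>. complex_of_real (poisson_kernel s (fst (y, \<xi>))) * F (snd (y, \<xi>)))"
        using F by simp
    qed measurable
    then show "integrable lborel (\<lambda>p::'b\<times>'b. complex_of_real (poisson_kernel s (fst p)) * F (snd p))"
      by (simp add: lborel_prod)
    have "(\<lambda>p::'b\<times>'b. (x + fst p) \<bullet> snd p) \<in> borel_measurable (borel \<Otimes>\<^sub>M borel)" by measurable
    then show "(\<lambda>p::'b\<times>'b. (x + fst p) \<bullet> snd p) \<in> borel_measurable lborel" by (simp add: borel_prod)
  qed
  have "(\<integral>y. complex_of_real (poisson_kernel s y) * (\<integral>\<xi>. F \<xi> * cis ((x + y) \<bullet> \<xi>) \<partial>lborel) \<partial>lborel)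
    = (\<integral>y. \<integral>\<xi>. ?H (y, \<xi>) \<partial>lborel \<partial>lborel)"
    by (simp add: mult.assoc)
  also have "\<dots> = (\<integral>\<xi>. \<integral>y. ?H (y, \<xi>) \<partial>lborel \<partial>lborel)"
    using integral_lborel_pair[OF Hi] by simp
  also have "\<dots> = (\<integral>\<xi>. complex_of_real (poisson_mass TYPE('b)) * (complex_of_real (exp (- (s * norm \<xi>))) * F \<xi> * cis (x \<bullet> \<xi>)) \<partial>lborel)"
  proof (rule Bochner_Integration.integral_cong[OF refl])
    fix \<xi> :: 'b
    have "(\<integral>y. ?H (y, \<xi>) \<partial>lborel) = (F \<xi> * cis (x \<bullet> \<xi>)) * (\<integral>y. complex_of_real (poisson_kernel s y) * cis (- (y \<bullet> (- \<xi>))) \<partial>lborel)"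
      by (subst integral_mult_right_zero[symmetric]) (simp add: inner_add_left cis_mult[symmetric] mult_ac)
    then show "(\<integral>y. ?H (y, \<xi>) \<partial>lborel) = complex_of_real (poisson_mass TYPE('b)) * (complex_of_real (exp (- (s * norm \<xi>))) * F \<xi> * cis (x \<bullet> \<xi>))"
      by (simp only: poisson_fourier(2)[OF s]) simp
  qed
  finally show ?thesis by simp
qed

section \<open>Decay of the space Fourier transform of a test function\<close>

lemma test_function_slab:
  fixes \<phi> :: "'b::euclidean_space \<times> real \<Rightarrow> real"
  assumes "test_function \<phi>"
  shows "\<exists>B R. B \<ge> 0 \<and> R > 0 \<and> (\<forall>x t. \<bar>\<phi> (x, t)\<bar> \<le> B) \<and>
    (\<forall>x t. (x, t) \<in> fun_support \<phi> \<longrightarrow> norm x \<le> R \<and> \<bar>t\<bar> \<le> R)"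
proof -
  obtain B where B: "\<And>z. \<bar>\<phi> z\<bar> \<le> B" using test_function_bounded[OF assms] by blast
  have "bounded (fun_support \<phi>)" using assms compact_imp_bounded by (auto simp: test_function_def)
  then obtain R where R: "R > 0" "\<And>z. z \<in> fun_support \<phi> \<Longrightarrow> norm z \<le> R"
    unfolding bounded_pos by metis
  have "B \<ge> 0" using B[of undefined] by linarith
  moreover have "norm x \<le> R \<and> \<bar>t\<bar> \<le> R" if "(x, t) \<in> fun_support \<phi>" for x t
    using R(2)[OF that] norm_fst_le[of x t] norm_snd_le[of t x] by auto
  ultimately show ?thesis using B R(1) by blast
qed

lemma integrable_cball_bounded:
  fixes f :: "'b::euclidean_space \<Rightarrow> 'c::{banach, second_countable_topology}"
  assumes "f \<in> borel_measurable borel" "\<And>x. norm (f x) \<le> B" "\<And>x. f x \<noteq> 0 \<Longrightarrow> norm x \<le> R"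
  shows "integrable lborel f" and "(\<integral>x. norm (f x) \<partial>lborel) \<le> B * measure lborel (cball (0::'b) R)"
proof -
  have B: "B \<ge> 0" using order_trans[OF norm_ge_zero assms(2)[of 0]] .
  have i: "integrable lborel (\<lambda>x::'b. B * indicator (cball 0 R) x)"
    by (intro integrable_mult_right integrable_real_indicator) (auto simp: emeasure_bounded_finite[OF bounded_cball, simplified])
  have b: "norm (f x) \<le> B * indicator (cball 0 R) x" for x
    using assms(2)[of x] assms(3)[of x] B by (cases "f x = 0") (auto simp: indicator_def)
  show "integrable lborel f"
    by (rule Bochner_Integration.integrable_bound[OF i]) (use assms(1) b B in \<open>auto simp: abs_mult\<close>)
  then have "(\<integral>x. norm (f x) \<partial>lborel) \<le> (\<integral>x. B * indicator (cball 0 R) (x::'b) \<partial>lborel)"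
  proof (intro Bochner_Integration.integral_mono)
    show "norm (f x) \<le> B * indicator (cball 0 R) x" for x by (rule b)
  qed (use i in auto)
  then show "(\<integral>x. norm (f x) \<partial>lborel) \<le> B * measure lborel (cball (0::'b) R)"
    by simp
qed

lemma slice_continuous:
  fixes \<phi> :: "'b::euclidean_space \<times> real \<Rightarrow> real"
  assumes "smooth \<phi>"
  shows "continuous_on UNIV (\<lambda>y. \<phi> (y, t))"
  by (rule continuous_on_compose2[OF smooth_continuous_on[OF assms, of UNIV]]) (auto intro!: continuous_intros)

lemma slice_integrable:
  fixes \<phi> :: "'b::euclidean_space \<times> real \<Rightarrow> real"
  assumes "test_function \<phi>"
  shows "integrable lborel (\<lambda>y. \<phi> (y, t))"
proof -
  obtain B R where "\<And>x t. \<bar>\<phi> (x, t)\<bar> \<le> B" and R: "\<And>x t. (x, t) \<in> fun_support \<phi> \<Longrightarrow> norm x \<le> R \<and> \<bar>t\<bar> \<le> R"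
    using test_function_slab[OF assms] by metis
  moreover have "norm x \<le> R" if "\<phi> (x, t) \<noteq> 0" for x
    using that not_in_fun_support[of "(x, t)" \<phi>] R by blast
  ultimately show ?thesis
    by (intro integrable_cball_bounded(1)[where B = B and R = R] borel_measurable_continuous_onI slice_continuous
         test_function_smooth assms) auto
qed

text \<open>Integrating the fundamental theorem of calculus along \<open>v\<close> over all base points gives
  integration by parts without a divergence theorem.\<close>

lemma integral_directional_derivative_eq_0:
  fixes G D :: "'b::euclidean_space \<Rightarrow> complex"
  assumes G: "integrable lborel G" and D: "integrable lborel D" "continuous_on UNIV D"
    and d: "\<And>y s. ((\<lambda>s. G (y + s *\<^sub>R v)) has_vector_derivative D (y + s *\<^sub>R v)) (at s)"
  shows "(\<integral>y. D y \<partial>lborel) = 0"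
proof -
  have [measurable]: "G \<in> borel_measurable borel" "D \<in> borel_measurable borel" using G D by auto
  let ?H = "\<lambda>p::real \<times> 'b. indicator {0..1} (fst p) *\<^sub>R D (snd p + fst p *\<^sub>R v)"
  have tr: "(\<integral>y. norm (D (y + s *\<^sub>R v)) \<partial>lborel) = (\<integral>y. norm (D y) \<partial>lborel)" for s
    by (rule integral_lborel_translate(1)[of "\<lambda>y. norm (D y)"]) measurable
  have "integrable (lborel \<Otimes>\<^sub>M lborel) ?H"
  proof (rule lborel_pair.Fubini_integrable)
    show "integrable lborel (\<lambda>s. \<integral>y. norm (?H (s, y)) \<partial>lborel)"
      by (simp add: tr)
    show "AE s in lborel. integrable lborel (\<lambda>y. ?H (s, y))"
      using D by (simp add: integrable_lborel_translate)
  qed measurable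
  then have Hi: "integrable lborel ?H" by (simp add: lborel_prod)
  have FTC: "(\<integral>s. ?H (s, y) \<partial>lborel) = G (y + v) - G y" for y
  proof -
    have "(\<integral>s. indicator {0..1} s *\<^sub>R D (y + s *\<^sub>R v) \<partial>lborel) = G (y + 1 *\<^sub>R v) - G (y + 0 *\<^sub>R v)"
    proof (rule integral_FTC_Icc)
      show "continuous_on {0..1} (\<lambda>s. D (y + s *\<^sub>R v))"
        by (rule continuous_on_compose2[OF D(2)]) (auto intro!: continuous_intros)
    qed (auto intro: has_vector_derivative_at_within d)
    then show ?thesis by simp
  qed
  have Gs: "integrable lborel (\<lambda>y. G (y + v))" using G by (simp add: integrable_lborel_translate)
  have "(\<integral>y. D y \<partial>lborel) = (\<integral>s. indicator {0..1} s *\<^sub>R (\<integral>y. D y \<partial>lborel) \<partial>(lborel :: real measure))" by simp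
  also have "\<dots> = (\<integral>s. \<integral>y. ?H (s, y) \<partial>lborel \<partial>lborel)"
    by (simp add: integral_lborel_translate(1)[of D])
  also have "\<dots> = (\<integral>y. \<integral>s. ?H (s, y) \<partial>lborel \<partial>lborel)"
    using integral_lborel_pair[OF Hi] by simp
  also have "\<dots> = (\<integral>y. G (y + v) - G y \<partial>lborel)" by (simp only: FTC)
  also have "\<dots> = 0" using G Gs by (simp add: integral_lborel_translate(1)[of G])
  finally show ?thesis .
qed

lemma smooth_slice_derivative:
  fixes \<phi> :: "'b::euclidean_space \<times> real \<Rightarrow> real"
  assumes "smooth \<phi>"
  shows "((\<lambda>s. \<phi> (y + s *\<^sub>R v, t)) has_real_derivative dirderiv (v, 0) \<phi> (y + s *\<^sub>R v, t)) (at s)"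
proof -
  have 1: "((\<lambda>s. (y + s *\<^sub>R v, t)) has_derivative (\<lambda>h. (h *\<^sub>R v, 0))) (at s)"
    by (auto intro!: derivative_eq_intros)
  have "((\<lambda>s. \<phi> (y + s *\<^sub>R v, t)) has_derivative (\<lambda>h. dirderiv (h *\<^sub>R v, 0) \<phi> (y + s *\<^sub>R v, t))) (at s)"
    by (rule has_derivative_compose[OF 1 smooth_has_derivative[OF assms]])
  moreover have "dirderiv (h *\<^sub>R v, 0) \<phi> z = dirderiv (v, 0) \<phi> z * h" for h z
    using linear_scale[OF has_derivative_linear[OF smooth_has_derivative[OF assms]], of h "(v, 0)" z]
    by simp
  ultimately show ?thesis by (simp add: has_field_derivative_def)
qed

lemma fourier_dirderiv:
  fixes \<phi> :: "'b::euclidean_space \<times> real \<Rightarrow> real"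
  assumes \<phi>: "test_function \<phi>"
  shows "fourier (\<lambda>y. dirderiv (v, 0) \<phi> (y, t)) \<xi> = \<i> * complex_of_real (v \<bullet> \<xi>) * fourier (\<lambda>y. \<phi> (y, t)) \<xi>"
proof -
  let ?G = "\<lambda>y. complex_of_real (\<phi> (y, t)) * cis (- (y \<bullet> \<xi>))"
  let ?A = "\<lambda>y. complex_of_real (dirderiv (v, 0) \<phi> (y, t)) * cis (- (y \<bullet> \<xi>))"
  \<comment> \<open>The derivative of \<open>?G\<close> along \<open>v\<close>; the second term
    comes from differentiating the character.\<close>
  let ?D = "\<lambda>y. ?A y - \<i> * complex_of_real (v \<bullet> \<xi>) * ?G y"
  have s: "smooth \<phi>" "smooth (dirderiv (v, 0) \<phi>)" using \<phi> by (auto intro: test_function_smooth smooth_dirderiv)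
  have m: "(\<lambda>y. - (y \<bullet> \<xi>)) \<in> borel_measurable lborel" by simp
  have i: "integrable lborel ?G" "integrable lborel ?A"
    by (intro integrable_mult_cis m integrable_of_real slice_integrable test_function_dirderiv \<phi>)+
  have "(\<integral>y. ?D y \<partial>lborel) = 0"
  proof (rule integral_directional_derivative_eq_0[where v = v])
    show "integrable lborel ?G" by fact
    show "integrable lborel ?D" using i by simp
    show "continuous_on UNIV ?D"
      by (intro continuous_intros slice_continuous s)
    fix y s
    have 1: "((\<lambda>s. complex_of_real (\<phi> (y + s *\<^sub>R v, t))) has_vector_derivative complex_of_real (dirderiv (v, 0) \<phi> (y + s *\<^sub>R v, t))) (at s)"
      using smooth_slice_derivative[OF s(1), of y v t s] has_vector_derivative_of_real
      by (simp add: has_real_derivative_iff_has_vector_derivative)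
    have "((\<lambda>s. cis (- ((y + s *\<^sub>R v) \<bullet> \<xi>))) has_vector_derivative - (v \<bullet> \<xi>) *\<^sub>R (\<i> * cis (- ((y + s *\<^sub>R v) \<bullet> \<xi>)))) (at s)"
    proof -
      have "((\<lambda>s. - ((y + s *\<^sub>R v) \<bullet> \<xi>)) has_vector_derivative - (v \<bullet> \<xi>)) (at s)"
        unfolding has_real_derivative_iff_has_vector_derivative[symmetric]
        by (auto intro!: derivative_eq_intros simp: inner_add_left)
      moreover have "(cis has_vector_derivative \<i> * cis u) (at u)" for u
        by (auto intro!: derivative_eq_intros simp: has_vector_derivative_def scaleR_conv_of_real mult_ac)
      ultimately show ?thesis
        using vector_diff_chain_at[of "\<lambda>s. - ((y + s *\<^sub>R v) \<bullet> \<xi>)" "- (v \<bullet> \<xi>)" s cis] by (simp add: o_def)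
    qed
    from has_vector_derivative_mult[OF 1 this]
    show "((\<lambda>s. ?G (y + s *\<^sub>R v)) has_vector_derivative ?D (y + s *\<^sub>R v)) (at s)"
      by (simp add: scaleR_conv_of_real algebra_simps)
  qed
  then show ?thesis using i by (simp add: fourier_def)
qed

lemma fourier_iter_deriv:
  fixes \<phi> :: "'b::euclidean_space \<times> real \<Rightarrow> real"
  assumes \<phi>: "test_function \<phi>"
  shows "fourier (\<lambda>y. iter_deriv (replicate m (v, 0)) \<phi> (y, t)) \<xi> = (\<i> * complex_of_real (v \<bullet> \<xi>)) ^ m * fourier (\<lambda>y. \<phi> (y, t)) \<xi>"
  by (induction m)
     (simp_all add: iter_deriv_Cons fourier_dirderiv test_function_iter_deriv \<phi> del: iter_deriv.simps(2))

text \<open>Differentiating \<open>m\<close> times along \<xi> itself multiplies the transform by (i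
  |\<xi>|^2)^m, while the derivative is only of size |\<xi>|^m; dividing leaves decay of order
  \<open>m\<close>. The bound is uniform in \<open>t\<close> because all slices are supported in one
  ball.\<close>

lemma fourier_power_bound:
  fixes \<phi> :: "'b::euclidean_space \<times> real \<Rightarrow> real"
  assumes \<phi>: "test_function \<phi>"
  shows "\<exists>C\<ge>0. \<forall>t \<xi>. norm \<xi> ^ m * norm (fourier (\<lambda>y. \<phi> (y, t)) \<xi>) \<le> C"
proof -
  obtain R where R: "R > 0" "\<And>x t. (x, t) \<in> fun_support \<phi> \<Longrightarrow> norm x \<le> R \<and> \<bar>t\<bar> \<le> R"
    using test_function_slab[OF \<phi>] by metis
  obtain B where B: "B \<ge> 0" "\<And>vs x. length vs = m \<Longrightarrow> \<bar>iter_deriv vs \<phi> x\<bar> \<le> B * prod_list (map norm vs)"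
    using smooth_bounded_iter_deriv_bound[OF test_function_smooth_bounded[OF \<phi>]] by metis
  let ?V = "measure lborel (cball (0::'b) R)"
  have "norm \<xi> ^ m * norm (fourier (\<lambda>y. \<phi> (y, t)) \<xi>) \<le> B * ?V" for t \<xi>
  proof (cases "norm \<xi> ^ m = 0")
    case True
    show ?thesis unfolding True using B by simp
  next
    case False
    let ?\<psi> = "iter_deriv (replicate m (\<xi>, 0)) \<phi>"
    have t: "test_function ?\<psi>" by (rule test_function_iter_deriv[OF \<phi>])
    have b: "\<bar>?\<psi> z\<bar> \<le> B * norm \<xi> ^ m" for z
      using B(2)[of "replicate m (\<xi>, 0)" z] by (simp add: norm_Pair map_replicate_const)
    have "norm (fourier (\<lambda>y. ?\<psi> (y, t)) \<xi>) \<le> (\<integral>y. \<bar>?\<psi> (y, t)\<bar> \<partial>lborel)"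
      by (rule norm_fourier_le[OF slice_integrable[OF t]])
    also have "\<dots> \<le> (B * norm \<xi> ^ m) * ?V"
    proof -
      have "norm y \<le> R" if "?\<psi> (y, t) \<noteq> 0" for y
        using that not_in_fun_support[of "(y, t)" ?\<psi>] R(2)[of y t]
          fun_support_iter_deriv[OF test_function_smooth[OF \<phi>], of "replicate m (\<xi>, 0)"] by blast
      then show ?thesis
        using integrable_cball_bounded(2)[where f = "\<lambda>y. ?\<psi> (y, t)" and B = "B * norm \<xi> ^ m" and R = R] b
          borel_measurable_integrable[OF slice_integrable[OF t]] by auto
    qed
    also have "norm (fourier (\<lambda>y. ?\<psi> (y, t)) \<xi>) = norm \<xi> ^ m * (norm \<xi> ^ m * norm (fourier (\<lambda>y. \<phi> (y, t)) \<xi>))"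
      by (simp add: fourier_iter_deriv[OF \<phi>] norm_mult norm_power power_mult_distrib[symmetric] power2_norm_eq_inner[symmetric] power2_eq_square)
    finally have "norm \<xi> ^ m * (norm \<xi> ^ m * norm (fourier (\<lambda>y. \<phi> (y, t)) \<xi>)) \<le> norm \<xi> ^ m * (B * ?V)"
      by (simp add: mult_ac)
    moreover have "norm \<xi> ^ m > 0" using False by (metis norm_ge_zero order_le_less zero_le_power)
    ultimately show ?thesis by (simp only: mult_le_cancel_left_pos)
  qed
  then show ?thesis using B by (intro exI[of _ "B * ?V"]) simp
qed

text \<open>\<open>poisson_kernel 1\<close> serves as a ready-made integrable majorant with decay
  |\<xi>|^(-N-1). The order N + 2 used below is N + 1 for the majorant and one more for the
  multiplier |\<xi>|.\<close>

lemma fourier_decay: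
  fixes \<phi> :: "'b::euclidean_space \<times> real \<Rightarrow> real"
  assumes \<phi>: "test_function \<phi>"
  shows "\<exists>C\<ge>0. \<forall>t \<xi>. (1 + norm \<xi>) * norm (fourier (\<lambda>y. \<phi> (y, t)) \<xi>) \<le> C * poisson_kernel 1 \<xi>"
proof -
  let ?n = "DIM('b) + 2"
  obtain C0 where C0: "C0 \<ge> 0" "\<And>t \<xi>. norm \<xi> ^ 0 * norm (fourier (\<lambda>y. \<phi> (y, t)) \<xi>) \<le> C0"
    using fourier_power_bound[OF \<phi>, of 0] by metis
  obtain C1 where C1: "C1 \<ge> 0" "\<And>t \<xi>. norm \<xi> ^ ?n * norm (fourier (\<lambda>y. \<phi> (y, t)) \<xi>) \<le> C1"
    using fourier_power_bound[OF \<phi>, of ?n] by metis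
  have "(1 + norm \<xi>) * norm (fourier (\<lambda>y. \<phi> (y, t)) \<xi>) \<le> (2 ^ ?n * (C0 + C1)) * poisson_kernel 1 \<xi>" for t \<xi>
  proof -
    let ?r = "norm \<xi>" and ?f = "norm (fourier (\<lambda>y. \<phi> (y, t)) \<xi>)"
    let ?q = "sqrt (1\<^sup>2 + ?r\<^sup>2)"
    have q: "0 < ?q" "?q \<le> 1 + ?r"
      by (auto simp: add_pos_nonneg power2_eq_square algebra_simps intro!: real_le_lsqrt)
    have "?q ^ Suc DIM('b) * ((1 + ?r) * ?f) \<le> (1 + ?r) ^ Suc DIM('b) * ((1 + ?r) * ?f)"
      using q by (intro mult_right_mono power_mono) auto
    also have "\<dots> = (1 + ?r) ^ ?n * ?f" by (simp add: mult_ac)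
    also have "\<dots> \<le> (2 ^ ?n * (1 + ?r ^ ?n)) * ?f"
    proof (rule mult_right_mono)
      have "(1 + ?r) ^ ?n \<le> (2 * max 1 ?r) ^ ?n" by (rule power_mono) auto
      also have "\<dots> \<le> 2 ^ ?n * (1 + ?r ^ ?n)"
        by (simp only: power_mult_distrib) (intro mult_left_mono, auto simp: max_def)
      finally show "(1 + ?r) ^ ?n \<le> 2 ^ ?n * (1 + ?r ^ ?n)" .
    qed simp
    also have "\<dots> = 2 ^ ?n * (?r ^ 0 * ?f + ?r ^ ?n * ?f)" by (simp add: algebra_simps)
    also have "\<dots> \<le> 2 ^ ?n * (C0 + C1)" using C0(2)[of \<xi> t] C1(2)[of \<xi> t] by (intro mult_left_mono add_mono) auto
    finally have "?q ^ Suc DIM('b) * ((1 + ?r) * ?f) \<le> 2 ^ ?n * (C0 + C1)" .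
    then have "(1 + ?r) * ?f \<le> 2 ^ ?n * (C0 + C1) / ?q ^ Suc DIM('b)"
      using q by (simp only: pos_le_divide_eq zero_less_power mult.commute[of "?q ^ Suc DIM('b)"])
    then show ?thesis by (simp add: poisson_kernel_def)
  qed
  moreover have "2 ^ ?n * (C0 + C1) \<ge> 0" using C0 C1 by simp
  ultimately show ?thesis by blast
qed

lemma fourier_slice_integrable:
  fixes \<phi> :: "'b::euclidean_space \<times> real \<Rightarrow> real"
  assumes \<phi>: "test_function \<phi>"
  shows "integrable lborel (fourier (\<lambda>y. \<phi> (y, t)))"
    and "integrable lborel (\<lambda>\<xi>. complex_of_real (norm \<xi>) * fourier (\<lambda>y. \<phi> (y, t)) \<xi>)"
proof -
  obtain C where C: "C \<ge> 0" "\<And>t \<xi>. (1 + norm \<xi>) * norm (fourier (\<lambda>y. \<phi> (y, t)) \<xi>) \<le> C * poisson_kernel 1 \<xi>"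
    using fourier_decay[OF \<phi>] by metis
  have i: "integrable lborel (\<lambda>\<xi>::'b. C * poisson_kernel 1 \<xi>)"
    by (intro integrable_mult_right poisson_fourier(1)) simp
  have [measurable]: "fourier (\<lambda>y. \<phi> (y, t)) \<in> borel_measurable borel"
    by (intro fourier_measurable borel_measurable_continuous_onI slice_continuous test_function_smooth \<phi>)
  have *: "norm (fourier (\<lambda>y. \<phi> (y, t)) \<xi>) + norm \<xi> * norm (fourier (\<lambda>y. \<phi> (y, t)) \<xi>) \<le> norm (C * poisson_kernel 1 \<xi>)" for \<xi>
    using C(2)[of \<xi> t] by (simp add: algebra_simps)
  show "integrable lborel (fourier (\<lambda>y. \<phi> (y, t)))"
    by (rule Bochner_Integration.integrable_bound[OF i])
       (simp, intro AE_I2 order_trans[OF _ *], simp)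
  show "integrable lborel (\<lambda>\<xi>. complex_of_real (norm \<xi>) * fourier (\<lambda>y. \<phi> (y, t)) \<xi>)"
    by (rule Bochner_Integration.integrable_bound[OF i])
       (simp, intro AE_I2 order_trans[OF _ *], simp add: norm_mult)
qed

lemma fourier_inversion_slice:
  fixes \<phi> :: "'b::euclidean_space \<times> real \<Rightarrow> real"
  assumes \<phi>: "test_function \<phi>"
  shows "(\<integral>\<xi>. fourier (\<lambda>y. \<phi> (y, t)) \<xi> * cis (x \<bullet> \<xi>) \<partial>lborel) = complex_of_real ((2 * pi) ^ DIM('b) * \<phi> (x, t))"
proof -
  obtain B where "\<And>x t. \<bar>\<phi> (x, t)\<bar> \<le> B" using test_function_slab[OF \<phi>] by metis
  then show ?thesis
    by (intro fourier_inversion[where B = B] slice_continuous slice_integrable fourier_slice_integrable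
        test_function_smooth \<phi>)
qed

section \<open>The half Laplacian as a singular integral\<close>

lemma half_laplacian_fourier:
  fixes \<phi> :: "(real^'n) \<times> real \<Rightarrow> real"
  shows "half_laplacian \<phi> (x, t) =
    Re (\<integral>\<xi>. (complex_of_real (norm \<xi> / (2 * pi) ^ CARD('n)) * fourier (\<lambda>y. \<phi> (y, t)) \<xi>) * cis (x \<bullet> \<xi>) \<partial>lborel)"
proof -
  let ?c = "complex_of_real (1 / (2 * pi) ^ CARD('n))"
  have "(\<integral>\<xi>. (complex_of_real (norm \<xi> / (2 * pi) ^ CARD('n)) * fourier (\<lambda>y. \<phi> (y, t)) \<xi>) * cis (x \<bullet> \<xi>) \<partial>lborel)
    = ?c * (\<integral>\<xi>. complex_of_real (norm \<xi>) * space_fourier \<phi> \<xi> t * cis (x \<bullet> \<xi>) \<partial>lborel)"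
    by (subst integral_mult_right_zero[symmetric]) (simp add: space_fourier_def fourier_def mult_ac)
  then show ?thesis by (simp add: half_laplacian_def Re_divide_of_real)
qed

lemma poisson_average_slice:
  fixes \<phi> :: "'b::euclidean_space \<times> real \<Rightarrow> real"
  assumes \<phi>: "test_function \<phi>" and s: "s > 0"
  shows "complex_of_real (\<integral>y. poisson_kernel s y * \<phi> (x + y, t) \<partial>lborel)
    = complex_of_real (poisson_mass TYPE('b)) *
      (\<integral>\<xi>. complex_of_real (exp (- (s * norm \<xi>)) / (2 * pi) ^ DIM('b)) * fourier (\<lambda>y. \<phi> (y, t)) \<xi> * cis (x \<bullet> \<xi>) \<partial>lborel)"
proof -
  let ?c = "complex_of_real (1 / (2 * pi) ^ DIM('b))"
  let ?F = "\<lambda>\<xi>. ?c * fourier (\<lambda>y. \<phi> (y, t)) \<xi>"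
  have F: "integrable lborel ?F" using fourier_slice_integrable(1)[OF \<phi>] by (rule integrable_mult_right)
  have "(\<integral>\<xi>. ?F \<xi> * cis (z \<bullet> \<xi>) \<partial>lborel) = complex_of_real (\<phi> (z, t))" for z
  proof -
    have "(\<integral>\<xi>. ?F \<xi> * cis (z \<bullet> \<xi>) \<partial>lborel) = ?c * (\<integral>\<xi>. fourier (\<lambda>y. \<phi> (y, t)) \<xi> * cis (z \<bullet> \<xi>) \<partial>lborel)"
      by (subst integral_mult_right_zero[symmetric]) (simp add: mult.assoc)
    then show ?thesis by (simp only: fourier_inversion_slice[OF \<phi>]) simp
  qed
  then have "complex_of_real (\<integral>y. poisson_kernel s y * \<phi> (x + y, t) \<partial>lborel)
      = (\<integral>y. complex_of_real (poisson_kernel s y) * (\<integral>\<xi>. ?F \<xi> * cis ((x + y) \<bullet> \<xi>) \<partial>lborel) \<partial>lborel)"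
    by (simp only: integral_complex_of_real[symmetric] of_real_mult)
  also have "\<dots> = complex_of_real (poisson_mass TYPE('b)) * (\<integral>\<xi>. complex_of_real (exp (- (s * norm \<xi>))) * ?F \<xi> * cis (x \<bullet> \<xi>) \<partial>lborel)"
    by (rule poisson_average[OF F s])
  finally show ?thesis by (simp add: mult_ac)
qed

text \<open>The product of the three factors met in the bilinear term: min(|h|, 1) from the
  Lipschitz cutoff, sqrt |h| from the translation estimate, and the jump density |h|^(-N-1).\<close>

definition frac_weight :: "'b::euclidean_space \<Rightarrow> real" where
  "frac_weight h = min (norm h) 1 * sqrt (norm h) / norm h ^ Suc DIM('b)"

text \<open>Chosen so that integrating \<open>time_weight s * poisson_kernel s h\<close> over
  \<open>s\<close> comparable to |h| reproduces \<open>frac_weight h\<close> up to a constant. It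
  behaves like s^(-1/2) at 0 and like s^(-3/2) at infinity, hence is integrable.\<close>

definition time_weight :: "real \<Rightarrow> real" where
  "time_weight s = indicator {0<..} s * (min s 1 / (s * sqrt s))"

lemma integrable_inverse_sqrt: "integrable lborel (\<lambda>s. indicator {0<..<1} s * (1 / sqrt s))"
  and integrable_time_weight: "integrable lborel time_weight"
proof -
  have 1: "set_integrable lborel (einterval 0 1) (\<lambda>s. 1 / sqrt s)"
  proof (rule interval_integral_FTC_nonneg(1)[where F = "\<lambda>s. 2 * sqrt s" and A = 0 and B = 2])
    show "((\<lambda>s. 2 * sqrt s) has_real_derivative 1 / sqrt s) (at s)" if "0 < ereal s" "ereal s < 1" for s
      using that by (auto intro!: derivative_eq_intros simp: field_simps)
    show "(((\<lambda>s. 2 * sqrt s) \<circ> real_of_ereal) \<longlongrightarrow> 0) (at_right 0)"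
      unfolding zero_ereal_def ereal_tendsto_simps by real_asymp
    show "(((\<lambda>s. 2 * sqrt s) \<circ> real_of_ereal) \<longlongrightarrow> 2) (at_left 1)"
      unfolding one_ereal_def ereal_tendsto_simps by real_asymp
  qed (auto intro!: continuous_intros)
  then show i1: "integrable lborel (\<lambda>s. indicator {0<..<1} s * (1 / sqrt s))"
    by (simp add: set_integrable_def einterval_def greaterThanLessThan_def greaterThan_def lessThan_def
        Collect_conj_eq[symmetric] zero_ereal_def one_ereal_def)
  have 2: "set_integrable lborel (einterval 1 \<infinity>) (\<lambda>s. 1 / (s * sqrt s))"
  proof (rule interval_integral_FTC_nonneg(1)[where F = "\<lambda>s. - 2 / sqrt s" and A = "- 2" and B = 0])
    show "((\<lambda>s. - 2 / sqrt s) has_real_derivative 1 / (s * sqrt s)) (at s)" if "1 < ereal s" "ereal s < \<infinity>" for s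
      using that by (auto intro!: derivative_eq_intros simp: field_simps one_ereal_def)
    show "isCont (\<lambda>s. 1 / (s * sqrt s)) s" if "1 < ereal s" "ereal s < \<infinity>" for s
      using that by (auto intro!: continuous_intros simp: one_ereal_def)
    show "AE s in lborel. 1 < ereal s \<longrightarrow> ereal s < \<infinity> \<longrightarrow> 0 \<le> 1 / (s * sqrt s)"
      by (auto simp: one_ereal_def)
    show "(((\<lambda>s. - 2 / sqrt s) \<circ> real_of_ereal) \<longlongrightarrow> - 2) (at_right 1)"
      unfolding one_ereal_def ereal_tendsto_simps by real_asymp
    show "(((\<lambda>s. - 2 / sqrt s) \<circ> real_of_ereal) \<longlongrightarrow> 0) (at_left \<infinity>)"
      unfolding ereal_tendsto_simps by real_asymp
  qed simp
  then have i2: "integrable lborel (\<lambda>s. indicator {1<..} s * (1 / (s * sqrt s)))"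
    by (simp add: set_integrable_def einterval_def greaterThan_def one_ereal_def)
  show "integrable lborel time_weight"
  proof (rule integrable_cong_AE_imp[OF Bochner_Integration.integrable_add[OF i1 i2]])
    show "AE s in lborel. indicator {0<..<1} s * (1 / sqrt s) + indicator {1<..} s * (1 / (s * sqrt s)) = time_weight s"
      by (rule AE_mp[OF AE_lborel_singleton[of 1]]) (auto intro!: AE_I2 simp: time_weight_def indicator_def min_def)
    show "time_weight \<in> borel_measurable lborel" unfolding time_weight_def[abs_def] by measurable
  qed
qed

lemma frac_weight_measurable [measurable]: "frac_weight \<in> borel_measurable borel"
  unfolding frac_weight_def[abs_def] by measurable

lemma frac_weight_nonneg: "frac_weight h \<ge> 0"
  by (simp add: frac_weight_def)

lemma time_weight_measurable [measurable]: "time_weight \<in> borel_measurable borel"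
  unfolding time_weight_def[abs_def] by measurable

lemma time_weight_nonneg: "time_weight s \<ge> 0"
  by (auto simp: time_weight_def indicator_def)

text \<open>The weight is dominated by a superposition of Poisson kernels at scales comparable to \<open>|h|\<close>.\<close>

lemma integrable_frac_weight: "integrable lborel (frac_weight :: 'b::euclidean_space \<Rightarrow> real)"
proof -
  let ?N = "DIM('b)"
  \<comment> \<open>On [r/2, r] the Poisson kernel is at least (r/2) / (sqrt 2 r)^(N+1), and the
    interval has length r/2; the two halves give the 4.\<close>
  define c where "c = 1 / (4 * sqrt 2 ^ Suc ?N)"
  have c: "c > 0" by (simp add: c_def)
  define J where "J = (\<lambda>h::'b. \<integral>\<^sup>+s. ennreal (time_weight s * poisson_kernel s h) \<partial>lborel)"
  have tp [measurable]: "(\<lambda>p::real \<times> 'b. ennreal (time_weight (fst p) * poisson_kernel (fst p) (snd p))) \<in> borel_measurable borel"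
    unfolding borel_prod[symmetric] by measurable
  have lower: "ennreal (c * frac_weight h) \<le> J h" for h
  proof (cases "h = 0")
    case False
    define r where "r = norm h"
    have r: "r > 0" using False by (simp add: r_def)
    have pt: "(min r 1 / (r * sqrt r)) * ((r / 2) / (sqrt 2 * r) ^ Suc ?N) \<le> time_weight s * poisson_kernel s h"
      if s: "s \<in> {r / 2..r}" for s
    proof (rule mult_mono)
      have s0: "s > 0" "s \<le> r" using s r by auto
      have "min r 1 / r \<le> min s 1 / s"
        using s0 by (auto simp: min_def divide_simps)
      moreover have "1 / sqrt r \<le> 1 / sqrt s" using s0 by (intro divide_left_mono) auto
      ultimately have "min r 1 / r * (1 / sqrt r) \<le> min s 1 / s * (1 / sqrt s)"
        using s0 r by (intro mult_mono) auto
      then show "min r 1 / (r * sqrt r) \<le> time_weight s" using s0 by (simp add: time_weight_def)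
      have "sqrt (s\<^sup>2 + (norm h)\<^sup>2) \<le> sqrt 2 * r"
      proof (rule real_le_lsqrt)
        have "s\<^sup>2 \<le> r\<^sup>2" using s0 by (intro power_mono) auto
        then show "s\<^sup>2 + (norm h)\<^sup>2 \<le> (sqrt 2 * r)\<^sup>2" by (simp add: power_mult_distrib r_def)
      qed (use r in auto)
      moreover have "sqrt (s\<^sup>2 + (norm h)\<^sup>2) > 0" using s0 by (simp add: add_pos_nonneg)
      ultimately show "(r / 2) / (sqrt 2 * r) ^ Suc ?N \<le> poisson_kernel s h"
        unfolding poisson_kernel_def using s r by (intro frac_le power_mono zero_less_power) auto
      show "0 \<le> (r / 2) / (sqrt 2 * r) ^ Suc ?N" using r by simp
      show "0 \<le> time_weight s" by (rule time_weight_nonneg)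
    qed
    have "c * frac_weight h = (min r 1 / (r * sqrt r)) * ((r / 2) / (sqrt 2 * r) ^ Suc ?N) * (r / 2)"
    proof -
      have "sqrt r * sqrt r = r" using r by simp
      then have "sqrt r = r * r / (r * sqrt r)" using r by (simp add: field_simps)
      then have "frac_weight h = min r 1 * (r * r / (r * sqrt r)) / r ^ Suc ?N"
        by (simp add: frac_weight_def r_def[symmetric])
      then show ?thesis by (simp only: c_def power_mult_distrib) simp
    qed
    also have "ennreal \<dots> = (\<integral>\<^sup>+s. ennreal ((min r 1 / (r * sqrt r)) * ((r / 2) / (sqrt 2 * r) ^ Suc ?N)) * indicator {r / 2..r} s \<partial>lborel)"
      using r by (subst nn_integral_cmult_indicator) (auto simp: ennreal_mult[symmetric])
    also have "\<dots> \<le> J h" unfolding J_def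
      by (intro nn_integral_mono) (use pt in \<open>auto simp: indicator_def intro!: ennreal_leI\<close>)
    finally show ?thesis .
  qed (simp add: frac_weight_def)
  have slice: "(\<integral>\<^sup>+h. ennreal (time_weight s * poisson_kernel s (h::'b)) \<partial>lborel) = ennreal (time_weight s * poisson_mass TYPE('b))" for s
  proof (cases "s > 0")
    case True
    have "has_bochner_integral lborel (\<lambda>h::'b. time_weight s * poisson_kernel s h) (time_weight s * poisson_mass TYPE('b))"
      by (intro has_bochner_integral_mult_right poisson_integral True)
    then show ?thesis
      using True by (intro nn_integral_eq_integrable[THEN iffD2])
        (auto simp: has_bochner_integral_iff time_weight_nonneg poisson_kernel_nonneg poisson_mass_pos[THEN less_imp_le])
  qed (simp add: time_weight_def)
  have "(\<integral>\<^sup>+h. ennreal (c * frac_weight (h::'b)) \<partial>lborel) \<le> (\<integral>\<^sup>+h. J h \<partial>lborel)"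
    by (intro nn_integral_mono lower)
  also have "\<dots> = (\<integral>\<^sup>+s. \<integral>\<^sup>+h. ennreal (time_weight s * poisson_kernel s (h::'b)) \<partial>lborel \<partial>lborel)"
    using nn_integral_lborel_pair[OF tp] by (simp add: J_def)
  also have "\<dots> = (\<integral>\<^sup>+s. ennreal (time_weight s * poisson_mass TYPE('b)) \<partial>lborel)" by (simp only: slice)
  also have "\<dots> < \<infinity>"
    using integrable_mult_left[OF integrable_time_weight, of "poisson_mass TYPE('b)"]
    unfolding integrable_iff_bounded
    by (simp add: time_weight_nonneg poisson_mass_pos[THEN less_imp_le])
  finally have "integrable lborel (\<lambda>h::'b. c * frac_weight h)"
    unfolding integrable_iff_bounded using c by (simp add: frac_weight_nonneg)
  from integrable_mult_right[OF this, of "1 / c"] show ?thesis using c by simp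
qed

text \<open>The junk value \<open>1 / 0 = 0\<close> at \<open>h = 0\<close> is harmless: second differences vanish there.\<close>

definition riesz_kernel :: "'b::euclidean_space \<Rightarrow> real" where
  "riesz_kernel h = 1 / norm h ^ Suc DIM('b)"

lemma riesz_kernel_nonneg: "riesz_kernel h \<ge> 0"
  by (simp add: riesz_kernel_def)

lemma riesz_kernel_measurable [measurable]: "riesz_kernel \<in> borel_measurable borel"
  unfolding riesz_kernel_def[abs_def] by measurable

text \<open>For |h| \<le> 1 this is |h|^2 \<le> |h|^(3/2), otherwise 1 \<le> |h|^(1/2).
  Integrability of the one weight \<open>frac_weight\<close> thus also yields the Levy condition for
  the Riesz kernel.\<close>

lemma riesz_kernel_frac_weight: "riesz_kernel h * min ((norm h)\<^sup>2) 1 \<le> frac_weight h"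
proof -
  have "min ((norm h)\<^sup>2) 1 \<le> min (norm h) 1 * sqrt (norm h)"
  proof (cases "norm h \<le> 1")
    case True
    have "sqrt (norm h) \<ge> norm h"
      using True by (intro real_le_rsqrt) (auto simp: power2_eq_square mult_left_le_one_le)
    then have "norm h * norm h \<le> norm h * sqrt (norm h)" by (intro mult_left_mono) auto
    then show ?thesis using True by (simp add: power2_eq_square min_def)
  next
    case False
    then have "1 < (norm h)\<^sup>2" by (intro one_less_power) auto
    moreover have "1 \<le> sqrt (norm h)" using False by auto
    ultimately have "1 \<le> sqrt (norm h)" "\<not> (norm h)\<^sup>2 \<le> 1" by auto
    then show ?thesis using False by (simp add: min_def)
  qed
  then show ?thesis
    by (simp add: riesz_kernel_def frac_weight_def divide_right_mono)
qed

lemma levy_kernel_riesz: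
  assumes "c \<ge> 0" "k \<in> borel_measurable borel" "\<And>h. 0 \<le> k h" "\<And>h. k h \<le> c * riesz_kernel h"
  shows "levy_kernel (k :: 'b::euclidean_space \<Rightarrow> real)"
  unfolding levy_kernel_def
proof (intro conjI allI assms(2,3))
  show "integrable lborel (\<lambda>h. k h * min ((norm h)\<^sup>2) 1)"
  proof (rule Bochner_Integration.integrable_bound)
    show "integrable lborel (\<lambda>h::'b. c * frac_weight h)" by (intro integrable_mult_right integrable_frac_weight)
    have "k h * min ((norm h)\<^sup>2) 1 \<le> c * frac_weight h" for h
    proof -
      have "k h * min ((norm h)\<^sup>2) 1 \<le> (c * riesz_kernel h) * min ((norm h)\<^sup>2) 1"
        by (intro mult_right_mono assms) auto
      also have "\<dots> \<le> c * frac_weight h"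
        using mult_left_mono[OF riesz_kernel_frac_weight assms(1)] by (simp add: mult.assoc)
      finally show ?thesis .
    qed
    then show "AE h in lborel. norm (k h * min ((norm h)\<^sup>2) 1) \<le> norm (c * frac_weight h)"
      using assms by (intro AE_I2) (simp add: abs_mult frac_weight_nonneg)
  qed (use assms in measurable)
qed

text \<open>The quotient (\<kappa> \<phi> - P_s \<phi>) / s, with P_s the averaging by P(., s), is
  evaluated twice as s decreases to 0. In frequency its multiplier is \<kappa> (1 - exp(-s |\<xi>|))
  / s, which tends to \<kappa> |\<xi>|. In space P(y, s) / s tends to |y|^(-N-1), tested on second
  differences after a symmetrisation that gives the factor 1/2.\<close>

theorem half_laplacian_levy:
  fixes \<phi> :: "(real^'n) \<times> real \<Rightarrow> real"
  assumes \<phi>: "test_function \<phi>"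
  shows "half_laplacian \<phi> z = levy_op (\<lambda>h. riesz_kernel h / (2 * poisson_mass TYPE(real^'n))) \<phi> z"
proof -
  let ?\<kappa> = "poisson_mass TYPE(real^'n)"
  let ?N = "CARD('n)"
  obtain x t where z: "z = (x, t)" by (cases z)
  let ?F = "fourier (\<lambda>y. \<phi> (y, t))"
  define e where "e = (\<lambda>n::nat. inverse (real (Suc n)))"
  have e0: "e n > 0" for n by (simp add: e_def)
  have elim: "e \<longlonglongrightarrow> 0" unfolding e_def by (rule LIMSEQ_inverse_real_of_nat)
  define A where "A = (\<lambda>n. (?\<kappa> * \<phi> z - (\<integral>y. poisson_kernel (e n) y * \<phi> (x + y, t) \<partial>lborel)) / e n)"
  have \<kappa>: "?\<kappa> > 0" by (rule poisson_mass_pos)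
  have Fi: "integrable lborel ?F" "integrable lborel (\<lambda>\<xi>. complex_of_real (norm \<xi>) * ?F \<xi>)"
    by (rule fourier_slice_integrable[OF \<phi>])+
  have [measurable]: "?F \<in> borel_measurable borel" using Fi(1) by auto
  have sm: "smooth \<phi>" using \<phi> by (rule test_function_smooth)
  have [measurable]: "\<phi> \<in> borel_measurable borel" by (rule smooth_borel_measurable[OF sm])
  obtain B where B: "\<And>z. \<bar>\<phi> z\<bar> \<le> B" using test_function_bounded[OF \<phi>] by blast

  let ?q = "\<lambda>n \<xi>. complex_of_real ((1 - exp (- (e n * norm \<xi>))) / e n / (2 * pi) ^ ?N) * ?F \<xi> * cis (x \<bullet> \<xi>)"
  \<comment> \<open>From 1 - exp(-a) \<le> a; this makes |\<xi>| times the transform a majorant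
    uniform in \<open>n\<close>.\<close>
  have q_bound: "0 \<le> (1 - exp (- (e n * norm \<xi>))) / e n" "(1 - exp (- (e n * norm \<xi>))) / e n \<le> norm \<xi>" for n and \<xi> :: "real^'n"
    using e0[of n] exp_ge_add_one_self[of "- (e n * norm \<xi>)"] by (auto simp: divide_simps mult_ac)
  have A_fourier: "complex_of_real (A n) = complex_of_real ?\<kappa> * (\<integral>\<xi>. ?q n \<xi> \<partial>lborel)" for n
  proof -
    let ?u = "\<lambda>\<xi>. complex_of_real (1 / (2 * pi) ^ ?N) * (?F \<xi> * cis (x \<bullet> \<xi>))"
    let ?v = "\<lambda>\<xi>. complex_of_real (exp (- (e n * norm \<xi>)) / (2 * pi) ^ ?N) * ?F \<xi> * cis (x \<bullet> \<xi>)"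
    have u: "integrable lborel ?u" by (intro integrable_mult_right integrable_mult_cis Fi) simp
    have vu: "?v \<xi> = complex_of_real (exp (- (e n * norm \<xi>))) * ?u \<xi>" for \<xi> by simp
    have v: "integrable lborel ?v"
    proof (rule Bochner_Integration.integrable_bound[OF u])
      show "AE \<xi> in lborel. norm (?v \<xi>) \<le> norm (?u \<xi>)"
        unfolding vu norm_mult[of "complex_of_real (exp r)" for r] using e0[of n]
        by (intro AE_I2 mult_left_le_one_le) auto
    qed measurable
    have "complex_of_real (\<phi> z) = (\<integral>\<xi>. ?u \<xi> \<partial>lborel)"
      by (simp only: integral_mult_right_zero fourier_inversion_slice[OF \<phi>]) (simp add: z)
    moreover have "complex_of_real (\<integral>y. poisson_kernel (e n) y * \<phi> (x + y, t) \<partial>lborel) = complex_of_real ?\<kappa> * (\<integral>\<xi>. ?v \<xi> \<partial>lborel)"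
      by (subst poisson_average_slice[OF \<phi> e0]) simp
    ultimately have "complex_of_real (A n) = complex_of_real ?\<kappa> * (((\<integral>\<xi>. ?u \<xi> \<partial>lborel) - (\<integral>\<xi>. ?v \<xi> \<partial>lborel)) / complex_of_real (e n))"
      by (simp add: A_def right_diff_distrib)
    also have "(\<integral>\<xi>. ?u \<xi> \<partial>lborel) - (\<integral>\<xi>. ?v \<xi> \<partial>lborel) = (\<integral>\<xi>. ?u \<xi> - ?v \<xi> \<partial>lborel)"
      using u v by simp
    also have "\<dots> / complex_of_real (e n) = (\<integral>\<xi>. (?u \<xi> - ?v \<xi>) / complex_of_real (e n) \<partial>lborel)" by simp
    also have "\<dots> = (\<integral>\<xi>. ?q n \<xi> \<partial>lborel)"
      by (intro Bochner_Integration.integral_cong refl) (use e0[of n] in \<open>simp add: field_simps\<close>)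
    finally show ?thesis .
  qed
  have "(\<lambda>n. \<integral>\<xi>. ?q n \<xi> \<partial>lborel) \<longlonglongrightarrow> (\<integral>\<xi>. (complex_of_real (norm \<xi> / (2 * pi) ^ ?N) * ?F \<xi>) * cis (x \<bullet> \<xi>) \<partial>lborel)"
  proof (rule integral_dominated_convergence)
    have "integrable lborel (\<lambda>\<xi>. complex_of_real (1 / (2 * pi) ^ ?N) * (complex_of_real (norm \<xi>) * ?F \<xi>))"
      by (rule integrable_mult_right[OF Fi(2)])
    from integrable_norm[OF this]
    show "integrable lborel (\<lambda>\<xi>. norm (complex_of_real (norm \<xi> / (2 * pi) ^ ?N) * ?F \<xi>))"
      by (simp add: norm_mult norm_divide)
    have lim: "(\<lambda>n. (1 - exp (- (e n * r))) / e n) \<longlonglongrightarrow> r" for r :: real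
    proof -
      have "((\<lambda>s. (1 - exp (- (s * r))) / s) \<longlongrightarrow> r) (at_right 0)" by real_asymp
      moreover have "filterlim e (at_right 0) sequentially"
        using elim e0 less_imp_neq[OF e0] by (auto simp: filterlim_at intro!: always_eventually)
      ultimately show ?thesis by (rule filterlim_compose)
    qed
    show "AE \<xi> in lborel. (\<lambda>n. ?q n \<xi>) \<longlonglongrightarrow> (complex_of_real (norm \<xi> / (2 * pi) ^ ?N) * ?F \<xi>) * cis (x \<bullet> \<xi>)"
      by (intro AE_I2 tendsto_intros lim) auto
    have "norm (?q n \<xi>) \<le> norm (complex_of_real (norm \<xi> / (2 * pi) ^ ?N) * ?F \<xi>)" for n \<xi>
    proof -
      have "norm (?q n \<xi>) = (1 - exp (- (e n * norm \<xi>))) / e n / (2 * pi) ^ ?N * norm (?F \<xi>)"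
        using q_bound(1)[of n \<xi>] e0[of n]
        by (simp add: norm_mult zero_le_divide_iff abs_mult del: of_real_divide of_real_diff)
      also have "\<dots> \<le> norm \<xi> / (2 * pi) ^ ?N * norm (?F \<xi>)"
        using q_bound(2)[of n \<xi>] by (intro mult_right_mono divide_right_mono) auto
      finally show ?thesis by (simp add: norm_mult norm_divide norm_power)
    qed
    then show "AE \<xi> in lborel. norm (?q n \<xi>) \<le> norm (complex_of_real (norm \<xi> / (2 * pi) ^ ?N) * ?F \<xi>)" for n
      by simp
  qed measurable
  then have "(\<lambda>n. Re (complex_of_real ?\<kappa> * (\<integral>\<xi>. ?q n \<xi> \<partial>lborel))) \<longlonglongrightarrow>
      Re (complex_of_real ?\<kappa> * (\<integral>\<xi>. (complex_of_real (norm \<xi> / (2 * pi) ^ ?N) * ?F \<xi>) * cis (x \<bullet> \<xi>) \<partial>lborel))"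
    by (intro tendsto_intros)
  then have "(\<lambda>n. Re (complex_of_real (A n))) \<longlonglongrightarrow>
      Re (complex_of_real ?\<kappa> * (\<integral>\<xi>. (complex_of_real (norm \<xi> / (2 * pi) ^ ?N) * ?F \<xi>) * cis (x \<bullet> \<xi>) \<partial>lborel))"
    by (simp only: A_fourier)
  then have lim1: "A \<longlonglongrightarrow> ?\<kappa> * half_laplacian \<phi> z"
    by (simp add: z half_laplacian_fourier)

  let ?Q = "\<lambda>n y. 1 / sqrt ((e n)\<^sup>2 + (norm y)\<^sup>2) ^ Suc ?N :: real"
  have PQ: "poisson_kernel (e n) y = e n * ?Q n y" for n and y :: "real^'n"
    by (simp add: poisson_kernel_def)
  have A_diff: "A n = (1 / 2) * (\<integral>y. ?Q n y * sdiff (y, 0) \<phi> z \<partial>lborel)" for n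
  proof -
    let ?P = "poisson_kernel (e n) :: real^'n \<Rightarrow> real"
    have P: "integrable lborel ?P" "(\<integral>y. ?P y \<partial>lborel) = ?\<kappa>"
      using poisson_integral[where 'a = "real^'n", OF e0[of n]] by (auto simp: has_bochner_integral_iff)
    have i1: "integrable lborel (\<lambda>y. ?P y * \<phi> (x + y, t))" and i2: "integrable lborel (\<lambda>y. ?P y * \<phi> (x - y, t))"
      by (rule integrable_mult_bounded[OF P(1) _ B], measurable)+
    \<comment> \<open>Evenness of the Poisson kernel allows averaging the quotient with its
      reflection, so that second differences appear; first differences are in general not absolutely
      integrable against |y|^(-N-1).\<close>
    have "(\<integral>y. ?P y * \<phi> (x - y, t) \<partial>lborel) = (\<integral>y. ?P y * \<phi> (x + y, t) \<partial>lborel)"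
      using integral_lborel_translate(3)[of "\<lambda>y. ?P y * \<phi> (x + y, t)"] by (simp add: poisson_kernel_minus)
    then have "2 * (e n * A n) = (\<integral>y. 2 * (?P y * \<phi> z) - ?P y * \<phi> (x + y, t) - ?P y * \<phi> (x - y, t) \<partial>lborel)"
      using i1 i2 P e0[of n] by (simp add: A_def)
    also have "\<dots> = (\<integral>y. ?P y * sdiff (y, 0) \<phi> z \<partial>lborel)"
      by (intro Bochner_Integration.integral_cong refl) (simp add: sdiff_def z algebra_simps)
    also have "\<dots> = e n * (\<integral>y. ?Q n y * sdiff (y, 0) \<phi> z \<partial>lborel)"
      by (simp only: PQ mult.assoc integral_mult_right_zero)
    finally show ?thesis using e0[of n] by simp
  qed
  obtain C where C: "C \<ge> 0" "\<And>z h. \<bar>sdiff h \<phi> z\<bar> \<le> C * min ((norm h)\<^sup>2) 1"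
    using smooth_bounded_sdiff_bound(2)[OF test_function_smooth_bounded[OF \<phi>]] by metis
  have [measurable]: "(\<lambda>h. sdiff (h, 0) \<phi> z) \<in> borel_measurable borel" by (rule borel_measurable_sdiff(1)) measurable
  have "(\<lambda>n. \<integral>y. ?Q n y * sdiff (y, 0) \<phi> z \<partial>lborel) \<longlonglongrightarrow> (\<integral>y. riesz_kernel y * sdiff (y, 0) \<phi> z \<partial>lborel)"
  proof (rule integral_dominated_convergence)
    show "integrable lborel (\<lambda>y::real^'n. C * frac_weight y)" by (intro integrable_mult_right integrable_frac_weight)
    have "(\<lambda>n. ?Q n y * sdiff (y, 0) \<phi> z) \<longlonglongrightarrow> riesz_kernel y * sdiff (y, 0) \<phi> z" for y :: "real^'n"
    proof (cases "y = 0")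
      case True
      then have "sdiff (y, 0) \<phi> z = 0" by (simp add: sdiff_def z)
      then show ?thesis by simp
    next
      case False
      have "(\<lambda>n. ?Q n y) \<longlonglongrightarrow> 1 / sqrt (0\<^sup>2 + (norm y)\<^sup>2) ^ Suc ?N"
        using False by (intro tendsto_intros elim) auto
      then show ?thesis by (intro tendsto_mult tendsto_const) (simp add: riesz_kernel_def)
    qed
    then show "AE y in lborel. (\<lambda>n. ?Q n y * sdiff (y, 0) \<phi> z) \<longlonglongrightarrow> riesz_kernel y * sdiff (y, 0) \<phi> z" by simp
    have "\<bar>?Q n y * sdiff (y, 0) \<phi> z\<bar> \<le> C * frac_weight y" for n and y :: "real^'n"
    proof (cases "y = 0")
      case True
      then show ?thesis by (simp add: sdiff_def z frac_weight_def)
    next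
      case False
      have "norm y \<le> sqrt ((e n)\<^sup>2 + (norm y)\<^sup>2)" by (intro real_le_rsqrt) simp
      then have Q: "?Q n y \<le> riesz_kernel y" unfolding riesz_kernel_def
        using False by (simp only: DIM_cart DIM_real mult_1_right) (intro divide_left_mono power_mono mult_pos_pos zero_less_power, auto simp: add_nonneg_pos)
      have "0 \<le> ?Q n y" by simp
      then have "\<bar>?Q n y * sdiff (y, 0) \<phi> z\<bar> = ?Q n y * \<bar>sdiff (y, 0) \<phi> z\<bar>"
        by (simp only: abs_mult abs_of_nonneg)
      also have "\<dots> \<le> riesz_kernel y * (C * min ((norm y)\<^sup>2) 1)"
        using C(2)[of "(y, 0)" z] by (intro mult_mono Q riesz_kernel_nonneg) (simp_all add: norm_Pair)
      also have "\<dots> = C * (riesz_kernel y * min ((norm y)\<^sup>2) 1)" by (simp add: mult_ac)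
      also have "\<dots> \<le> C * frac_weight y" using C(1) by (intro mult_left_mono riesz_kernel_frac_weight)
      finally show ?thesis .
    qed
    then show "AE y in lborel. norm (?Q n y * sdiff (y, 0) \<phi> z) \<le> C * frac_weight y" for n by simp
  qed measurable
  then have "A \<longlonglongrightarrow> (1 / 2) * (\<integral>y. riesz_kernel y * sdiff (y, 0) \<phi> z \<partial>lborel)"
    unfolding A_diff by (intro tendsto_intros)
  from LIMSEQ_unique[OF lim1 this]
  have "half_laplacian \<phi> z = (1 / (2 * ?\<kappa>)) * (\<integral>y. riesz_kernel y * sdiff (y, 0) \<phi> z \<partial>lborel)"
    using \<kappa> by (simp add: field_simps)
  also have "\<dots> = (\<integral>y. (1 / (2 * ?\<kappa>)) * (riesz_kernel y * sdiff (y, 0) \<phi> z) \<partial>lborel)" by simp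
  finally show ?thesis by (simp add: levy_op_def)
qed

section \<open>Integrability of Levy operators on test functions\<close>

lemma sdiff_support_bound:
  assumes "\<bar>sdiff h \<phi> z\<bar> \<le> C * m"
  shows "\<bar>sdiff h \<phi> z\<bar> \<le> C * m * (indicator (fun_support \<phi>) z + indicator (fun_support \<phi>) (z + h) + indicator (fun_support \<phi>) (z - h))"
proof (cases "z \<in> fun_support \<phi> \<or> z + h \<in> fun_support \<phi> \<or> z - h \<in> fun_support \<phi>")
  case True
  have "C * m \<ge> 0" using assms by linarith
  then have "C * m * 1 \<le> C * m * (indicator (fun_support \<phi>) z + indicator (fun_support \<phi>) (z + h) + indicator (fun_support \<phi>) (z - h))"
    using True by (intro mult_left_mono) (auto simp: indicator_def)
  then show ?thesis using assms by linarith
next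
  case False
  then show ?thesis by (simp add: sdiff_def not_in_fun_support)
qed

text \<open>For fixed \<open>h\<close> the second difference lives on the support and its two
  translates by \<open>h\<close>, of total measure at most three times that of the support.
  Integrating over \<open>z\<close> first and over \<open>h\<close> afterwards therefore converges,
  even when \<open>levy_op k \<phi>\<close> has unbounded support.\<close>

lemma levy_op_L1:
  fixes \<phi> :: "'b::euclidean_space \<times> 'c::euclidean_space \<Rightarrow> real"
  assumes \<phi>: "test_function \<phi>" and k: "levy_kernel k"
    and C: "C \<ge> 0" "\<And>z h. \<bar>sdiff h \<phi> z\<bar> \<le> C * min ((norm h)\<^sup>2) 1"
  shows "integrable lborel (\<lambda>p. k (snd p) * sdiff (snd p, 0) \<phi> (fst p))"
    and "integrable lborel (levy_op k \<phi>)"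
    and "integrable lborel (\<lambda>z. \<integral>h. \<bar>k h * sdiff (h, 0) \<phi> z\<bar> \<partial>lborel)"
    and "(\<integral>z. \<bar>levy_op k \<phi> z\<bar> \<partial>lborel) \<le> 3 * C * measure lborel (fun_support \<phi>) * (\<integral>h. k h * min ((norm h)\<^sup>2) 1 \<partial>lborel)"
proof -
  let ?K = "fun_support \<phi>"
  have [measurable]: "k \<in> borel_measurable borel" and k0: "\<And>h. k h \<ge> 0"
    and ki: "integrable lborel (\<lambda>h. k h * min ((norm h)\<^sup>2) 1)"
    using k by (auto simp: levy_kernel_def)
  have [measurable]: "\<phi> \<in> borel_measurable borel" by (rule smooth_borel_measurable[OF test_function_smooth[OF \<phi>]])
  have [measurable]: "?K \<in> sets borel" using closed_fun_support by (rule borel_closed)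
  have fin: "emeasure lborel ?K < \<infinity>"
    using \<phi> by (intro emeasure_bounded_finite compact_imp_bounded) (auto simp: test_function_def)
  have iK: "has_bochner_integral lborel (indicator ?K :: _ \<Rightarrow> real) (measure lborel ?K)"
    using fin by (intro has_bochner_integral_real_indicator) auto
  have iK2: "has_bochner_integral lborel (\<lambda>z. indicator ?K (z + a) :: real) (measure lborel ?K)" for a
    using iK integral_lborel_translate(1)[of "indicator ?K :: _ \<Rightarrow> real" a] integrable_lborel_translate(1)[of "indicator ?K :: _ \<Rightarrow> real" a]
    by (simp add: has_bochner_integral_iff)
  have iK3: "has_bochner_integral lborel (\<lambda>z. indicator ?K (z - a) :: real) (measure lborel ?K)" for a
    using iK2[of "- a"] by simp
  let ?b = "\<lambda>h z. C * min ((norm h)\<^sup>2) 1 * (indicator ?K z + indicator ?K (z + (h, 0)) + indicator ?K (z - (h, 0)))"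
  have bi: "has_bochner_integral lborel (?b h) (C * min ((norm h)\<^sup>2) 1 * (measure lborel ?K + measure lborel ?K + measure lborel ?K))" for h
    by (intro has_bochner_integral_mult_right has_bochner_integral_add iK iK2 iK3)
  have b: "\<bar>sdiff (h, 0) \<phi> z\<bar> \<le> ?b h z" for h z
    using sdiff_support_bound[OF C(2)[of "(h, 0)" z]] by (simp add: norm_Pair)
  let ?H = "\<lambda>p. k (fst p) * sdiff (fst p, 0) \<phi> (snd p)"
  have Hm: "?H \<in> borel_measurable (lborel \<Otimes>\<^sub>M lborel)" unfolding sdiff_def by measurable
  have sl: "integrable lborel (\<lambda>z. ?H (h, z))" for h
  proof (rule Bochner_Integration.integrable_bound)
    show "integrable lborel (\<lambda>z. k h * ?b h z)"
      using bi by (intro integrable_mult_right) (auto simp: has_bochner_integral_iff)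
    show "AE z in lborel. norm (?H (h, z)) \<le> norm (k h * ?b h z)"
      using mult_left_mono[OF order_trans[OF b abs_ge_self] k0[of h]] k0[of h] by (intro AE_I2) (simp add: abs_mult)
    show "(\<lambda>z. ?H (h, z)) \<in> borel_measurable lborel" unfolding sdiff_def fst_conv snd_conv by measurable
  qed
  have sl_le: "(\<integral>z. norm (?H (h, z)) \<partial>lborel) \<le> 3 * C * measure lborel ?K * (k h * min ((norm h)\<^sup>2) 1)" for h
  proof -
    have "(\<integral>z. norm (?H (h, z)) \<partial>lborel) \<le> (\<integral>z. k h * ?b h z \<partial>lborel)"
    proof (rule Bochner_Integration.integral_mono[OF integrable_norm[OF sl]])
      show "integrable lborel (\<lambda>z. k h * ?b h z)"
        using bi by (intro integrable_mult_right) (auto simp: has_bochner_integral_iff)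
      show "norm (?H (h, z)) \<le> k h * ?b h z" for z
        using mult_left_mono[OF b k0[of h]] k0[of h] by (simp add: abs_mult)
    qed
    also have "\<dots> = 3 * C * measure lborel ?K * (k h * min ((norm h)\<^sup>2) 1)"
      using has_bochner_integral_mult_right[OF bi, of "k h" h] by (simp add: has_bochner_integral_iff)
    finally show ?thesis .
  qed
  have nm: "(\<lambda>h. \<integral>z. norm (?H (h, z)) \<partial>lborel) \<in> borel_measurable lborel"
    using Hm by measurable
  have slmi: "integrable lborel (\<lambda>h. \<integral>z. norm (?H (h, z)) \<partial>lborel)"
  proof (rule Bochner_Integration.integrable_bound)
    show "integrable lborel (\<lambda>h. 3 * C * measure lborel ?K * (k h * min ((norm h)\<^sup>2) 1))"
      using ki by (rule integrable_mult_right)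
    show "AE h in lborel. norm (\<integral>z. norm (?H (h, z)) \<partial>lborel) \<le> norm (3 * C * measure lborel ?K * (k h * min ((norm h)\<^sup>2) 1))"
      using order_trans[OF sl_le abs_ge_self] by (intro AE_I2) simp
  qed (rule nm)
  have Hi: "integrable (lborel \<Otimes>\<^sub>M lborel) ?H"
    by (rule lborel_pair.Fubini_integrable[OF Hm slmi]) (use sl in simp)
  have Hs: "integrable (lborel \<Otimes>\<^sub>M lborel) (\<lambda>p. k (snd p) * sdiff (snd p, 0) \<phi> (fst p))"
    using lborel_pair.integrable_product_swap[OF Hi] by (simp add: case_prod_beta')
  then show "integrable lborel (\<lambda>p. k (snd p) * sdiff (snd p, 0) \<phi> (fst p))"
    by (simp add: lborel_prod)
  show li: "integrable lborel (levy_op k \<phi>)"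
    using lborel_pair.integrable_fst'[OF Hs] by (simp add: levy_op_def[abs_def])
  show ai: "integrable lborel (\<lambda>z. \<integral>h. \<bar>k h * sdiff (h, 0) \<phi> z\<bar> \<partial>lborel)"
    using lborel_pair.integrable_fst'[OF integrable_norm[OF Hs]] by simp
  have "(\<integral>z. \<bar>levy_op k \<phi> z\<bar> \<partial>lborel) \<le> (\<integral>z. \<integral>h. \<bar>k h * sdiff (h, 0) \<phi> z\<bar> \<partial>lborel \<partial>lborel)"
  proof (rule Bochner_Integration.integral_mono[OF _ ai])
    show "integrable lborel (\<lambda>z. \<bar>levy_op k \<phi> z\<bar>)" using li by simp
    show "\<bar>levy_op k \<phi> z\<bar> \<le> (\<integral>h. \<bar>k h * sdiff (h, 0) \<phi> z\<bar> \<partial>lborel)" for z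
      unfolding levy_op_def using integral_norm_bound[of lborel "\<lambda>h. k h * sdiff (h, 0) \<phi> z"] by simp
  qed
  also have "\<dots> = (\<integral>h. \<integral>z. norm (?H (h, z)) \<partial>lborel \<partial>lborel)"
    using lborel_pair.Fubini_integral[of "\<lambda>h z. norm (?H (h, z))"] Hi by (simp add: case_prod_beta')
  also have "\<dots> \<le> (\<integral>h. 3 * C * measure lborel ?K * (k h * min ((norm h)\<^sup>2) 1) \<partial>lborel)"
    by (rule Bochner_Integration.integral_mono[OF slmi]) (use ki sl_le in auto)
  finally show "(\<integral>z. \<bar>levy_op k \<phi> z\<bar> \<partial>lborel) \<le> 3 * C * measure lborel ?K * (\<integral>h. k h * min ((norm h)\<^sup>2) 1 \<partial>lborel)"
    by simp
qed

section \<open>The fundamental solution\<close>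

lemma half_heat_kernel_poisson:
  "half_heat_kernel (y :: real^'n, s) = (if s > 0 then poisson_kernel s y else 0)"
proof -
  have "(s\<^sup>2 + (norm y)\<^sup>2) powr ((real CARD('n) + 1) / 2) = sqrt (s\<^sup>2 + (norm y)\<^sup>2) ^ Suc CARD('n)" if "s > 0"
  proof -
    have p: "s\<^sup>2 + (norm y)\<^sup>2 > 0" using that by (simp add: add_pos_nonneg)
    have "sqrt (s\<^sup>2 + (norm y)\<^sup>2) ^ Suc CARD('n) = (sqrt (s\<^sup>2 + (norm y)\<^sup>2)) powr (real (Suc CARD('n)))"
      using p by (simp only: powr_realpow real_sqrt_gt_0_iff)
    also have "\<dots> = (s\<^sup>2 + (norm y)\<^sup>2) powr ((real CARD('n) + 1) / 2)"
      using p by (simp add: powr_half_sqrt[symmetric] powr_powr add.commute)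
    finally show ?thesis by simp
  qed
  then show ?thesis by (simp add: half_heat_kernel_def poisson_kernel_def)
qed

lemma half_heat_kernel_eq: "half_heat_kernel p = (if snd p > 0 then poisson_kernel (snd p) (fst p) else 0)"
  using half_heat_kernel_poisson[of "fst p" "snd p"] by simp

lemma half_heat_kernel_nonneg: "half_heat_kernel p \<ge> 0"
  by (simp add: half_heat_kernel_eq poisson_kernel_nonneg)

lemma half_heat_kernel_measurable [measurable]:
  "half_heat_kernel \<in> borel_measurable (borel \<Otimes>\<^sub>M borel)"
  "half_heat_kernel \<in> borel_measurable borel"
proof -
  show m: "half_heat_kernel \<in> borel_measurable (borel \<Otimes>\<^sub>M borel)"
    unfolding half_heat_kernel_eq[abs_def] by measurable
  then show "half_heat_kernel \<in> borel_measurable borel" by (simp add: borel_prod)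
qed

text \<open>Every slice at a positive time has the same mass, so the kernel is not integrable over
  space-time; restricted to a bounded set of times it is, with mass at most \<kappa> times the
  length of that set.\<close>

definition heat_window :: "real set \<Rightarrow> (real^'n) \<times> real \<Rightarrow> real" where
  "heat_window A p = indicator A (snd p) * half_heat_kernel p"

lemma heat_window_integral:
  assumes [measurable]: "A \<in> sets borel" and bd: "bounded A"
  shows "integrable lborel (heat_window A :: (real^'n) \<times> real \<Rightarrow> real)"
    and "(\<integral>p. heat_window A (p :: (real^'n) \<times> real) \<partial>lborel) \<le> poisson_mass TYPE(real^'n) * measure lborel A"
proof -
  let ?\<kappa> = "poisson_mass TYPE(real^'n)"
  let ?w = "heat_window A :: (real^'n) \<times> real \<Rightarrow> real"
  have A: "emeasure lborel A < \<infinity>" by (rule emeasure_bounded_finite[OF bd])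
  have [measurable]: "?w \<in> borel_measurable borel"
    unfolding heat_window_def[abs_def] borel_prod[symmetric] by measurable
  have "(\<integral>\<^sup>+p. ennreal (?w p) \<partial>lborel) = (\<integral>\<^sup>+s. \<integral>\<^sup>+y. ennreal (?w (y, s)) \<partial>lborel \<partial>lborel)"
    by (rule nn_integral_lborel_pair(2)) measurable
  also have "\<dots> \<le> (\<integral>\<^sup>+s. ennreal ?\<kappa> * indicator A s \<partial>lborel)"
  proof (rule nn_integral_mono)
    fix s :: real
    show "(\<integral>\<^sup>+y. ennreal (?w (y, s)) \<partial>lborel) \<le> ennreal ?\<kappa> * indicator A s"
    proof (cases "s > 0 \<and> s \<in> A")
      case True
      have "(\<integral>\<^sup>+y. ennreal (poisson_kernel s (y :: real^'n)) \<partial>lborel) = ennreal ?\<kappa>"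
        using poisson_integral[where 'a = "real^'n", of s] True
        by (intro nn_integral_eq_integrable[THEN iffD2])
          (auto simp: has_bochner_integral_iff poisson_kernel_nonneg poisson_mass_pos[THEN less_imp_le])
      then show ?thesis using True by (simp add: heat_window_def half_heat_kernel_poisson)
    next
      case False
      then have "?w (y, s) = 0" for y by (auto simp: heat_window_def half_heat_kernel_poisson)
      then show ?thesis by simp
    qed
  qed
  also have "\<dots> = ennreal (?\<kappa> * measure lborel A)"
    using A poisson_mass_pos[where 'a = "real^'n"]
    by (simp add: nn_integral_cmult_indicator emeasure_eq_ennreal_measure ennreal_mult)
  finally have le: "(\<integral>\<^sup>+p. ennreal (?w p) \<partial>lborel) \<le> ennreal (?\<kappa> * measure lborel A)" .
  have w0: "?w p \<ge> 0" for p by (simp add: heat_window_def half_heat_kernel_nonneg)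
  show i: "integrable lborel ?w"
    unfolding integrable_iff_bounded using le w0 by (simp add: le_less_trans)
  have "ennreal (\<integral>p. ?w p \<partial>lborel) = (\<integral>\<^sup>+p. ennreal (?w p) \<partial>lborel)"
    using nn_integral_eq_integral[OF i] w0 by simp
  with le have "ennreal (\<integral>p. ?w p \<partial>lborel) \<le> ennreal (?\<kappa> * measure lborel A)" by simp
  moreover have "0 \<le> ?\<kappa> * measure lborel A" using poisson_mass_pos[where 'a = "real^'n"] by simp
  ultimately show "(\<integral>p. ?w p \<partial>lborel) \<le> ?\<kappa> * measure lborel A" by (simp only: ennreal_le_iff)
qed

text \<open>The adjoint potential: since P lives at positive times, the value at a point averages
  \<open>g\<close> over later times.\<close>

definition heat_adjoint :: "((real^'n) \<times> real \<Rightarrow> real) \<Rightarrow> (real^'n) \<times> real \<Rightarrow> real" where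
  "heat_adjoint = translate_avg half_heat_kernel"

text \<open>A class preserved by derivatives and by spatial Levy operators, and on which
  \<open>heat_adjoint\<close> converges because it sees only a bounded time window of the kernel.
  Compact support would be destroyed by the half Laplacian.\<close>

definition time_bounded :: "real \<Rightarrow> ((real^'n) \<times> real \<Rightarrow> real) \<Rightarrow> bool" where
  "time_bounded R g \<longleftrightarrow> smooth_bounded g \<and> fun_support g \<subseteq> {z. \<bar>snd z\<bar> \<le> R}"

lemma time_bounded_dirderiv: "time_bounded R g \<Longrightarrow> time_bounded R (dirderiv v g)"
  unfolding time_bounded_def
  using fun_support_dirderiv smooth_bounded_dirderiv smooth_bounded_smooth by blast

lemma time_bounded_iter_deriv: "time_bounded R g \<Longrightarrow> time_bounded R (iter_deriv vs g)"
  by (induction vs) (simp_all add: iter_deriv_Cons time_bounded_dirderiv del: iter_deriv.simps(2))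

lemma time_bounded_zero: "time_bounded R g \<Longrightarrow> \<bar>snd z\<bar> > R \<Longrightarrow> g z = 0"
  using not_in_fun_support[of z g] unfolding time_bounded_def by fastforce

text \<open>Replaces the kernel by an integrable one, so that the results on
  \<open>translate_avg\<close> apply.\<close>

lemma heat_adjoint_window:
  fixes g :: "(real^'n) \<times> real \<Rightarrow> real"
  assumes "time_bounded R g" "{- R - snd w..R - snd w} \<subseteq> A"
  shows "heat_adjoint g w = translate_avg (heat_window A) g w"
  unfolding heat_adjoint_def translate_avg_def
proof (rule Bochner_Integration.integral_cong[OF refl])
  fix y :: "(real^'n) \<times> real"
  show "half_heat_kernel y * g (y + w) = heat_window A y * g (y + w)"
  proof (cases "snd y \<in> A")
    case False
    then have "snd y \<notin> {- R - snd w..R - snd w}" using assms(2) by blast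
    then have "\<bar>snd (y + w)\<bar> > R" by auto
    then show ?thesis using time_bounded_zero[OF assms(1)] by simp
  qed (simp add: heat_window_def)
qed

lemma heat_adjoint_integrable:
  fixes g :: "(real^'n) \<times> real \<Rightarrow> real"
  assumes g: "time_bounded R g"
  shows "integrable lborel (\<lambda>y. half_heat_kernel y * g (y + w))"
proof -
  have "integrable lborel (\<lambda>y. heat_window {- R - snd w..R - snd w} y * g (y + w))"
    using g by (intro integrable_translate_avg heat_window_integral) (auto simp: time_bounded_def)
  moreover have "half_heat_kernel y * g (y + w) = heat_window {- R - snd w..R - snd w} y * g (y + w)" for y
  proof (cases "snd y \<in> {- R - snd w..R - snd w}")
    case False
    then have "\<bar>snd (y + w)\<bar> > R" by auto
    then show ?thesis using time_bounded_zero[OF g] by simp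
  qed (simp add: heat_window_def)
  ultimately show ?thesis by (simp only:)
qed

lemma heat_adjoint_has_derivative:
  fixes g :: "(real^'n) \<times> real \<Rightarrow> real"
  assumes g: "time_bounded R g"
  shows "(heat_adjoint g has_derivative (\<lambda>v. heat_adjoint (dirderiv v g) w)) (at w)"
proof -
  \<comment> \<open>The window moves with \<open>w\<close>; one unit of slack on each side makes a
    single window valid for all points at distance less than 1.\<close>
  let ?A = "{- R - snd w - 1..R - snd w + 1}"
  have sb: "smooth_bounded g" using g by (simp add: time_bounded_def)
  have i: "integrable lborel (heat_window ?A :: (real^'n) \<times> real \<Rightarrow> real)" by (rule heat_window_integral) auto
  have "(heat_adjoint g has_derivative (\<lambda>v. translate_avg (heat_window ?A) (dirderiv v g) w)) (at w)"
  proof (rule has_derivative_transform_within[OF translate_avg_has_derivative[OF i sb]])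
    show "(1::real) > 0" by simp
    fix w' :: "(real^'n) \<times> real" assume "dist w' w < 1"
    then have "\<bar>snd w' - snd w\<bar> < 1" using dist_snd_le[of w' w] by (simp add: dist_real_def)
    then have "{- R - snd w'..R - snd w'} \<subseteq> ?A" by auto
    then show "translate_avg (heat_window ?A) g w' = heat_adjoint g w'"
      by (rule heat_adjoint_window[OF g, symmetric])
  qed simp
  moreover have "translate_avg (heat_window ?A) (dirderiv v g) w = heat_adjoint (dirderiv v g) w" for v
    by (rule heat_adjoint_window[OF time_bounded_dirderiv[OF g], symmetric]) auto
  ultimately show ?thesis by simp
qed

lemma heat_adjoint_smooth:
  assumes "time_bounded R g"
  shows "smooth (heat_adjoint g)" "iter_deriv vs (heat_adjoint g) = heat_adjoint (iter_deriv vs g)"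
  using smooth_operator[of "time_bounded R" heat_adjoint, OF time_bounded_dirderiv
      heat_adjoint_has_derivative assms] by auto

lemma heat_adjoint_bound:
  fixes g :: "(real^'n) \<times> real \<Rightarrow> real"
  assumes g: "time_bounded R g" and B: "\<And>z. \<bar>g z\<bar> \<le> B" and R: "R \<ge> 0"
  shows "\<bar>heat_adjoint g w\<bar> \<le> poisson_mass TYPE(real^'n) * (2 * R) * B"
proof -
  let ?A = "{- R - snd w..R - snd w}"
  have i: "integrable lborel (heat_window ?A :: (real^'n) \<times> real \<Rightarrow> real)" by (rule heat_window_integral) auto
  have "\<bar>heat_adjoint g w\<bar> \<le> (\<integral>y. \<bar>heat_window ?A (y :: (real^'n) \<times> real)\<bar> \<partial>lborel) * B"
    by (subst heat_adjoint_window[OF g order_refl]) (rule translate_avg_bound[OF i B])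
  also have "\<dots> = (\<integral>y. heat_window ?A (y :: (real^'n) \<times> real) \<partial>lborel) * B"
    by (simp add: heat_window_def half_heat_kernel_nonneg)
  also have "\<dots> \<le> (poisson_mass TYPE(real^'n) * measure lborel ?A) * B"
  proof (rule mult_right_mono)
    show "B \<ge> 0" using order_trans[OF abs_ge_zero B] .
  qed (rule heat_window_integral, auto)
  finally show ?thesis using R by simp
qed

lemma heat_adjoint_smooth_bounded:
  assumes "time_bounded R g" "R \<ge> 0"
  shows "smooth_bounded (heat_adjoint g)"
  unfolding smooth_bounded_def
proof (intro conjI allI)
  show "smooth (heat_adjoint g)" by (rule heat_adjoint_smooth[OF assms(1)])
  fix vs
  obtain B where "\<And>z. \<bar>iter_deriv vs g z\<bar> \<le> B" using assms(1) unfolding time_bounded_def smooth_bounded_def by blast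
  then show "\<exists>B. \<forall>x. \<bar>iter_deriv vs (heat_adjoint g) x\<bar> \<le> B"
    unfolding heat_adjoint_smooth(2)[OF assms(1)]
    using heat_adjoint_bound[OF time_bounded_iter_deriv[OF assms(1)] _ assms(2)] by blast
qed

lemma test_function_time_bounded:
  fixes \<phi> :: "(real^'n) \<times> real \<Rightarrow> real"
  assumes "test_function \<phi>"
  shows "\<exists>R\<ge>0. time_bounded R \<phi>"
proof -
  obtain R where R: "R > 0" "\<And>x t. (x, t) \<in> fun_support \<phi> \<Longrightarrow> norm x \<le> R \<and> \<bar>t\<bar> \<le> R"
    using test_function_slab[OF assms] by metis
  have "time_bounded R \<phi>"
    unfolding time_bounded_def using R(2) test_function_smooth_bounded[OF assms] by auto
  then show ?thesis using R(1) by (intro exI[of _ R]) simp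
qed

lemma time_bounded_levy_op:
  fixes g :: "(real^'n) \<times> real \<Rightarrow> real"
  assumes k: "levy_kernel k" and g: "time_bounded R g"
  shows "time_bounded R (levy_op k g)"
  unfolding time_bounded_def
proof
  show "smooth_bounded (levy_op k g)" using g by (intro levy_op_smooth_bounded k) (simp add: time_bounded_def)
  have c: "closed {z :: (real^'n) \<times> real. \<bar>snd z\<bar> \<le> R}"
    by (intro closed_Collect_le continuous_intros)
  show "fun_support (levy_op k g) \<subseteq> {z. \<bar>snd z\<bar> \<le> R}"
  proof (rule fun_support_subset[OF c])
    fix z :: "(real^'n) \<times> real" assume nz: "levy_op k g z \<noteq> 0"
    show "z \<in> {z. \<bar>snd z\<bar> \<le> R}"
    proof (rule ccontr)
      assume "z \<notin> {z. \<bar>snd z\<bar> \<le> R}"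
      then have "sdiff (h, 0) g z = 0" for h
        using time_bounded_zero[OF g] by (simp add: sdiff_def)
      then show False using nz by (simp add: levy_op_def)
    qed
  qed
qed

section \<open>The time derivative and the heat equation in frequency\<close>

lemma time_deriv_eq:
  fixes \<phi> :: "(real^'n) \<times> real \<Rightarrow> real"
  assumes "smooth \<phi>"
  shows "time_deriv \<phi> = dirderiv (0, 1) \<phi>"
proof
  fix z :: "(real^'n) \<times> real"
  obtain x t where z: "z = (x, t)" by (cases z)
  have 1: "((\<lambda>s. (x, s)) has_derivative (\<lambda>h. (0, h))) (at t)"
    by (rule has_derivative_Pair[OF has_derivative_const has_derivative_ident])
  have "((\<lambda>s. \<phi> (x, s)) has_derivative (\<lambda>h. dirderiv (0, h) \<phi> (x, t))) (at t)"
    by (rule has_derivative_compose[OF 1 smooth_has_derivative[OF assms]])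
  moreover have "dirderiv (0, h) \<phi> (x, t) = dirderiv (0, 1) \<phi> (x, t) * h" for h
    using linear_scale[OF has_derivative_linear[OF smooth_has_derivative[OF assms]], of h "(0, 1)" "(x, t)"]
    by simp
  then have "(\<lambda>h. dirderiv (0, h) \<phi> (x, t)) = (*) (dirderiv (0, 1) \<phi> (x, t))" by (rule ext)
  ultimately have "((\<lambda>s. \<phi> (x, s)) has_real_derivative dirderiv (0, 1) \<phi> z) (at t)"
    by (simp only: has_field_derivative_def z)
  then show "time_deriv \<phi> z = dirderiv (0, 1) \<phi> z" by (simp add: time_deriv_def z DERIV_imp_deriv)
qed

lemma smooth_time_derivative:
  fixes \<phi> :: "'b::euclidean_space \<times> real \<Rightarrow> real"
  assumes "smooth \<phi>"
  shows "((\<lambda>s. \<phi> (y, t + s)) has_real_derivative dirderiv (0, 1) \<phi> (y, t + s)) (at s)"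
proof -
  have 1: "((\<lambda>s. (y, t + s)) has_derivative (\<lambda>h. (0, h))) (at s)"
    using has_derivative_Pair[OF has_derivative_const has_derivative_add[OF has_derivative_const has_derivative_ident]]
    by simp
  have "((\<lambda>s. \<phi> (y, t + s)) has_derivative (\<lambda>h. dirderiv (0, h) \<phi> (y, t + s))) (at s)"
    by (rule has_derivative_compose[OF 1 smooth_has_derivative[OF assms]])
  moreover have "dirderiv (0, h) \<phi> (y, t + s) = dirderiv (0, 1) \<phi> (y, t + s) * h" for h
    using linear_scale[OF has_derivative_linear[OF smooth_has_derivative[OF assms]], of h "(0, 1)" "(y, t + s)"]
    by simp
  then have "(\<lambda>h. dirderiv (0, h) \<phi> (y, t + s)) = (*) (dirderiv (0, 1) \<phi> (y, t + s))" by (rule ext)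
  ultimately show ?thesis by (simp only: has_field_derivative_def)
qed

text \<open>For each frequency the equation is an ordinary differential equation in time, solved by
  the integrating factor \<open>exp (- s |\<xi>|)\<close>.\<close>

lemma fourier_heat_ode:
  fixes \<psi> :: "'b::euclidean_space \<times> real \<Rightarrow> real"
  assumes \<psi>: "test_function \<psi>"
  shows "(\<integral>s. indicator {0<..} s *\<^sub>R (complex_of_real (exp (- (s * r))) *
      (complex_of_real r * fourier (\<lambda>y. \<psi> (y, t + s)) \<xi> - fourier (\<lambda>y. dirderiv (0, 1) \<psi> (y, t + s)) \<xi>)) \<partial>lborel)
    = fourier (\<lambda>y. \<psi> (y, t)) \<xi>"
proof -
  let ?d = "dirderiv (0, 1) \<psi>"
  have d: "test_function ?d" by (rule test_function_dirderiv[OF \<psi>])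
  have sm: "smooth \<psi>" "smooth ?d" using \<psi> d by (auto intro: test_function_smooth)
  obtain B0 R where B0: "\<And>x t. \<bar>\<psi> (x, t)\<bar> \<le> B0" and R: "R > 0" "\<And>x t. (x, t) \<in> fun_support \<psi> \<Longrightarrow> norm x \<le> R \<and> \<bar>t\<bar> \<le> R"
    using test_function_slab[OF \<psi>] by metis
  obtain B1 where B1: "\<And>z. \<bar>?d z\<bar> \<le> B1" using test_function_bounded[OF d] by blast
  \<comment> \<open>Chosen with t + S > R, so that \<psi> has died out at time t + S and the upper
    boundary term vanishes.\<close>
  define S where "S = \<bar>t\<bar> + R + 1"
  have S: "S \<ge> 0" using R by (simp add: S_def)
  have nz: "norm y \<le> R \<and> \<bar>t + s\<bar> \<le> R" if "\<psi> (y, t + s) \<noteq> 0 \<or> ?d (y, t + s) \<noteq> 0" for y s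
    using that R(2) not_in_fun_support[of "(y, t + s)" \<psi>] not_in_fun_support[of "(y, t + s)" ?d]
      fun_support_dirderiv[OF sm(1), of "(0, 1)"] by blast
  let ?f = "\<lambda>y s. exp (- (s * r)) * (r * \<psi> (y, t + s) - ?d (y, t + s))"
  let ?G = "\<lambda>p. complex_of_real (indicator {0..S} (snd p) * ?f (fst p) (snd p)) * cis (- (fst p \<bullet> \<xi>))"
  have cont: "continuous_on UNIV (\<lambda>p. ?f (fst p) (snd p))"
    by (intro continuous_intros continuous_on_compose2[OF smooth_continuous_on[OF sm(1), of UNIV]]
        continuous_on_compose2[OF smooth_continuous_on[OF sm(2), of UNIV]]) auto
  have fm: "(\<lambda>p. ?f (fst p) (snd p)) \<in> borel_measurable borel" by (rule borel_measurable_continuous_onI[OF cont])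
  have Gi: "integrable lborel ?G"
  proof (rule integrable_mult_cis, rule integrable_of_real)
    show "integrable lborel (\<lambda>p. indicator {0..S} (snd p) * ?f (fst p) (snd p))"
    proof (rule integrable_cball_bounded(1))
      have "(\<lambda>p::'b \<times> real. indicator {0..S} (snd p) :: real) \<in> borel_measurable borel"
        unfolding borel_prod[symmetric] by measurable
      then show "(\<lambda>p. indicator {0..S} (snd p) * ?f (fst p) (snd p)) \<in> borel_measurable borel"
        using fm by (rule borel_measurable_times)
      fix p :: "'b \<times> real"
      have "\<bar>r * \<psi> (fst p, t + snd p) - ?d (fst p, t + snd p)\<bar> \<le> \<bar>r\<bar> * B0 + B1"
        using B0[of "fst p" "t + snd p"] B1[of "(fst p, t + snd p)"] mult_left_mono[of "\<bar>\<psi> (fst p, t + snd p)\<bar>" B0 "\<bar>r\<bar>"]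
        by (intro order_trans[OF abs_triangle_ineq4]) (auto simp: abs_mult)
      moreover have "exp (- (snd p * r)) \<le> exp (S * \<bar>r\<bar>)" if "snd p \<in> {0..S}"
      proof -
        have "- (snd p * r) \<le> snd p * \<bar>r\<bar>" using that by (metis abs_ge_minus_self abs_mult abs_of_nonneg atLeastAtMost_iff)
        also have "\<dots> \<le> S * \<bar>r\<bar>" using that by (intro mult_right_mono) auto
        finally show ?thesis by simp
      qed
      ultimately show "norm (indicator {0..S} (snd p) * ?f (fst p) (snd p)) \<le> exp (S * \<bar>r\<bar>) * (\<bar>r\<bar> * B0 + B1)"
        using order_trans[OF abs_ge_zero B0] order_trans[OF abs_ge_zero B1]
        by (cases "snd p \<in> {0..S}") (auto simp: abs_mult intro!: mult_mono)
      assume *: "indicator {0..S} (snd p) * ?f (fst p) (snd p) \<noteq> 0"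
      then have "\<psi> (fst p, t + snd p) \<noteq> 0 \<or> ?d (fst p, t + snd p) \<noteq> 0" by auto
      then have "norm (fst p) \<le> R" using nz by blast
      moreover have "\<bar>snd p\<bar> \<le> S" using * by (auto simp: indicator_def split: if_splits)
      ultimately show "norm p \<le> R + S" using norm_Pair_le[of "fst p" "snd p"] by simp
    qed
    have "(\<lambda>p::'b \<times> real. - (fst p \<bullet> \<xi>)) \<in> borel_measurable borel"
      by (intro borel_measurable_continuous_onI continuous_intros)
    then show "(\<lambda>p::'b \<times> real. - (fst p \<bullet> \<xi>)) \<in> borel_measurable lborel" by simp
  qed
  have FTC: "(\<integral>s. ?G (y, s) \<partial>lborel) = complex_of_real (\<psi> (y, t)) * cis (- (y \<bullet> \<xi>))" for y
  proof -
    have "(\<integral>s. indicator {0..S} s *\<^sub>R ?f y s \<partial>lborel) = - (exp (- (S * r)) * \<psi> (y, t + S)) - (- (exp (- (0 * r)) * \<psi> (y, t + 0)))"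
    proof (rule integral_FTC_Icc[OF S])
      fix s
      have e: "((\<lambda>s. exp (- (s * r))) has_real_derivative - r * exp (- (s * r))) (at s)"
        by (auto intro!: derivative_eq_intros)
      have "((\<lambda>s. - (exp (- (s * r)) * \<psi> (y, t + s))) has_real_derivative ?f y s) (at s)"
        using DERIV_minus[OF DERIV_mult[OF e smooth_time_derivative[OF sm(1), of y t s]]]
        by (simp add: algebra_simps)
      then have "((\<lambda>s. - (exp (- (s * r)) * \<psi> (y, t + s))) has_real_derivative ?f y s) (at s within {0..S})"
        by (rule has_field_derivative_at_within)
      then show "((\<lambda>s. - (exp (- (s * r)) * \<psi> (y, t + s))) has_vector_derivative ?f y s) (at s within {0..S})"
        by (simp add: has_real_derivative_iff_has_vector_derivative)
    next
      show "continuous_on {0..S} (?f y)"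
        by (rule continuous_on_compose2[OF cont, of _ "\<lambda>s. (y, s)", simplified]) (intro continuous_intros)
    qed
    moreover have "\<psi> (y, t + S) = 0"
    proof (rule ccontr)
      assume "\<psi> (y, t + S) \<noteq> 0"
      then have "\<bar>t + S\<bar> \<le> R" using nz by blast
      then show False by (simp add: S_def)
    qed
    ultimately have "(\<integral>s. indicator {0..S} s * ?f y s \<partial>lborel) = \<psi> (y, t)" by simp
    then show ?thesis by (simp only: fst_conv snd_conv integral_mult_left_zero integral_complex_of_real)
  qed
  have slice: "(\<integral>y. ?G (y, s) \<partial>lborel) = indicator {0..S} s *\<^sub>R (complex_of_real (exp (- (s * r))) *
      (complex_of_real r * fourier (\<lambda>y. \<psi> (y, t + s)) \<xi> - fourier (\<lambda>y. ?d (y, t + s)) \<xi>))" for s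
  proof -
    have i: "integrable lborel (\<lambda>y. complex_of_real (\<psi> (y, t + s)) * cis (- (y \<bullet> \<xi>)))" "integrable lborel (\<lambda>y. complex_of_real (?d (y, t + s)) * cis (- (y \<bullet> \<xi>)))"
      by (intro integrable_mult_cis integrable_of_real slice_integrable \<psi> d; simp)+
    have "(\<integral>y. ?G (y, s) \<partial>lborel) = (\<integral>y. (complex_of_real (indicator {0..S} s * exp (- (s * r)))) *
       (complex_of_real r * (complex_of_real (\<psi> (y, t + s)) * cis (- (y \<bullet> \<xi>))) - complex_of_real (?d (y, t + s)) * cis (- (y \<bullet> \<xi>))) \<partial>lborel)"
      by (intro Bochner_Integration.integral_cong refl) (simp add: algebra_simps)
    also have "\<dots> = (complex_of_real (indicator {0..S} s * exp (- (s * r)))) * (complex_of_real r * fourier (\<lambda>y. \<psi> (y, t + s)) \<xi> - fourier (\<lambda>y. ?d (y, t + s)) \<xi>)"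
      using i by (simp add: fourier_def)
    finally show ?thesis by (simp add: scaleR_conv_of_real mult.assoc)
  qed
  \<comment> \<open>The open half line and [0, S] differ only by the point 0 and by times at which
    \<psi> and its time derivative already vanish.\<close>
  have ind: "AE s in lborel. indicator {0<..} s *\<^sub>R (complex_of_real (exp (- (s * r))) *
      (complex_of_real r * fourier (\<lambda>y. \<psi> (y, t + s)) \<xi> - fourier (\<lambda>y. ?d (y, t + s)) \<xi>)) = (\<integral>y. ?G (y, s) \<partial>lborel)"
  proof (rule AE_mp[OF AE_lborel_singleton[of 0]], intro AE_I2 impI)
    fix s :: real assume "s \<noteq> 0"
    show "indicator {0<..} s *\<^sub>R (complex_of_real (exp (- (s * r))) *
      (complex_of_real r * fourier (\<lambda>y. \<psi> (y, t + s)) \<xi> - fourier (\<lambda>y. ?d (y, t + s)) \<xi>)) = (\<integral>y. ?G (y, s) \<partial>lborel)"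
    proof (cases "s > S")
      case True
      have "\<psi> (y, t + s) = 0 \<and> ?d (y, t + s) = 0" for y
      proof (rule ccontr)
        assume "\<not> (\<psi> (y, t + s) = 0 \<and> ?d (y, t + s) = 0)"
        then have "\<bar>t + s\<bar> \<le> R" using nz by blast
        then show False using True by (simp add: S_def)
      qed
      then show ?thesis by (simp add: fourier_def)
    next
      case False
      then show ?thesis unfolding slice using \<open>s \<noteq> 0\<close> by (simp add: indicator_def)
    qed
  qed
  have fm2: "(\<lambda>s. fourier (\<lambda>y. g (y, t + s)) \<xi>) \<in> borel_measurable borel" if "smooth g" for g :: "'b \<times> real \<Rightarrow> real"
  proof -
    have [measurable]: "g \<in> borel_measurable borel" by (rule smooth_borel_measurable[OF that])
    show ?thesis unfolding fourier_def by measurable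
  qed
  have [measurable]: "(\<lambda>s. fourier (\<lambda>y. \<psi> (y, t + s)) \<xi>) \<in> borel_measurable borel" "(\<lambda>s. fourier (\<lambda>y. ?d (y, t + s)) \<xi>) \<in> borel_measurable borel"
    using fm2 sm by auto
  have gm: "(\<lambda>s. \<integral>y. ?G (y, s) \<partial>lborel) \<in> borel_measurable lborel"
    unfolding slice by measurable
  have "(\<integral>s. indicator {0<..} s *\<^sub>R (complex_of_real (exp (- (s * r))) *
      (complex_of_real r * fourier (\<lambda>y. \<psi> (y, t + s)) \<xi> - fourier (\<lambda>y. ?d (y, t + s)) \<xi>)) \<partial>lborel)
    = (\<integral>s. \<integral>y. ?G (y, s) \<partial>lborel \<partial>lborel)"
    by (rule integral_cong_AE[OF _ gm ind]) measurable
  also have "\<dots> = (\<integral>y. \<integral>s. ?G (y, s) \<partial>lborel \<partial>lborel)"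
    using integral_lborel_pair[OF Gi] by simp
  also have "\<dots> = fourier (\<lambda>y. \<psi> (y, t)) \<xi>" by (simp only: FTC fourier_def)
  finally show ?thesis .
qed

text \<open>Slice by time: averaging with P(., s) multiplies the space transform by \<kappa> exp(-s
  |\<xi>|), so frequency \<xi> contributes -d/ds of exp(-s |\<xi>|) times the transform of \<psi> at
  time t + s. Integrating over s > 0 leaves the transform at time t, and Fourier inversion returns
  \<psi>.\<close>

theorem heat_adjoint_fundamental:
  fixes \<psi> :: "(real^'n) \<times> real \<Rightarrow> real"
  assumes \<psi>: "test_function \<psi>"
  shows "heat_adjoint (\<lambda>z. half_laplacian \<psi> z - time_deriv \<psi> z) w = poisson_mass TYPE(real^'n) * \<psi> w"
proof -
  let ?\<kappa> = "poisson_mass TYPE(real^'n)" and ?N = "CARD('n)"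
  let ?k = "\<lambda>h. riesz_kernel h / (2 * ?\<kappa>) :: real"
  let ?d = "dirderiv (0, 1) \<psi>"
  obtain x t where w: "w = (x, t)" by (cases w)
  have sm: "smooth \<psi>" using \<psi> by (rule test_function_smooth)
  have d: "test_function ?d" by (rule test_function_dirderiv[OF \<psi>])
  have \<kappa>: "?\<kappa> > 0" by (rule poisson_mass_pos)
  have k: "levy_kernel ?k"
    by (rule levy_kernel_riesz[where c = "1 / (2 * ?\<kappa>)"]) (use \<kappa> in \<open>auto simp: riesz_kernel_nonneg\<close>)
  obtain R where R: "R \<ge> 0" "time_bounded R \<psi>" using test_function_time_bounded[OF \<psi>] by blast
  let ?g = "\<lambda>z. half_laplacian \<psi> z - ?d z"
  have ge: "(\<lambda>z. half_laplacian \<psi> z - time_deriv \<psi> z) = ?g" by (simp add: time_deriv_eq[OF sm])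
  have hl: "half_laplacian \<psi> = levy_op ?k \<psi>" using half_laplacian_levy[OF \<psi>] by blast
  have tb: "time_bounded R (half_laplacian \<psi>)" unfolding hl by (rule time_bounded_levy_op[OF k R(2)])
  have tbd: "time_bounded R ?d" by (rule time_bounded_dirderiv[OF R(2)])
  have [measurable]: "half_laplacian \<psi> \<in> borel_measurable borel" "?d \<in> borel_measurable borel"
    using tb tbd by (auto simp: time_bounded_def intro!: smooth_borel_measurable smooth_bounded_smooth)
  define F where "F = (\<lambda>s \<xi>. complex_of_real (1 / (2 * pi) ^ ?N) *
     (complex_of_real (norm \<xi>) * fourier (\<lambda>y. \<psi> (y, t + s)) \<xi> - fourier (\<lambda>y. ?d (y, t + s)) \<xi>))"
  have inner: "(\<integral>y. poisson_kernel s y * ?g (x + y, t + s) \<partial>lborel)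
      = ?\<kappa> * (Re (\<integral>\<xi>. complex_of_real (exp (- (s * norm \<xi>))) * F s \<xi> * cis (x \<bullet> \<xi>) \<partial>lborel))" if s: "s > 0" for s
  proof -
    let ?h = "\<lambda>\<xi>. complex_of_real (norm \<xi> / (2 * pi) ^ ?N) * fourier (\<lambda>y. \<psi> (y, t + s)) \<xi>"
    let ?e = "\<lambda>\<xi>. complex_of_real (1 / (2 * pi) ^ ?N) * fourier (\<lambda>y. ?d (y, t + s)) \<xi>"
    have hi: "integrable lborel ?h"
      using integrable_mult_right[OF fourier_slice_integrable(2)[OF \<psi>, of "t + s"], of "complex_of_real (1 / (2 * pi) ^ ?N)"]
      by (simp add: mult_ac)
    have ei: "integrable lborel ?e" by (rule integrable_mult_right[OF fourier_slice_integrable(1)[OF d]])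
    have P: "integrable lborel (\<lambda>y::real^'n. poisson_kernel s y)" by (rule poisson_fourier(1)[OF s])
    let ?H = "\<lambda>y. \<integral>\<xi>. (?h \<xi> - ?e \<xi>) * cis (y \<bullet> \<xi>) \<partial>lborel"
    have hc: "integrable lborel (\<lambda>\<xi>. ?h \<xi> * cis (y \<bullet> \<xi>))" "integrable lborel (\<lambda>\<xi>. ?e \<xi> * cis (y \<bullet> \<xi>))" for y
      by (intro integrable_mult_cis hi ei; simp)+
    have H: "Re (?H y) = ?g (y, t + s)" for y
    proof -
      have "?H y = (\<integral>\<xi>. ?h \<xi> * cis (y \<bullet> \<xi>) \<partial>lborel) - (\<integral>\<xi>. ?e \<xi> * cis (y \<bullet> \<xi>) \<partial>lborel)"
        using hc[of y] by (simp add: left_diff_distrib)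
      also have "(\<integral>\<xi>. ?e \<xi> * cis (y \<bullet> \<xi>) \<partial>lborel) = complex_of_real (?d (y, t + s))"
        by (simp only: mult.assoc integral_mult_right_zero fourier_inversion_slice[OF d]) simp
      finally show ?thesis by (simp add: half_laplacian_fourier)
    qed
    have pa: "(\<integral>y. complex_of_real (poisson_kernel s y) * ?H (x + y) \<partial>lborel)
      = complex_of_real ?\<kappa> * (\<integral>\<xi>. complex_of_real (exp (- (s * norm \<xi>))) * (?h \<xi> - ?e \<xi>) * cis (x \<bullet> \<xi>) \<partial>lborel)"
      by (rule poisson_average[OF Bochner_Integration.integrable_diff[OF hi ei] s])
    have [measurable]: "?h \<in> borel_measurable borel" "?e \<in> borel_measurable borel" using hi ei by auto
    have Hb: "norm (?H y) \<le> (\<integral>\<xi>. norm (?h \<xi> - ?e \<xi>) \<partial>lborel)" for y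
      using integral_norm_bound[of lborel "\<lambda>\<xi>. (?h \<xi> - ?e \<xi>) * cis (y \<bullet> \<xi>)"] by (simp add: norm_mult)
    have Pi: "integrable lborel (\<lambda>y. complex_of_real (poisson_kernel s y) * ?H (x + y))"
    proof (rule Bochner_Integration.integrable_bound)
      show "integrable lborel (\<lambda>y::real^'n. (\<integral>\<xi>. norm (?h \<xi> - ?e \<xi>) \<partial>lborel) * poisson_kernel s y)"
        by (rule integrable_mult_right[OF P])
      show "AE y in lborel. norm (complex_of_real (poisson_kernel s y) * ?H (x + y)) \<le> norm ((\<integral>\<xi>. norm (?h \<xi> - ?e \<xi>) \<partial>lborel) * poisson_kernel s y)"
        using mult_right_mono[OF Hb] s by (intro AE_I2) (simp add: norm_mult poisson_kernel_nonneg mult.commute)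
    qed measurable
    have "(\<integral>y. poisson_kernel s y * ?g (x + y, t + s) \<partial>lborel) = (\<integral>y. Re (complex_of_real (poisson_kernel s y) * ?H (x + y)) \<partial>lborel)"
      by (simp only: H[symmetric] Re_complex_of_real times_complex.sel Im_complex_of_real mult_zero_left diff_zero)
    also have "\<dots> = Re (\<integral>y. complex_of_real (poisson_kernel s y) * ?H (x + y) \<partial>lborel)"
      by (rule integral_Re[OF Pi])
    also have "\<dots> = ?\<kappa> * Re (\<integral>\<xi>. complex_of_real (exp (- (s * norm \<xi>))) * (?h \<xi> - ?e \<xi>) * cis (x \<bullet> \<xi>) \<partial>lborel)"
      unfolding pa by simp
    moreover have "?h \<xi> - ?e \<xi> = F s \<xi>" for \<xi> by (simp add: F_def field_simps)
    ultimately show ?thesis by (simp only:)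
  qed
  define M where "M = (\<lambda>p. indicator {0<..} (fst p) *\<^sub>R (complex_of_real (exp (- (fst p * norm (snd p)))) * F (fst p) (snd p) * cis (x \<bullet> snd p)))"
  have [measurable]: "\<psi> \<in> borel_measurable borel" by (rule smooth_borel_measurable[OF sm])
  have Mi: "integrable lborel M"
  proof -
    obtain C where C: "C \<ge> 0" "\<And>t \<xi>. (1 + norm \<xi>) * norm (fourier (\<lambda>y. \<psi> (y, t)) \<xi>) \<le> C * poisson_kernel 1 \<xi>"
      using fourier_decay[OF \<psi>] by metis
    obtain C' where C': "C' \<ge> 0" "\<And>t \<xi>. (1 + norm \<xi>) * norm (fourier (\<lambda>y. ?d (y, t)) \<xi>) \<le> C' * poisson_kernel 1 \<xi>"
      using fourier_decay[OF d] by metis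
    define S where "S = \<bar>t\<bar> + R"
    let ?K = "(C + C') / (2 * pi) ^ ?N"
    \<comment> \<open>Majorant for Fubini: in time the integrand vanishes beyond S, in frequency the
      decay of the transforms beats the multiplier.\<close>
    let ?b = "\<lambda>p::real \<times> (real^'n). indicator {0..S} (fst p) * (?K * poisson_kernel 1 (snd p))"
    have P1: "integrable lborel (\<lambda>y::real^'n. poisson_kernel 1 y)" by (rule poisson_fourier(1)) simp
    have "integrable (lborel \<Otimes>\<^sub>M lborel) ?b"
    proof (rule lborel_pair.Fubini_integrable)
      have "(\<integral>\<xi>. norm (?b (s, \<xi>)) \<partial>lborel) = indicator {0..S} s * (\<integral>\<xi>. norm (?K * poisson_kernel 1 (\<xi>::real^'n)) \<partial>lborel)" for s
        by (simp add: abs_mult)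
      moreover have "integrable lborel (\<lambda>s. indicator {0..S} s * c)" for c :: real
        by (intro integrable_mult_left integrable_real_indicator emeasure_bounded_finite) auto
      ultimately show "integrable lborel (\<lambda>s. \<integral>\<xi>. norm (?b (s, \<xi>)) \<partial>lborel)"
        by (simp only:)
      show "AE s in lborel. integrable lborel (\<lambda>\<xi>. ?b (s, \<xi>))" using P1 by simp
    qed measurable
    then have bi: "integrable lborel ?b" by (simp add: lborel_prod)
    have Fb: "norm (F s \<xi>) \<le> ?K * poisson_kernel 1 \<xi>" for s \<xi>
    proof -
      let ?a = "norm (fourier (\<lambda>y. \<psi> (y, t + s)) \<xi>)" and ?a' = "norm (fourier (\<lambda>y. ?d (y, t + s)) \<xi>)"
      have "norm (complex_of_real (norm \<xi>) * fourier (\<lambda>y. \<psi> (y, t + s)) \<xi> - fourier (\<lambda>y. ?d (y, t + s)) \<xi>)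
          \<le> norm \<xi> * ?a + ?a'"
        by (rule order_trans[OF norm_triangle_ineq4]) (simp add: norm_mult)
      also have "\<dots> \<le> (1 + norm \<xi>) * ?a + (1 + norm \<xi>) * ?a'" by (simp add: algebra_simps)
      also have "\<dots> \<le> (C + C') * poisson_kernel 1 \<xi>"
        using C(2)[of \<xi> "t + s"] C'(2)[of \<xi> "t + s"] by (simp add: algebra_simps)
      finally have "norm (complex_of_real (norm \<xi>) * fourier (\<lambda>y. \<psi> (y, t + s)) \<xi> - fourier (\<lambda>y. ?d (y, t + s)) \<xi>) / (2 * pi) ^ ?N
        \<le> (C + C') * poisson_kernel 1 \<xi> / (2 * pi) ^ ?N" by (rule divide_right_mono) simp
      then show ?thesis by (simp add: F_def norm_mult norm_divide norm_power)
    qed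
    have F0: "F s \<xi> = 0" if "s > S" for s \<xi>
    proof -
      have "\<psi> (y, t + s) = 0 \<and> ?d (y, t + s) = 0" for y
        using that time_bounded_zero[OF R(2), of "(y, t + s)"] time_bounded_zero[OF tbd, of "(y, t + s)"]
        by (auto simp: S_def)
      then show ?thesis by (simp add: F_def fourier_def)
    qed
    have Fm: "(\<lambda>p. F (fst p) (snd p)) \<in> borel_measurable (borel \<Otimes>\<^sub>M borel)"
      unfolding F_def fourier_def by measurable
    have "M \<in> borel_measurable (borel \<Otimes>\<^sub>M borel)"
      unfolding M_def using Fm by measurable
    then have Mm: "M \<in> borel_measurable lborel" by (simp add: borel_prod)
    show ?thesis
    proof (rule Bochner_Integration.integrable_bound[OF bi Mm], rule AE_I2)
      fix p :: "real \<times> (real^'n)"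
      have pos: "0 \<le> ?K * poisson_kernel 1 (snd p)" using C C' by (simp add: poisson_kernel_nonneg)
      have "norm (M p) \<le> ?b p"
      proof (cases "fst p > 0 \<and> fst p \<le> S")
        case True
        have "norm (M p) = exp (- (fst p * norm (snd p))) * norm (F (fst p) (snd p))"
          using True by (simp add: M_def norm_mult)
        also have "\<dots> \<le> 1 * norm (F (fst p) (snd p))"
          using True by (intro mult_right_mono) auto
        also have "\<dots> \<le> ?b p" using Fb[of "fst p" "snd p"] True by simp
        finally show ?thesis .
      next
        case False
        then have "M p = 0" using F0[of "fst p" "snd p"] by (auto simp: M_def)
        then show ?thesis using pos by (simp add: indicator_def)
      qed
      then show "norm (M p) \<le> norm (?b p)" by (simp only: real_norm_def order_trans[OF _ abs_ge_self])
    qed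
  qed
  have iH: "integrable lborel (\<lambda>p. half_heat_kernel p * ?g (p + w))"
    using Bochner_Integration.integrable_diff[OF heat_adjoint_integrable[OF tb, of w] heat_adjoint_integrable[OF tbd, of w]]
    by (simp add: right_diff_distrib)
  have "heat_adjoint ?g w = (\<integral>s. \<integral>y. half_heat_kernel (y, s) * ?g ((y, s) + w) \<partial>lborel \<partial>lborel)"
    unfolding heat_adjoint_def translate_avg_def by (rule integral_lborel_pair(2)[OF iH])
  also have "\<dots> = (\<integral>s. ?\<kappa> * Re (\<integral>\<xi>. M (s, \<xi>) \<partial>lborel) \<partial>lborel)"
  proof (rule Bochner_Integration.integral_cong[OF refl])
    fix s :: real
    show "(\<integral>y. half_heat_kernel (y, s) * ?g ((y, s) + w) \<partial>lborel) = ?\<kappa> * Re (\<integral>\<xi>. M (s, \<xi>) \<partial>lborel)"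
    proof (cases "s > 0")
      case True
      have "(\<integral>y. half_heat_kernel (y, s) * ?g ((y, s) + w) \<partial>lborel) = (\<integral>y. poisson_kernel s y * ?g (x + y, t + s) \<partial>lborel)"
        using True by (simp add: half_heat_kernel_poisson w add.commute)
      then show ?thesis using True by (simp only: inner[OF True]) (simp add: M_def)
    qed (simp add: half_heat_kernel_poisson M_def)
  qed
  also have "\<dots> = ?\<kappa> * Re (\<integral>s. \<integral>\<xi>. M (s, \<xi>) \<partial>lborel \<partial>lborel)"
  proof -
    have "integrable lborel (\<lambda>s. \<integral>\<xi>. M (s, \<xi>) \<partial>lborel)"
      using lborel_pair.integrable_fst'[of M] Mi by (simp add: lborel_prod)
    from integral_Re[OF this] show ?thesis by simp
  qed
  also have "(\<integral>s. \<integral>\<xi>. M (s, \<xi>) \<partial>lborel \<partial>lborel) = (\<integral>\<xi>. \<integral>s. M (s, \<xi>) \<partial>lborel \<partial>lborel)"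
    using integral_lborel_pair[OF Mi] by simp
  also have "\<dots> = (\<integral>\<xi>. complex_of_real (1 / (2 * pi) ^ ?N) * (fourier (\<lambda>y. \<psi> (y, t)) \<xi> * cis (x \<bullet> \<xi>)) \<partial>lborel)"
  proof (rule Bochner_Integration.integral_cong[OF refl])
    fix \<xi> :: "real^'n"
    let ?c = "complex_of_real (1 / (2 * pi) ^ ?N)"
    have "M (s, \<xi>) = (?c * cis (x \<bullet> \<xi>)) * (indicator {0<..} s *\<^sub>R (complex_of_real (exp (- (s * norm \<xi>))) *
      (complex_of_real (norm \<xi>) * fourier (\<lambda>y. \<psi> (y, t + s)) \<xi> - fourier (\<lambda>y. ?d (y, t + s)) \<xi>)))" for s
      by (simp add: M_def F_def scaleR_conv_of_real mult_ac)
    then have "(\<integral>s. M (s, \<xi>) \<partial>lborel) = (?c * cis (x \<bullet> \<xi>)) * fourier (\<lambda>y. \<psi> (y, t)) \<xi>"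
      by (simp only: integral_mult_right_zero fourier_heat_ode[OF \<psi>])
    then show "(\<integral>s. M (s, \<xi>) \<partial>lborel) = ?c * (fourier (\<lambda>y. \<psi> (y, t)) \<xi> * cis (x \<bullet> \<xi>))" by (simp add: mult_ac)
  qed
  also have "\<dots> = complex_of_real (\<psi> w)"
    by (simp only: integral_mult_right_zero fourier_inversion_slice[OF \<psi>]) (simp add: w)
  finally show ?thesis by (simp add: ge)
qed

section \<open>Distributions with bounded potential\<close>

text \<open>Half of the jump density of the half Laplacian, since the symmetric second difference
  counts each jump twice.\<close>

definition half_levy :: "real^'n \<Rightarrow> real" where
  "half_levy h = riesz_kernel h / (2 * poisson_mass TYPE(real^'n))"

lemma half_levy_nonneg: "half_levy (h :: real^'n) \<ge> 0"
  using poisson_mass_pos[where 'a = "real^'n"] by (simp add: half_levy_def riesz_kernel_nonneg)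

lemma half_levy_measurable [measurable]: "half_levy \<in> borel_measurable borel"
  unfolding half_levy_def[abs_def] by measurable

lemma levy_kernel_indicator:
  assumes [measurable]: "A \<in> sets borel"
  shows "levy_kernel (\<lambda>h. indicator A h * half_levy (h :: real^'n))"
  by (rule levy_kernel_riesz[where c = "1 / (2 * poisson_mass TYPE(real^'n))"])
     (use poisson_mass_pos[where 'a = "real^'n"] half_levy_nonneg in
       \<open>auto simp: half_levy_def riesz_kernel_nonneg indicator_def intro!: divide_right_mono\<close>)

lemma levy_kernel_half_levy: "levy_kernel (half_levy :: real^'n \<Rightarrow> real)"
  using levy_kernel_indicator[of UNIV] by simp

lemma half_laplacian_levy_op:
  fixes \<phi> :: "(real^'n) \<times> real \<Rightarrow> real"
  shows "test_function \<phi> \<Longrightarrow> half_laplacian \<phi> = levy_op half_levy \<phi>"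
  using half_laplacian_levy[of \<phi>] by (auto simp: half_levy_def[abs_def])

lemma half_laplacian_integrable:
  fixes \<phi> :: "(real^'n) \<times> real \<Rightarrow> real"
  assumes \<phi>: "test_function \<phi>"
  shows "integrable lborel (half_laplacian \<phi>)"
proof -
  obtain C where "C \<ge> 0" "\<And>z h. \<bar>sdiff h \<phi> z\<bar> \<le> C * min ((norm h)\<^sup>2) 1"
    using smooth_bounded_sdiff_bound(2)[OF test_function_smooth_bounded[OF \<phi>]] by metis
  then show ?thesis unfolding half_laplacian_levy_op[OF \<phi>]
    by (intro levy_op_L1(2)[OF \<phi> levy_kernel_half_levy])
qed

lemma test_function_integrable:
  fixes \<phi> :: "'a::euclidean_space \<Rightarrow> real"
  assumes \<phi>: "test_function \<phi>"
  shows "integrable lborel \<phi>"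
proof -
  obtain B where B: "\<And>z. \<bar>\<phi> z\<bar> \<le> B" using test_function_bounded[OF \<phi>] by blast
  have "bounded (fun_support \<phi>)" using \<phi> compact_imp_bounded by (auto simp: test_function_def)
  then obtain R where R: "\<And>z. z \<in> fun_support \<phi> \<Longrightarrow> norm z \<le> R" unfolding bounded_iff by blast
  show ?thesis
  proof (rule integrable_cball_bounded(1))
    show "\<phi> \<in> borel_measurable borel" by (intro smooth_borel_measurable test_function_smooth \<phi>)
    show "norm (\<phi> x) \<le> B" for x using B by simp
    show "norm x \<le> R" if "\<phi> x \<noteq> 0" for x using R that not_in_fun_support[of x \<phi>] by blast
  qed
qed

text \<open>The notions are stated with Lebesgue measurable functions and essential bounds, whereas
  Fubini is applied over \<open>lborel\<close> with pointwise bounds. Setting a Borel version to 0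
  where it exceeds \<open>c\<close> changes it only on a null set.\<close>

lemma Linfty_representative:
  fixes f :: "'a::euclidean_space \<Rightarrow> real"
  assumes f: "f \<in> borel_measurable lebesgue" and c: "Linfty_norm f \<le> ereal c" "c \<ge> 0"
  shows "\<exists>f'\<in>borel_measurable borel. (\<forall>z. \<bar>f' z\<bar> \<le> c) \<and> (AE z in lebesgue. f z = f' z)"
proof -
  obtain g where g: "g \<in> borel_measurable lborel" "AE z in lborel. f z = g z"
    using completion_ex_borel_measurable_real[OF f] by auto
  have "AE z in lebesgue. f z = g z" using g(2) by (rule AE_completion)
  moreover have "AE z in lebesgue. ereal \<bar>f z\<bar> \<le> Linfty_norm f"
    unfolding Linfty_norm_def by (rule esssup_AE)
  then have "AE z in lebesgue. \<bar>f z\<bar> \<le> c"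
    by (rule AE_mp) (intro AE_I2 impI, use c(1) order_trans in \<open>fastforce simp flip: ereal_less_eq(3)\<close>)
  ultimately have "AE z in lebesgue. f z = (if \<bar>g z\<bar> \<le> c then g z else 0)" by eventually_elim auto
  moreover have "(\<lambda>z. if \<bar>g z\<bar> \<le> c then g z else 0) \<in> borel_measurable borel"
    using g(1) by measurable
  ultimately show ?thesis using c(2) by (intro bexI[of _ "\<lambda>z. if \<bar>g z\<bar> \<le> c then g z else 0"]) auto
qed

lemma lebesgue_integral_representative:
  fixes f f' q :: "'a::euclidean_space \<Rightarrow> real"
  assumes f: "f \<in> borel_measurable lebesgue" and f': "f' \<in> borel_measurable borel" "AE z in lebesgue. f z = f' z"
    and q: "q \<in> borel_measurable borel"
  shows "(LINT z|lebesgue. f z * q z) = (\<integral>z. f' z * q z \<partial>lborel)"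
proof -
  have m: "(\<lambda>z. f' z * q z) \<in> borel_measurable lborel" using f' q by simp
  have "(LINT z|lebesgue. f z * q z) = (LINT z|lebesgue. f' z * q z)"
  proof (rule integral_cong_AE)
    have "q \<in> borel_measurable lebesgue" using q by (intro measurable_completion) simp
    then show "(\<lambda>z. f z * q z) \<in> borel_measurable lebesgue" using f by simp
    show "(\<lambda>z. f' z * q z) \<in> borel_measurable lebesgue" using m by (intro measurable_completion) simp
    show "AE z in lebesgue. f z * q z = f' z * q z" using f'(2) by eventually_elim simp
  qed
  also have "\<dots> = (\<integral>z. f' z * q z \<partial>lborel)" by (rule integral_completion[OF m])
  finally show ?thesis .
qed

definition heat_dual :: "((real^'n) \<times> real \<Rightarrow> real) \<Rightarrow> (real^'n) \<times> real \<Rightarrow> real" where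
  "heat_dual \<phi> z = half_laplacian \<phi> z - time_deriv \<phi> z"

lemma heat_dual_eq:
  assumes "test_function \<phi>"
  shows "heat_dual \<phi> = (\<lambda>z. half_laplacian \<phi> z - dirderiv (0, 1) \<phi> z)"
  using assms by (simp add: heat_dual_def[abs_def] time_deriv_eq test_function_smooth)

lemma heat_dual_integrable:
  assumes "test_function \<phi>"
  shows "integrable lborel (heat_dual \<phi>)"
  unfolding heat_dual_eq[OF assms]
  by (intro Bochner_Integration.integrable_diff half_laplacian_integrable test_function_integrable
      test_function_dirderiv assms)

lemma Theta_half_representative:
  fixes f :: "(real^'n) \<times> real \<Rightarrow> real"
  assumes "f \<in> borel_measurable lebesgue" "f' \<in> borel_measurable borel" "AE z in lebesgue. f z = f' z"
    and \<phi>: "test_function \<phi>"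
  shows "Theta_half f \<phi> = (\<integral>z. f' z * heat_dual \<phi> z \<partial>lborel)"
  unfolding Theta_half_def heat_dual_def[symmetric]
  by (rule lebesgue_integral_representative[OF assms(1-3)])
     (use borel_measurable_integrable[OF heat_dual_integrable[OF \<phi>]] in simp)

lemma kernel_conv_eq:
  fixes \<phi> :: "(real^'n) \<times> real \<Rightarrow> real"
  assumes \<phi>: "test_function \<phi>"
  shows "kernel_conv \<nu> \<phi> = dist_pairing \<nu> (heat_adjoint \<phi>)"
proof -
  have [measurable]: "\<phi> \<in> borel_measurable borel" by (intro smooth_borel_measurable test_function_smooth \<phi>)
  have "(LINT z|lebesgue. half_heat_kernel (z - w) * \<phi> z) = heat_adjoint \<phi> w" for w
  proof -
    have "(LINT z|lebesgue. half_heat_kernel (z - w) * \<phi> z) = (\<integral>z. half_heat_kernel (z - w) * \<phi> z \<partial>lborel)"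
      by (rule integral_completion) measurable
    also have "\<dots> = (\<integral>z. half_heat_kernel ((z + w) - w) * \<phi> (z + w) \<partial>lborel)"
      by (rule integral_lborel_translate(1)[symmetric]) measurable
    finally show ?thesis by (simp add: heat_adjoint_def translate_avg_def)
  qed
  then show ?thesis by (simp add: kernel_conv_def)
qed

lemma heat_adjoint_diff:
  assumes "time_bounded R g" "time_bounded R' h"
  shows "heat_adjoint (\<lambda>z. g z - h z) w = heat_adjoint g w - heat_adjoint h w"
  using Bochner_Integration.integral_diff[OF heat_adjoint_integrable[OF assms(1), of w] heat_adjoint_integrable[OF assms(2), of w]]
  by (simp add: heat_adjoint_def translate_avg_def right_diff_distrib)

text \<open>Cutting the jumps at size \<open>n\<close> keeps the image of a test function compactly
  supported, so it may be inserted into an identity that is known for test functions only; the tail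
  is treated as an error.\<close>

definition levy_trunc :: "nat \<Rightarrow> real^'n \<Rightarrow> real" where
  "levy_trunc n h = indicator (cball 0 (real n)) h * half_levy h"

definition levy_tail :: "nat \<Rightarrow> real^'n \<Rightarrow> real" where
  "levy_tail n h = indicator (- cball 0 (real n)) h * half_levy h"

lemma levy_kernel_trunc: "levy_kernel (levy_trunc n)" and levy_kernel_tail: "levy_kernel (levy_tail n)"
  unfolding levy_trunc_def[abs_def] levy_tail_def[abs_def] by (auto intro!: levy_kernel_indicator)

lemma levy_tail_integrable:
  assumes "n \<ge> 1"
  shows "integrable lborel (levy_tail n :: real^'n \<Rightarrow> real)"
proof -
  have e: "levy_tail n h * min ((norm h)\<^sup>2) 1 = levy_tail n h" for h :: "real^'n"
  proof (cases "norm h \<le> real n")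
    case False
    then have "1 < norm h" using assms by linarith
    then have "1 < (norm h)\<^sup>2" by (intro one_less_power) auto
    then show ?thesis by simp
  qed (simp add: levy_tail_def)
  have "levy_kernel (levy_tail n :: real^'n \<Rightarrow> real)" by (rule levy_kernel_tail)
  then show ?thesis unfolding levy_kernel_def by (simp only: e)
qed

lemma levy_tail_tendsto: "(\<lambda>n. \<integral>h. levy_tail n (h :: real^'n) \<partial>lborel) \<longlonglongrightarrow> 0"
proof -
  \<comment> \<open>The factor min(|h|^2, 1) equals 1 on the tail once n \<ge> 1. Inserted for all n
    it supplies an integrable majorant, since \<open>half_levy\<close> alone is not integrable at
    the origin.\<close>
  have "(\<lambda>n. \<integral>h. levy_tail n (h :: real^'n) * min ((norm h)\<^sup>2) 1 \<partial>lborel) \<longlonglongrightarrow> (\<integral>h. 0 \<partial>(lborel :: (real^'n) measure))"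
  proof (rule integral_dominated_convergence)
    show "integrable lborel (\<lambda>h :: real^'n. half_levy h * min ((norm h)\<^sup>2) 1)"
      by (rule levy_kernel_half_levy[unfolded levy_kernel_def, THEN conjunct2, THEN conjunct2])
    show "AE h in lborel. (\<lambda>n. levy_tail n (h :: real^'n) * min ((norm h)\<^sup>2) 1) \<longlonglongrightarrow> 0"
    proof (rule AE_I2)
      fix h :: "real^'n"
      obtain m where m: "norm h \<le> real m" using real_arch_simple by blast
      have "eventually (\<lambda>n. levy_tail n h * min ((norm h)\<^sup>2) 1 = 0) sequentially"
        by (rule eventually_sequentiallyI[of m]) (use m in \<open>auto simp: levy_tail_def indicator_def\<close>)
      then show "(\<lambda>n. levy_tail n h * min ((norm h)\<^sup>2) 1) \<longlonglongrightarrow> 0" by (rule tendsto_eventually)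
    qed
    show "AE h in lborel. norm (levy_tail n h * min ((norm h)\<^sup>2) 1) \<le> half_levy (h :: real^'n) * min ((norm h)\<^sup>2) 1" for n
      by (intro AE_I2) (auto simp: levy_tail_def half_levy_nonneg indicator_def abs_mult)
    fix n
    have "levy_kernel (levy_tail n :: real^'n \<Rightarrow> real)" by (rule levy_kernel_tail)
    then have [measurable]: "(levy_tail n :: real^'n \<Rightarrow> real) \<in> borel_measurable borel" by (simp add: levy_kernel_def)
    show "(\<lambda>h :: real^'n. levy_tail n h * min ((norm h)\<^sup>2) 1) \<in> borel_measurable lborel" by measurable
  qed simp
  then have "(\<lambda>n. \<integral>h. levy_tail n (h :: real^'n) * min ((norm h)\<^sup>2) 1 \<partial>lborel) \<longlonglongrightarrow> 0" by simp
  then show ?thesis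
  proof (rule Lim_transform_eventually, intro eventually_sequentiallyI[of 1] Bochner_Integration.integral_cong refl)
    fix n :: nat and h :: "real^'n" assume n: "1 \<le> n"
    show "levy_tail n h * min ((norm h)\<^sup>2) 1 = levy_tail n h"
    proof (cases "norm h \<le> real n")
      case False
      then have "1 < norm h" using n by linarith
      then have "1 < (norm h)\<^sup>2" by (intro one_less_power) auto
      then show ?thesis by simp
    qed (simp add: levy_tail_def)
  qed
qed

lemma levy_op_split:
  fixes g :: "(real^'n) \<times> real \<Rightarrow> real"
  assumes "smooth_bounded g"
  shows "levy_op (levy_trunc n) g z = levy_op half_levy g z - levy_op (levy_tail n) g z"
proof -
  have "levy_op half_levy g z = (\<integral>h. levy_trunc n h * sdiff (h, 0) g z + levy_tail n h * sdiff (h, 0) g z \<partial>lborel)"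
    unfolding levy_op_def by (intro Bochner_Integration.integral_cong refl) (auto simp: levy_trunc_def levy_tail_def indicator_def)
  also have "\<dots> = levy_op (levy_trunc n) g z + levy_op (levy_tail n) g z"
    unfolding levy_op_def
    by (rule Bochner_Integration.integral_add[OF levy_op_integrable[OF levy_kernel_trunc assms] levy_op_integrable[OF levy_kernel_tail assms]])
  finally show ?thesis by simp
qed

lemma levy_op_tail_bound:
  fixes g :: "(real^'n) \<times> real \<Rightarrow> real"
  assumes g: "smooth_bounded g" and B: "\<And>z. \<bar>g z\<bar> \<le> B" and n: "n \<ge> 1"
  shows "\<bar>levy_op (levy_tail n) g z\<bar> \<le> 4 * B * (\<integral>h. levy_tail n (h :: real^'n) \<partial>lborel)"
proof -
  have t0: "levy_tail n h \<ge> 0" for h :: "real^'n" by (simp add: levy_tail_def half_levy_nonneg)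
  have "norm (levy_op (levy_tail n) g z) \<le> (\<integral>h. 4 * B * levy_tail n (h :: real^'n) \<partial>lborel)"
    unfolding levy_op_def
  proof (rule bochner_integral_norm_le)
    show "integrable lborel (\<lambda>h. levy_tail n h * sdiff (h, 0) g z)" by (rule levy_op_integrable[OF levy_kernel_tail g])
    show "integrable lborel (\<lambda>h :: real^'n. 4 * B * levy_tail n h)" using levy_tail_integrable[OF n] by (rule integrable_mult_right)
    fix h :: "real^'n"
    have "\<bar>sdiff (h, 0) g z\<bar> \<le> 4 * B"
      using B[of z] B[of "z + (h, 0)"] B[of "z - (h, 0)"] unfolding sdiff_def by linarith
    from mult_left_mono[OF this t0[of h]] show "norm (levy_tail n h * sdiff (h, 0) g z) \<le> 4 * B * levy_tail n h"
      using t0[of h] by (simp add: abs_mult mult_ac)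
  qed
  then show ?thesis by simp
qed

lemma levy_op_trunc_test_function:
  fixes \<phi> :: "(real^'n) \<times> real \<Rightarrow> real"
  assumes \<phi>: "test_function \<phi>"
  shows "test_function (levy_op (levy_trunc n) \<phi>)"
proof (rule test_functionI)
  show "smooth (levy_op (levy_trunc n) \<phi>)"
    by (rule levy_op_smooth(1)[OF levy_kernel_trunc test_function_smooth_bounded[OF \<phi>]])
  let ?S = "{a + b |a b. a \<in> fun_support \<phi> \<and> b \<in> cball (0 :: (real^'n) \<times> real) (real n)}"
  show "compact ?S" using \<phi> by (intro compact_sums) (auto simp: test_function_def)
  fix z assume nz: "levy_op (levy_trunc n) \<phi> z \<noteq> 0"
  show "z \<in> ?S"
  proof (rule ccontr)
    assume z: "z \<notin> ?S"
    have "levy_trunc n h * sdiff (h, 0) \<phi> z = 0" for h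
    proof (cases "norm h \<le> real n")
      case True
      have out: "\<phi> (z + b) = 0" if "norm b \<le> real n" for b
      proof (rule ccontr)
        assume "\<phi> (z + b) \<noteq> 0"
        then have "z + b \<in> fun_support \<phi>" using not_in_fun_support by blast
        moreover have "- b \<in> cball 0 (real n)" using that by simp
        moreover have "z = (z + b) + (- b)" by simp
        ultimately show False using z by blast
      qed
      have "\<phi> (z + 0) = 0" "\<phi> (z + (h, 0)) = 0" "\<phi> (z + (- h, 0)) = 0"
        using True by (intro out; simp add: norm_Pair)+
      moreover have "z - (h, 0) = z + (- h, 0)" by (simp add: prod_eq_iff)
      ultimately have "sdiff (h, 0) \<phi> z = 0" by (simp only: sdiff_def add_0_right)
      then show ?thesis by simp
    qed (simp add: levy_trunc_def)
    then show False using nz by (simp only: levy_op_def Bochner_Integration.integral_zero)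
  qed
qed

text \<open>The identity for the potential is tested with the truncated operator applied to \<phi>,
  whose adjoint potential is \<kappa> \<phi> minus the adjoint potential of the tail. When the
  truncation is removed, the integral converges by dominated convergence, and the tail term is
  killed by the continuity of \<nu>, since the derivatives of the tail's potential up to any fixed
  order tend to 0 uniformly.\<close>

theorem Theta_half_of_potential:
  fixes \<nu> :: "((real^'n) \<times> real \<Rightarrow> real) \<Rightarrow> real"
  assumes \<nu>: "distribution \<nu>" and cs: "compact (dist_support \<nu>)"
    and g: "g \<in> borel_measurable borel" "\<And>z. \<bar>g z\<bar> \<le> c"
    and rep: "\<And>\<phi>. test_function \<phi> \<Longrightarrow> kernel_conv \<nu> \<phi> = (\<integral>z. g z * \<phi> z \<partial>lborel)"
    and \<phi>: "test_function \<phi>"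
  shows "(\<integral>z. g z * heat_dual \<phi> z \<partial>lborel) = poisson_mass TYPE(real^'n) * \<nu> \<phi>"
proof -
  let ?\<kappa> = "poisson_mass TYPE(real^'n)"
  let ?d = "dirderiv (0, 1) \<phi>"
  have sb: "smooth_bounded \<phi>" by (rule test_function_smooth_bounded[OF \<phi>])
  have d: "test_function ?d" by (rule test_function_dirderiv[OF \<phi>])
  obtain \<eta> where \<eta>: "cutoff_near (dist_support \<nu>) \<eta>" "\<And>\<psi>. dist_pairing \<nu> \<psi> = \<nu> (\<lambda>x. \<eta> x * \<psi> x)"
    using dist_pairing_cutoff[OF cs] by metis
  have \<eta>t: "test_function \<eta>" using \<eta>(1) by (simp add: cutoff_near_def)
  obtain R where R: "R \<ge> 0" "time_bounded R \<phi>" using test_function_time_bounded[OF \<phi>] by blast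
  let ?\<psi> = "\<lambda>n z. levy_op (levy_trunc n) \<phi> z - ?d z"
  have \<psi>t: "test_function (?\<psi> n)" for n by (rule test_function_diff[OF levy_op_trunc_test_function[OF \<phi>] d])
  let ?H = "\<lambda>n. heat_adjoint (levy_op (levy_tail n) \<phi>)"
  have tail_tb: "time_bounded R (levy_op (levy_tail n) \<phi>)" for n by (rule time_bounded_levy_op[OF levy_kernel_tail R(2)])
  have full_tb: "time_bounded R (half_laplacian \<phi>)"
    unfolding half_laplacian_levy_op[OF \<phi>] by (rule time_bounded_levy_op[OF levy_kernel_half_levy R(2)])
  have d_tb: "time_bounded R ?d" by (rule time_bounded_dirderiv[OF R(2)])
  have trunc_tb: "time_bounded R (levy_op (levy_trunc n) \<phi>)" for n by (rule time_bounded_levy_op[OF levy_kernel_trunc R(2)])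
  have adj: "heat_adjoint (?\<psi> n) w = ?\<kappa> * \<phi> w - ?H n w" for n w
  proof -
    have "heat_adjoint (?\<psi> n) w = heat_adjoint (levy_op (levy_trunc n) \<phi>) w - heat_adjoint ?d w"
      by (rule heat_adjoint_diff[OF trunc_tb d_tb])
    also have "heat_adjoint (levy_op (levy_trunc n) \<phi>) w = heat_adjoint (half_laplacian \<phi>) w - ?H n w"
    proof -
      have "levy_op (levy_trunc n) \<phi> = (\<lambda>z. half_laplacian \<phi> z - levy_op (levy_tail n) \<phi> z)"
        using levy_op_split[OF sb, of n] by (auto simp: half_laplacian_levy_op[OF \<phi>])
      then show ?thesis by (simp only: heat_adjoint_diff[OF full_tb tail_tb])
    qed
    also have "heat_adjoint (half_laplacian \<phi>) w = ?\<kappa> * \<phi> w + heat_adjoint ?d w"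
      using heat_adjoint_fundamental[OF \<phi>, of w] heat_adjoint_diff[OF full_tb d_tb, of w]
      by (simp add: time_deriv_eq test_function_smooth[OF \<phi>])
    finally show ?thesis by simp
  qed
  have Hs: "smooth (?H n)" for n by (rule heat_adjoint_smooth(1)[OF tail_tb])
  have val: "(\<integral>z. g z * ?\<psi> n z \<partial>lborel) = ?\<kappa> * \<nu> \<phi> - \<nu> (\<lambda>x. \<eta> x * ?H n x)" for n
  proof -
    have "(\<integral>z. g z * ?\<psi> n z \<partial>lborel) = \<nu> (\<lambda>x. \<eta> x * (?\<kappa> * \<phi> x - ?H n x))"
      using rep[OF \<psi>t] by (simp add: kernel_conv_eq[OF \<psi>t] \<eta>(2) adj)
    also have "(\<lambda>x. \<eta> x * (?\<kappa> * \<phi> x - ?H n x)) = (\<lambda>x. \<eta> x * (?\<kappa> * \<phi> x) - \<eta> x * ?H n x)"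
      by (simp add: right_diff_distrib)
    also have "\<nu> \<dots> = \<nu> (\<lambda>x. \<eta> x * (?\<kappa> * \<phi> x)) - \<nu> (\<lambda>x. \<eta> x * ?H n x)"
      by (intro distribution_diff[OF \<nu>] test_function_mult \<eta>t smooth_cmult test_function_smooth[OF \<phi>] Hs)
    also have "\<nu> (\<lambda>x. \<eta> x * (?\<kappa> * \<phi> x)) = \<nu> (\<lambda>x. ?\<kappa> * \<phi> x)"
      by (intro distribution_cutoff_mult[OF \<nu> \<eta>(1)] test_function_cmult \<phi>)
    also have "\<dots> = ?\<kappa> * \<nu> \<phi>" using \<nu> \<phi> by (simp add: distribution_def)
    finally show ?thesis .
  qed
  let ?I = "\<lambda>n. \<integral>h. levy_tail n (h :: real^'n) \<partial>lborel"
  have "(\<lambda>n. \<nu> (\<lambda>x. \<eta> x * ?H n x)) \<longlonglongrightarrow> 0"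
  proof -
    have "compact (fun_support \<eta>)" using \<eta>t by (simp add: test_function_def)
    then obtain C m where Cm: "\<And>\<psi>. test_function \<psi> \<Longrightarrow> fun_support \<psi> \<subseteq> fun_support \<eta> \<Longrightarrow> \<bar>\<nu> \<psi>\<bar> \<le> C * Ck_norm m \<psi>"
      using \<nu> unfolding distribution_def by metis
    let ?A = "Ck_norm m \<eta>" and ?B = "Ck_norm m \<phi>"
    let ?q = "real (card {vs::((real^'n) \<times> real) list. set vs \<subseteq> Basis \<and> length vs \<le> m})"
    let ?D = "\<lambda>n. ?\<kappa> * (2 * R) * (4 * ?B * ?I n)"
    have bnd: "\<bar>\<nu> (\<lambda>x. \<eta> x * ?H n x)\<bar> \<le> \<bar>C\<bar> * (?q * (2 ^ m * (?A * ?D n)))" if n: "n \<ge> 1" for n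
    proof -
      let ?\<chi> = "\<lambda>x. \<eta> x * ?H n x"
      have t: "test_function ?\<chi>" by (intro test_function_mult \<eta>t Hs)
      have sup: "fun_support ?\<chi> \<subseteq> fun_support \<eta>"
        by (rule fun_support_subset[OF closed_fun_support]) (use not_in_fun_support[of _ \<eta>] in force)
      have deriv: "\<bar>iter_deriv vs (?H n) x\<bar> \<le> ?D n" if vs: "set vs \<subseteq> Basis" "length vs \<le> m" for vs x
      proof -
        \<comment> \<open>Derivatives pass through both translation invariant operators down to
          \<phi>, so one sup estimate covers every order.\<close>
        have e: "iter_deriv vs (?H n) = heat_adjoint (levy_op (levy_tail n) (iter_deriv vs \<phi>))"
          by (simp only: heat_adjoint_smooth(2)[OF tail_tb] levy_op_smooth(2)[OF levy_kernel_tail sb])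
        have tb: "time_bounded R (levy_op (levy_tail n) (iter_deriv vs \<phi>))"
          by (intro time_bounded_levy_op levy_kernel_tail time_bounded_iter_deriv R)
        have bd: "\<bar>levy_op (levy_tail n) (iter_deriv vs \<phi>) z\<bar> \<le> 4 * ?B * ?I n" for z
          by (intro levy_op_tail_bound smooth_bounded_iter_deriv sb n Ck_norm_upper vs)
        show ?thesis unfolding e by (rule heat_adjoint_bound[OF tb bd R(1)])
      qed
      have "\<bar>\<nu> ?\<chi>\<bar> \<le> C * Ck_norm m ?\<chi>" by (rule Cm[OF t sup])
      also have "\<dots> \<le> \<bar>C\<bar> * Ck_norm m ?\<chi>"
      proof (rule mult_right_mono[OF abs_ge_self])
        show "0 \<le> Ck_norm m ?\<chi>"
          using order_trans[OF abs_ge_zero Ck_norm_upper[OF test_function_smooth_bounded[OF t], of "[]" m undefined]] by simp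
      qed
      also have "\<dots> \<le> \<bar>C\<bar> * (?q * (2 ^ m * (?A * ?D n)))"
        by (intro mult_left_mono Ck_norm_le iter_deriv_mult_bound Ck_norm_upper test_function_smooth_bounded \<eta>t
            test_function_smooth[OF \<eta>t] Hs deriv) auto
      finally show ?thesis .
    qed
    have "(\<lambda>n. \<bar>C\<bar> * (?q * (2 ^ m * (?A * ?D n)))) \<longlonglongrightarrow> \<bar>C\<bar> * (?q * (2 ^ m * (?A * (?\<kappa> * (2 * R) * (4 * ?B * 0)))))"
      by (intro tendsto_intros levy_tail_tendsto)
    then have "(\<lambda>n. \<bar>C\<bar> * (?q * (2 ^ m * (?A * ?D n)))) \<longlonglongrightarrow> 0" by simp
    then show ?thesis
      by (rule Lim_null_comparison[rotated]) (use bnd in \<open>auto intro!: eventually_sequentiallyI[of 1]\<close>)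
  qed
  then have "(\<lambda>n. ?\<kappa> * \<nu> \<phi> - \<nu> (\<lambda>x. \<eta> x * ?H n x)) \<longlonglongrightarrow> ?\<kappa> * \<nu> \<phi> - 0" by (intro tendsto_intros)
  then have lim1: "(\<lambda>n. \<integral>z. g z * ?\<psi> n z \<partial>lborel) \<longlonglongrightarrow> ?\<kappa> * \<nu> \<phi>" by (simp add: val)
  have lim2: "(\<lambda>n. \<integral>z. g z * ?\<psi> n z \<partial>lborel) \<longlonglongrightarrow> (\<integral>z. g z * heat_dual \<phi> z \<partial>lborel)"
  proof (rule integral_dominated_convergence)
    obtain C where C: "C \<ge> 0" "\<And>z h. \<bar>sdiff h \<phi> z\<bar> \<le> C * min ((norm h)\<^sup>2) 1"
      using smooth_bounded_sdiff_bound(2)[OF sb] by metis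
    \<comment> \<open>The truncated operators are dominated, uniformly in \<open>n\<close>, by the
      full Levy integral with absolute values inside.\<close>
    let ?a = "\<lambda>z. \<integral>h. \<bar>half_levy h * sdiff (h, 0) \<phi> z\<bar> \<partial>lborel"
    have c0: "c \<ge> 0" using order_trans[OF abs_ge_zero g(2)] .
    show "integrable lborel (\<lambda>z. c * (?a z + \<bar>?d z\<bar>))"
      using levy_op_L1(3)[OF \<phi> levy_kernel_half_levy C] test_function_integrable[OF d] by simp
    have B: "\<And>z. \<bar>\<phi> z\<bar> \<le> Ck_norm 0 \<phi>" using Ck_norm_upper[OF sb, of "[]" 0] by simp
    have "(\<lambda>n. levy_op (levy_tail n) \<phi> z) \<longlonglongrightarrow> 0" for z
    proof (rule Lim_null_comparison)
      show "\<forall>\<^sub>F n in sequentially. norm (levy_op (levy_tail n) \<phi> z) \<le> 4 * Ck_norm 0 \<phi> * ?I n"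
        using levy_op_tail_bound[OF sb B] by (intro eventually_sequentiallyI[of 1]) simp
      have "(\<lambda>n. 4 * Ck_norm 0 \<phi> * ?I n) \<longlonglongrightarrow> 4 * Ck_norm 0 \<phi> * 0" by (intro tendsto_intros levy_tail_tendsto)
      then show "(\<lambda>n. 4 * Ck_norm 0 \<phi> * ?I n) \<longlonglongrightarrow> 0" by simp
    qed
    then have "(\<lambda>n. g z * ((half_laplacian \<phi> z - levy_op (levy_tail n) \<phi> z) - ?d z)) \<longlonglongrightarrow> g z * ((half_laplacian \<phi> z - 0) - ?d z)" for z
      by (intro tendsto_intros)
    then show "AE z in lborel. (\<lambda>n. g z * ?\<psi> n z) \<longlonglongrightarrow> g z * heat_dual \<phi> z"
      by (simp add: levy_op_split[OF sb] half_laplacian_levy_op[OF \<phi>] heat_dual_eq[OF \<phi>])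
    have "\<bar>levy_op (levy_trunc n) \<phi> z\<bar> \<le> ?a z" for n z
    proof -
      have "norm (levy_op (levy_trunc n) \<phi> z) \<le> ?a z"
        unfolding levy_op_def
      proof (rule bochner_integral_norm_le)
        show "integrable lborel (\<lambda>h. levy_trunc n h * sdiff (h, 0) \<phi> z)" by (rule levy_op_integrable[OF levy_kernel_trunc sb])
        show "integrable lborel (\<lambda>h. \<bar>half_levy h * sdiff (h, 0) \<phi> z\<bar>)" using levy_op_integrable[OF levy_kernel_half_levy sb, of z] by simp
      qed (auto simp: levy_trunc_def indicator_def)
      then show ?thesis by simp
    qed
    then have "\<bar>?\<psi> n z\<bar> \<le> ?a z + \<bar>?d z\<bar>" for n z
      using abs_triangle_ineq4 add_right_mono order_trans by blast
    then have "\<bar>g z\<bar> * \<bar>?\<psi> n z\<bar> \<le> c * (?a z + \<bar>?d z\<bar>)" for n z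
      using g(2) c0 by (intro mult_mono) auto
    then show "AE z in lborel. norm (g z * ?\<psi> n z) \<le> c * (?a z + \<bar>?d z\<bar>)" for n
      by (intro AE_I2) (simp add: abs_mult)
    show "(\<lambda>z. g z * ?\<psi> n z) \<in> borel_measurable lborel" for n
      using g(1) smooth_borel_measurable[OF test_function_smooth[OF \<psi>t[of n]]] by simp
    show "(\<lambda>z. g z * heat_dual \<phi> z) \<in> borel_measurable lborel"
      using g(1) borel_measurable_integrable[OF heat_dual_integrable[OF \<phi>]] by simp
  qed
  show ?thesis by (rule LIMSEQ_unique[OF lim2 lim1])
qed

theorem removable_imp_capacity_zero:
  fixes E :: "((real^'n) \<times> real) set"
  assumes E: "compact E" and rem: "half_caloric_removable E"
  shows "half_caloric_capacity E = 0"
proof -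
  have "dist_pairing \<nu> (\<lambda>_. 1) = 0" if adm: "admissible E \<nu>" for \<nu>
  proof -
    have \<nu>: "distribution \<nu>" and sub: "dist_support \<nu> \<subseteq> E" using adm by (auto simp: admissible_def)
    have cs: "compact (dist_support \<nu>)" using E sub closed_dist_support by (metis closed_Int_compact inf.absorb1)
    obtain g where g: "g \<in> borel_measurable lebesgue" "Linfty_norm g \<le> ereal 1"
      and rep: "\<And>\<phi>. test_function \<phi> \<Longrightarrow> kernel_conv \<nu> \<phi> = (LINT x|lebesgue. g x * \<phi> x)"
      using adm unfolding admissible_def dist_Linfty_le_def by blast
    obtain g' where g': "g' \<in> borel_measurable borel" "\<And>z. \<bar>g' z\<bar> \<le> 1" "AE z in lebesgue. g z = g' z"
      using Linfty_representative[OF g] by auto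
    have rep': "kernel_conv \<nu> \<phi> = (\<integral>z. g' z * \<phi> z \<partial>lborel)" if "test_function \<phi>" for \<phi>
      unfolding rep[OF that]
      by (intro lebesgue_integral_representative g g' smooth_borel_measurable test_function_smooth that)
    have Th: "Theta_half g \<phi> = poisson_mass TYPE(real^'n) * \<nu> \<phi>" if "test_function \<phi>" for \<phi>
      unfolding Theta_half_representative[OF g(1) g'(1,3) that]
      by (rule Theta_half_of_potential[OF \<nu> cs g'(1,2) rep' that])
    have "half_caloric_on (- E) g"
      unfolding half_caloric_on_def vanishes_on_def
    proof (intro allI impI)
      fix \<phi> :: "(real^'n) \<times> real \<Rightarrow> real" assume "test_function \<phi>" "fun_support \<phi> \<subseteq> - E"
      then have "\<nu> \<phi> = 0" using sub by (intro vanishes_off_dist_support[OF \<nu>]) auto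
      then show "Theta_half g \<phi> = 0" using Th \<open>test_function \<phi>\<close> by simp
    qed
    moreover have "Linfty_norm g < \<infinity>" using g(2) by (rule le_less_trans) simp
    ultimately have "half_caloric_on UNIV g" using rem g(1) unfolding half_caloric_removable_def by blast
    then have zero: "\<nu> \<phi> = 0" if "test_function \<phi>" for \<phi>
      using that Th[OF that] poisson_mass_pos[where 'a = "real^'n"]
      unfolding half_caloric_on_def vanishes_on_def by simp
    obtain \<eta> where \<eta>: "cutoff_near (dist_support \<nu>) \<eta>" "\<And>\<psi>. dist_pairing \<nu> \<psi> = \<nu> (\<lambda>x. \<eta> x * \<psi> x)"
      using dist_pairing_cutoff[OF cs] by metis
    then show ?thesis using zero[of \<eta>] by (simp add: cutoff_near_def)
  qed
  then show ?thesis unfolding half_caloric_capacity_def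
    by (intro antisym SUP_least) auto
qed

section \<open>The product rule\<close>

lemma integrable_lborel_times:
  fixes f :: "'a::euclidean_space \<Rightarrow> real" and g :: "'b::euclidean_space \<Rightarrow> real"
  assumes f: "integrable lborel f" and g: "integrable lborel g"
  shows "integrable lborel (\<lambda>p. f (fst p) * g (snd p))"
proof -
  have [measurable]: "f \<in> borel_measurable borel" "g \<in> borel_measurable borel" using f g by auto
  have "integrable (lborel \<Otimes>\<^sub>M lborel) (\<lambda>p. f (fst p) * g (snd p))"
  proof (rule lborel_pair.Fubini_integrable)
    have "integrable lborel (\<lambda>x. \<bar>f x\<bar> * (\<integral>y. \<bar>g y\<bar> \<partial>lborel))" using f by simp
    then show "integrable lborel (\<lambda>x. \<integral>y. norm (f (fst (x, y)) * g (snd (x, y))) \<partial>lborel)"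
      by (simp add: abs_mult)
    show "AE x in lborel. integrable lborel (\<lambda>y. f (fst (x, y)) * g (snd (x, y)))"
      using g by simp
  qed measurable
  then show ?thesis by (simp add: lborel_prod)
qed

lemma heat_adjoint_sdiff:
  fixes g :: "(real^'n) \<times> real \<Rightarrow> real"
  assumes g: "time_bounded R g"
  shows "sdiff (h, 0) (heat_adjoint g) w = (\<integral>y. half_heat_kernel y * sdiff (h, 0) g (y + w) \<partial>lborel)"
proof -
  note i = heat_adjoint_integrable[OF g]
  have "(\<integral>y. half_heat_kernel y * sdiff (h, 0) g (y + w) \<partial>lborel)
    = (\<integral>y. 2 * (half_heat_kernel y * g (y + w)) - half_heat_kernel y * g (y + (w + (h, 0))) - half_heat_kernel y * g (y + (w - (h, 0))) \<partial>lborel)"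
    by (intro Bochner_Integration.integral_cong refl) (simp only: sdiff_def right_diff_distrib add.assoc add_diff_eq mult.left_commute)
  also have "\<dots> = 2 * heat_adjoint g w - heat_adjoint g (w + (h, 0)) - heat_adjoint g (w - (h, 0))"
    using i[of w] i[of "w + (h, 0)"] i[of "w - (h, 0)"] unfolding heat_adjoint_def translate_avg_def
    by (subst Bochner_Integration.integral_diff, simp, simp, subst Bochner_Integration.integral_diff, simp_all)
  finally show ?thesis by (simp only: sdiff_def)
qed

text \<open>Both operators average translates, so commuting them is Fubini; the joint integrand is
  dominated by the Levy weight in \<open>h\<close> times a windowed heat kernel in
  \<open>y\<close>.\<close>

lemma levy_heat_adjoint_commute:
  fixes \<psi> :: "(real^'n) \<times> real \<Rightarrow> real"
  assumes k: "levy_kernel k" and \<psi>: "time_bounded R \<psi>"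
  shows "levy_op k (heat_adjoint \<psi>) w = heat_adjoint (levy_op k \<psi>) w"
proof -
  let ?K = "half_heat_kernel :: (real^'n) \<times> real \<Rightarrow> real"
  let ?A = "{- R - snd w..R - snd w}"
  let ?W = "heat_window ?A :: (real^'n) \<times> real \<Rightarrow> real"
  have sb: "smooth_bounded \<psi>" using \<psi> by (simp add: time_bounded_def)
  obtain C where C: "C \<ge> 0" "\<And>z h. \<bar>sdiff h \<psi> z\<bar> \<le> C * min ((norm h)\<^sup>2) 1"
    using smooth_bounded_sdiff_bound(2)[OF sb] by metis
  have [measurable]: "k \<in> borel_measurable borel" and k0: "\<And>h. k h \<ge> 0"
    and ki: "integrable lborel (\<lambda>h. k h * min ((norm h)\<^sup>2) 1)"
    using k by (auto simp: levy_kernel_def)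
  have [measurable]: "\<psi> \<in> borel_measurable borel" by (rule smooth_borel_measurable[OF smooth_bounded_smooth[OF sb]])
  let ?H = "\<lambda>p. k (fst p) * (?K (snd p) * sdiff (fst p, 0) \<psi> (snd p + w))"
  have Hm: "?H \<in> borel_measurable (borel \<Otimes>\<^sub>M borel)" unfolding sdiff_def by measurable
  have wi: "integrable lborel (heat_window ?A :: (real^'n) \<times> real \<Rightarrow> real)" by (rule heat_window_integral) auto
  have Hi: "integrable lborel ?H"
  proof (rule Bochner_Integration.integrable_bound)
    show "integrable lborel (\<lambda>p. C * ((k (fst p) * min ((norm (fst p))\<^sup>2) 1) * ?W (snd p)))"
      by (rule integrable_mult_right[OF integrable_lborel_times[OF ki wi]])
    show "?H \<in> borel_measurable lborel" using Hm by (simp add: borel_prod)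
    have "\<bar>?H p\<bar> \<le> C * ((k (fst p) * min ((norm (fst p))\<^sup>2) 1) * ?W (snd p))" for p
    proof (cases "snd (snd p) \<in> ?A")
      case True
      have "\<bar>?H p\<bar> = k (fst p) * (?K (snd p) * \<bar>sdiff (fst p, 0) \<psi> (snd p + w)\<bar>)"
        using k0 by (simp add: abs_mult half_heat_kernel_nonneg)
      also have "\<dots> \<le> k (fst p) * (?K (snd p) * (C * min ((norm (fst p))\<^sup>2) 1))"
        using C(2)[of "(fst p, 0)" "snd p + w"] by (intro mult_left_mono k0 half_heat_kernel_nonneg) (simp add: norm_Pair)
      finally show ?thesis using True by (simp add: heat_window_def mult_ac)
    next
      case False
      then have "\<bar>snd (snd p + w)\<bar> > R" by auto
      then have "sdiff (fst p, 0) \<psi> (snd p + w) = 0"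
        using time_bounded_zero[OF \<psi>] by (simp add: sdiff_def)
      then show ?thesis using False by (simp add: heat_window_def)
    qed
    then show "AE p in lborel. norm (?H p) \<le> norm (C * ((k (fst p) * min ((norm (fst p))\<^sup>2) 1) * ?W (snd p)))"
      by (intro AE_I2) (simp only: real_norm_def order_trans[OF _ abs_ge_self])
  qed
  have "levy_op k (heat_adjoint \<psi>) w = (\<integral>h. \<integral>y. ?H (h, y) \<partial>lborel \<partial>lborel)"
    by (simp add: levy_op_def heat_adjoint_sdiff[OF \<psi>])
  also have "\<dots> = (\<integral>y. \<integral>h. ?H (h, y) \<partial>lborel \<partial>lborel)" using integral_lborel_pair[OF Hi] by simp
  also have "\<dots> = (\<integral>y. ?K y * levy_op k \<psi> (y + w) \<partial>lborel)"
    by (intro Bochner_Integration.integral_cong refl) (simp add: levy_op_def mult.left_commute)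
  finally show ?thesis by (simp add: heat_adjoint_def translate_avg_def)
qed

text \<open>Moves the operator from inside the potential to outside. The form with
  \<open>levy_op half_levy\<close> is chosen because an adjoint potential need not be a test
  function, and the multiplier has been identified with the singular integral on test
  functions.\<close>

lemma heat_adjoint_equation:
  fixes \<psi> :: "(real^'n) \<times> real \<Rightarrow> real"
  assumes \<psi>: "test_function \<psi>"
  shows "levy_op half_levy (heat_adjoint \<psi>) w - dirderiv (0, 1) (heat_adjoint \<psi>) w
    = poisson_mass TYPE(real^'n) * \<psi> w"
proof -
  obtain R where R: "R \<ge> 0" "time_bounded R \<psi>" using test_function_time_bounded[OF \<psi>] by blast
  have full_tb: "time_bounded R (levy_op half_levy \<psi>)" by (rule time_bounded_levy_op[OF levy_kernel_half_levy R(2)])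
  have "dirderiv (0, 1) (heat_adjoint \<psi>) = heat_adjoint (dirderiv (0, 1) \<psi>)"
    by (rule dirderiv_eqI[OF heat_adjoint_has_derivative[OF R(2)]])
  then show ?thesis
    using heat_adjoint_fundamental[OF \<psi>, of w] heat_adjoint_diff[OF full_tb time_bounded_dirderiv[OF R(2)], where w = w]
      levy_heat_adjoint_commute[OF levy_kernel_half_levy R(2), of w]
    by (simp add: time_deriv_eq test_function_smooth[OF \<psi>] half_laplacian_levy_op[OF \<psi>])
qed

lemma smooth_bounded_lipschitz:
  fixes g :: "'a::euclidean_space \<Rightarrow> real"
  assumes "smooth_bounded g"
  shows "\<exists>B\<ge>0. \<forall>z h. \<bar>g z - g (z + h)\<bar> \<le> B * min (norm h) 1"
proof -
  obtain B0 where B0: "B0 \<ge> 0" "\<And>vs x. length vs = 0 \<Longrightarrow> \<bar>iter_deriv vs g x\<bar> \<le> B0 * prod_list (map norm vs)"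
    using smooth_bounded_iter_deriv_bound[OF assms] by metis
  obtain B1 where B1: "B1 \<ge> 0" "\<And>vs x. length vs = 1 \<Longrightarrow> \<bar>iter_deriv vs g x\<bar> \<le> B1 * prod_list (map norm vs)"
    using smooth_bounded_iter_deriv_bound[OF assms] by metis
  have "\<bar>g z - g (z + h)\<bar> \<le> (2 * B0 + B1) * min (norm h) 1" for z h
  proof -
    have "\<bar>g z - g (z + h)\<bar> \<le> B1 * norm (z - (z + h))"
    proof (rule dirderiv_lipschitz[OF smooth_bounded_smooth[OF assms]])
      show "\<bar>dirderiv v g x\<bar> \<le> B1 * norm v" for v x using B1(2)[of "[v]" x] by (simp add: dirderiv_def)
    qed (use B1 in simp)
    moreover have "\<bar>g z - g (z + h)\<bar> \<le> 2 * B0" using B0(2)[of "[]" z] B0(2)[of "[]" "z + h"] by simp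
    moreover have "B1 * norm h \<le> (2 * B0 + B1) * norm h" using B0(1) by (intro mult_right_mono) auto
    ultimately show ?thesis using B1(1) by (auto simp: min_def)
  qed
  then show ?thesis using B0(1) B1(1) by (intro exI[of _ "2 * B0 + B1"]) auto
qed

text \<open>Twice the carre du champ of the half Laplacian; \<open>2 * half_levy\<close> is the jump
  density.\<close>

definition square_field :: "((real^'n) \<times> real \<Rightarrow> real) \<Rightarrow> ((real^'n) \<times> real \<Rightarrow> real) \<Rightarrow> (real^'n) \<times> real \<Rightarrow> real" where
  "square_field \<phi> u z = (\<integral>h. 2 * half_levy h * ((\<phi> z - \<phi> (z + (h, 0))) * (u z - u (z + (h, 0)))) \<partial>lborel)"

lemma half_levy_minus: "half_levy (- h) = half_levy h"
  by (simp add: half_levy_def riesz_kernel_def)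

lemma square_field_integrable:
  fixes \<phi> u :: "(real^'n) \<times> real \<Rightarrow> real"
  assumes "smooth_bounded \<phi>" "smooth_bounded u"
  shows "integrable lborel (\<lambda>h. half_levy h * ((\<phi> z - \<phi> (z + (h, 0))) * (u z - u (z + (h, 0)))))"
proof -
  obtain B where B: "B \<ge> 0" "\<And>z h. \<bar>\<phi> z - \<phi> (z + h)\<bar> \<le> B * min (norm h) 1"
    using smooth_bounded_lipschitz[OF assms(1)] by metis
  obtain B' where B': "B' \<ge> 0" "\<And>z h. \<bar>u z - u (z + h)\<bar> \<le> B' * min (norm h) 1"
    using smooth_bounded_lipschitz[OF assms(2)] by metis
  have [measurable]: "\<phi> \<in> borel_measurable borel" "u \<in> borel_measurable borel"
    using assms by (auto intro: smooth_borel_measurable smooth_bounded_smooth)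
  show ?thesis
  proof (rule Bochner_Integration.integrable_bound)
    show "integrable lborel (\<lambda>h :: real^'n. (B * B') * (half_levy h * min ((norm h)\<^sup>2) 1))"
      by (rule integrable_mult_right[OF levy_kernel_half_levy[unfolded levy_kernel_def, THEN conjunct2, THEN conjunct2]])
    have "\<bar>half_levy h * ((\<phi> z - \<phi> (z + (h, 0))) * (u z - u (z + (h, 0))))\<bar> \<le> (B * B') * (half_levy h * min ((norm h)\<^sup>2) 1)" for h :: "real^'n"
    proof -
      have m: "min (norm h) 1 * min (norm h) 1 = min ((norm h)\<^sup>2) 1"
      proof (cases "norm h \<le> 1")
        case True
        then have "(norm h)\<^sup>2 \<le> 1" by (intro power_le_one) auto
        with True show ?thesis by (simp add: min_def power2_eq_square)
      next
        case False
        then have "1 < (norm h)\<^sup>2" by (intro one_less_power) auto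
        with False show ?thesis by simp
      qed
      have "\<bar>\<phi> z - \<phi> (z + (h, 0))\<bar> * \<bar>u z - u (z + (h, 0))\<bar> \<le> (B * min (norm h) 1) * (B' * min (norm h) 1)"
        using B(2)[of z "(h, 0)"] B'(2)[of z "(h, 0)"] B(1) by (intro mult_mono) (auto simp: norm_Pair)
      also have "\<dots> = (B * B') * min ((norm h)\<^sup>2) 1" by (simp add: m[symmetric] mult_ac)
      finally have "half_levy h * (\<bar>\<phi> z - \<phi> (z + (h, 0))\<bar> * \<bar>u z - u (z + (h, 0))\<bar>) \<le> half_levy h * ((B * B') * min ((norm h)\<^sup>2) 1)"
        by (rule mult_left_mono[OF _ half_levy_nonneg])
      then show ?thesis by (simp add: abs_mult half_levy_nonneg mult_ac)
    qed
    then show "AE h in lborel. norm (half_levy h * ((\<phi> z - \<phi> (z + (h, 0))) * (u z - u (z + (h, 0))))) \<le> norm ((B * B') * (half_levy h * min ((norm h)\<^sup>2) 1))"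
      by (intro AE_I2) (simp only: real_norm_def order_trans[OF _ abs_ge_self])
  qed measurable
qed

lemma levy_op_mult:
  fixes \<phi> u :: "(real^'n) \<times> real \<Rightarrow> real"
  assumes \<phi>: "smooth_bounded \<phi>" and u: "smooth_bounded u"
  shows "levy_op half_levy (\<lambda>z. \<phi> z * u z) z
    = \<phi> z * levy_op half_levy u z + u z * levy_op half_levy \<phi> z - square_field \<phi> u z"
proof -
  let ?G = "\<lambda>h. half_levy h * ((\<phi> z - \<phi> (z + (h, 0))) * (u z - u (z + (h, 0))))"
  have [measurable]: "\<phi> \<in> borel_measurable borel" "u \<in> borel_measurable borel"
    using assms by (auto intro: smooth_borel_measurable smooth_bounded_smooth)
  have Gm: "?G \<in> borel_measurable borel" by measurable
  have G: "integrable lborel ?G" by (rule square_field_integrable[OF assms])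
  have G': "integrable lborel (\<lambda>h. ?G (- h))" using G by (simp only: integrable_lborel_translate(3)[OF Gm])
  have Ge: "(\<integral>h. ?G (- h) \<partial>lborel) = (\<integral>h. ?G h \<partial>lborel)" by (rule integral_lborel_translate(3)[OF Gm])
  have a: "integrable lborel (\<lambda>h. half_levy h * sdiff (h, 0) \<phi> z)" "integrable lborel (\<lambda>h. half_levy h * sdiff (h, 0) u z)"
    by (intro levy_op_integrable levy_kernel_half_levy assms)+
  have mi: "z + (- h, 0) = z - (h, 0)" for h by (simp add: prod_eq_iff)
  \<comment> \<open>Discrete product rule: the second difference of a product is \<phi> times that
    of u plus u times that of \<phi>, minus the products of the one-sided increments over h and over
    -h.\<close>
  have "levy_op half_levy (\<lambda>z. \<phi> z * u z) z =
     (\<integral>h. \<phi> z * (half_levy h * sdiff (h, 0) u z) + u z * (half_levy h * sdiff (h, 0) \<phi> z) - (?G h + ?G (- h)) \<partial>lborel)"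
    unfolding levy_op_def
    by (intro Bochner_Integration.integral_cong refl) (simp only: sdiff_def half_levy_minus mi, simp add: algebra_simps)
  also have "\<dots> = \<phi> z * levy_op half_levy u z + u z * levy_op half_levy \<phi> z - ((\<integral>h. ?G h \<partial>lborel) + (\<integral>h. ?G (- h) \<partial>lborel))"
    unfolding levy_op_def
    by (subst Bochner_Integration.integral_diff, intro Bochner_Integration.integrable_add integrable_mult_right a,
        intro Bochner_Integration.integrable_add G G',
        subst Bochner_Integration.integral_add, intro integrable_mult_right a, intro integrable_mult_right a,
        subst Bochner_Integration.integral_add[OF G G'], simp only: integral_mult_right_zero)
  also have "(\<integral>h. ?G h \<partial>lborel) + (\<integral>h. ?G (- h) \<partial>lborel) = square_field \<phi> u z"
    unfolding square_field_def Ge by (simp add: mult.assoc)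
  finally show ?thesis .
qed

text \<open>The equation for the adjoint potential turns the terms in which an operator falls on it
  into \<kappa> \<phi> \<psi>. What remains involves the potential through its values and first
  differences alone, so each term is an explicit kernel applied to \<psi>.\<close>

lemma heat_dual_mult:
  fixes \<phi> \<psi> :: "(real^'n) \<times> real \<Rightarrow> real"
  assumes \<phi>: "test_function \<phi>" and \<psi>: "test_function \<psi>"
  shows "heat_dual (\<lambda>z. \<phi> z * heat_adjoint \<psi> z) z
    = poisson_mass TYPE(real^'n) * \<phi> z * \<psi> z + heat_dual \<phi> z * heat_adjoint \<psi> z - square_field \<phi> (heat_adjoint \<psi>) z"
proof -
  obtain R where R: "R \<ge> 0" "time_bounded R \<psi>" using test_function_time_bounded[OF \<psi>] by blast
  have u: "smooth_bounded (heat_adjoint \<psi>)" by (rule heat_adjoint_smooth_bounded[OF R(2,1)])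
  have us: "smooth (heat_adjoint \<psi>)" using u by (rule smooth_bounded_smooth)
  have t: "test_function (\<lambda>z. \<phi> z * heat_adjoint \<psi> z)" by (rule test_function_mult(1)[OF \<phi> us])
  have d: "dirderiv (0, 1) (\<lambda>z. \<phi> z * heat_adjoint \<psi> z) z = \<phi> z * dirderiv (0, 1) (heat_adjoint \<psi>) z + dirderiv (0, 1) \<phi> z * heat_adjoint \<psi> z"
    by (subst dirderiv_mult) (auto intro: smooth_differentiable us test_function_smooth[OF \<phi>])
  have "heat_dual (\<lambda>z. \<phi> z * heat_adjoint \<psi> z) z
     = \<phi> z * (levy_op half_levy (heat_adjoint \<psi>) z - dirderiv (0, 1) (heat_adjoint \<psi>) z)
       + heat_adjoint \<psi> z * (levy_op half_levy \<phi> z - dirderiv (0, 1) \<phi> z) - square_field \<phi> (heat_adjoint \<psi>) z"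
    by (simp add: heat_dual_eq[OF t] half_laplacian_levy_op[OF t] levy_op_mult[OF test_function_smooth_bounded[OF \<phi>] u] d algebra_simps)
  then show ?thesis
    by (simp add: heat_adjoint_equation[OF \<psi>] heat_dual_eq[OF \<phi>] half_laplacian_levy_op[OF \<phi>] mult_ac)
qed

section \<open>Localization of bounded potentials\<close>

text \<open>A uniform L^1 bound on G(., w) makes its integral a bounded function of
  \<open>w\<close>, and Fubini then says that the integrated action on \<psi> is integration against
  this bounded function. The variable \<open>p\<close> is a space-time point in one use and a pair
  of point and jump in the other.\<close>

lemma kernel_swap:
  fixes G :: "'p::euclidean_space \<times> 'w::euclidean_space \<Rightarrow> real"
  assumes G [measurable]: "G \<in> borel_measurable borel"
    and C: "\<And>w. (\<integral>\<^sup>+p. ennreal \<bar>G (p, w)\<bar> \<partial>lborel) \<le> ennreal C" "C \<ge> 0"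
    and \<psi>: "integrable lborel \<psi>"
  shows "(\<integral>p. \<integral>w. G (p, w) * \<psi> w \<partial>lborel \<partial>lborel) = (\<integral>w. (\<integral>p. G (p, w) \<partial>lborel) * \<psi> w \<partial>lborel)"
    and "\<bar>\<integral>p. G (p, w) \<partial>lborel\<bar> \<le> C"
    and "(\<lambda>w. \<integral>p. G (p, w) \<partial>lborel) \<in> borel_measurable borel"
    and "integrable lborel (\<lambda>p. \<integral>w. G (p, w) * \<psi> w \<partial>lborel)"
proof -
  have [measurable]: "\<psi> \<in> borel_measurable borel" using \<psi> by auto
  have [measurable]: "G \<in> borel_measurable (borel \<Otimes>\<^sub>M borel)" using G by (simp add: borel_prod)
  have sl: "integrable lborel (\<lambda>p. G (p, w))" for w
    unfolding integrable_iff_bounded using le_less_trans[OF C(1)[of w]] by simp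
  have abs_le: "(\<integral>p. \<bar>G (p, w)\<bar> \<partial>lborel) \<le> C" for w
  proof -
    have "ennreal (\<integral>p. \<bar>G (p, w)\<bar> \<partial>lborel) = (\<integral>\<^sup>+p. ennreal \<bar>G (p, w)\<bar> \<partial>lborel)"
      using nn_integral_eq_integral[of lborel "\<lambda>p. \<bar>G (p, w)\<bar>"] sl[of w] by simp
    with C(1)[of w] have "ennreal (\<integral>p. \<bar>G (p, w)\<bar> \<partial>lborel) \<le> ennreal C" by simp
    then show ?thesis using C(2) by simp
  qed
  show "\<bar>\<integral>p. G (p, w) \<partial>lborel\<bar> \<le> C"
    by (rule order_trans[OF integral_abs_bound abs_le])
  show "(\<lambda>w. \<integral>p. G (p, w) \<partial>lborel) \<in> borel_measurable borel" by measurable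
  let ?H = "\<lambda>q. G (snd q, fst q) * \<psi> (fst q)"
  have Hi: "integrable (lborel \<Otimes>\<^sub>M lborel) ?H"
  proof (rule lborel_pair.Fubini_integrable)
    show "?H \<in> borel_measurable (lborel \<Otimes>\<^sub>M lborel)" by measurable
    show "integrable lborel (\<lambda>w. \<integral>p. norm (?H (w, p)) \<partial>lborel)"
    proof (rule Bochner_Integration.integrable_bound)
      show "integrable lborel (\<lambda>w. C * \<psi> w)" using \<psi> by simp
      show "(\<lambda>w. \<integral>p. norm (?H (w, p)) \<partial>lborel) \<in> borel_measurable lborel" by measurable
      have "(\<integral>p. norm (?H (w, p)) \<partial>lborel) \<le> C * \<bar>\<psi> w\<bar>" for w
        using mult_right_mono[OF abs_le[of w], of "\<bar>\<psi> w\<bar>"] by (simp add: abs_mult)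
      then show "AE w in lborel. norm (\<integral>p. norm (?H (w, p)) \<partial>lborel) \<le> norm (C * \<psi> w)"
        using C(2) by (intro AE_I2) (simp add: abs_mult)
    qed
    show "AE w in lborel. integrable lborel (\<lambda>p. ?H (w, p))" using sl by simp
  qed
  have Hs: "integrable (lborel \<Otimes>\<^sub>M lborel) (\<lambda>q. G q * \<psi> (snd q))"
    using lborel_pair.integrable_product_swap[OF Hi] by (simp add: case_prod_beta')
  show "integrable lborel (\<lambda>p. \<integral>w. G (p, w) * \<psi> w \<partial>lborel)"
    using lborel_pair.integrable_fst'[OF Hs] by simp
  have "integrable lborel (\<lambda>q. G q * \<psi> (snd q))" using Hs by (simp add: lborel_prod)
  from integral_lborel_pair[OF this]
  show "(\<integral>p. \<integral>w. G (p, w) * \<psi> w \<partial>lborel \<partial>lborel) = (\<integral>w. (\<integral>p. G (p, w) \<partial>lborel) * \<psi> w \<partial>lborel)"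
    by simp
qed

text \<open>Convexity: on [0, 1] the function (1 + b)^m lies below its chord from b = 0 to b =
  1.\<close>

lemma power_one_plus_le:
  fixes b :: real
  assumes "0 \<le> b" "b \<le> 1"
  shows "(1 + b) ^ m - 1 \<le> (2 ^ m - 1) * b"
proof (induction m)
  case (Suc m)
  have "(1 + b) ^ Suc m = (1 + b) ^ m * (1 + b)" by simp
  also have "\<dots> \<le> (1 + (2 ^ m - 1) * b) * (1 + b)" using Suc assms by (intro mult_right_mono) auto
  also have "\<dots> = 1 + b + (2 ^ m - 1) * b + (2 ^ m - 1) * (b * b)" by (simp add: algebra_simps)
  also have "\<dots> \<le> 1 + b + (2 ^ m - 1) * b + (2 ^ m - 1) * b"
    using assms mult_left_le_one_le[of b b] by (intro add_left_mono mult_left_mono) (auto simp: one_le_power)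
  finally show ?case by (simp add: algebra_simps)
qed simp

text \<open>The kernel is s times a negative power of the distance from the origin to (s, y). Moving
  y by h changes that distance by at most |h|, and the distance is at least s, so the relative
  change is at most |h| / s.\<close>

lemma poisson_kernel_harnack:
  fixes y h :: "'b::euclidean_space"
  assumes s: "s > 0"
  shows "poisson_kernel s (y - h) \<le> (1 + norm h / s) ^ Suc DIM('b) * poisson_kernel s y"
proof -
  let ?a = "sqrt (s\<^sup>2 + (norm y)\<^sup>2)" and ?c = "sqrt (s\<^sup>2 + (norm (y - h))\<^sup>2)"
  have c: "s \<le> ?c" "?c > 0" using s by (auto intro!: real_le_rsqrt simp: add_pos_nonneg)
  have a: "?a > 0" using s by (simp add: add_pos_nonneg)
  have "norm (s, y) \<le> norm (s, y - h) + norm ((0::real), h)"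
    using norm_triangle_ineq[of "(s, y - h)" "(0, h)"] by simp
  then have "?a \<le> ?c + norm h" by (simp add: norm_Pair)
  also have "\<dots> \<le> ?c + norm h / s * ?c"
  proof -
    have "norm h * s \<le> norm h * ?c" using c by (intro mult_left_mono) auto
    then show ?thesis using s by (simp add: field_simps)
  qed
  finally have "?a \<le> (1 + norm h / s) * ?c" by (simp add: algebra_simps)
  then have "?a ^ Suc DIM('b) \<le> ((1 + norm h / s) * ?c) ^ Suc DIM('b)"
    using a by (intro power_mono) auto
  then have "?a ^ Suc DIM('b) \<le> (1 + norm h / s) ^ Suc DIM('b) * ?c ^ Suc DIM('b)"
    by (simp only: power_mult_distrib)
  then have "s * ?a ^ Suc DIM('b) \<le> s * ((1 + norm h / s) ^ Suc DIM('b) * ?c ^ Suc DIM('b))"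
    using s by (intro mult_left_mono) auto
  moreover have "?c ^ Suc DIM('b) > 0" "?a ^ Suc DIM('b) > 0" using a c by (auto simp only: zero_less_power)
  ultimately show ?thesis
    unfolding poisson_kernel_def by (simp only: times_divide_eq_right divide_le_eq pos_le_divide_eq) (simp add: mult_ac divide_simps)
qed

text \<open>With b = |h| / s: for b \<le> 1 the Harnack bound is linear in b, hence below a multiple
  of sqrt b; for b > 1 the triangle inequality suffices as sqrt b > 1. Harnack in both directions
  bounds each sign of the difference by one of the two kernels.\<close>

lemma poisson_kernel_diff:
  fixes y h :: "'b::euclidean_space"
  assumes s: "s > 0"
  shows "\<bar>poisson_kernel s y - poisson_kernel s (y - h)\<bar>
    \<le> 2 ^ Suc DIM('b) * sqrt (norm h / s) * (poisson_kernel s y + poisson_kernel s (y - h))"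
proof -
  let ?b = "norm h / s" and ?P = "poisson_kernel s y" and ?Q = "poisson_kernel s (y - h)" and ?m = "Suc DIM('b)"
  have P: "?P \<ge> 0" "?Q \<ge> 0" using s by (auto intro: poisson_kernel_nonneg)
  have b: "?b \<ge> 0" using s by simp
  have one: "(1::real) \<le> 2 ^ ?m" by (rule one_le_power) simp
  show ?thesis
  proof (cases "?b \<le> 1")
    case True
    have "?b * ?b \<le> 1 * ?b" using True b by (intro mult_right_mono) auto
    then have "?b \<le> sqrt ?b" by (intro real_le_rsqrt) (simp only: power2_eq_square mult_1_left)
    have p: "(1 + ?b) ^ ?m - 1 \<le> 2 ^ ?m * sqrt ?b"
    proof -
      have "(1 + ?b) ^ ?m - 1 \<le> (2 ^ ?m - 1) * ?b" by (rule power_one_plus_le[OF b True])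
      also have "\<dots> \<le> 2 ^ ?m * ?b" using b by (intro mult_right_mono) auto
      also have "\<dots> \<le> 2 ^ ?m * sqrt ?b" using \<open>?b \<le> sqrt ?b\<close> by (intro mult_left_mono) auto
      finally show ?thesis .
    qed
    have "?Q - ?P \<le> ((1 + ?b) ^ ?m - 1) * ?P"
      using poisson_kernel_harnack[OF s, of y h] by (simp add: left_diff_distrib)
    also have "\<dots> \<le> 2 ^ ?m * sqrt ?b * ?P" using p P by (intro mult_right_mono)
    finally have 1: "?Q - ?P \<le> 2 ^ ?m * sqrt ?b * ?P" .
    have "?P - ?Q \<le> ((1 + ?b) ^ ?m - 1) * ?Q"
      using poisson_kernel_harnack[OF s, of "y - h" "- h"] by (simp add: left_diff_distrib)
    also have "\<dots> \<le> 2 ^ ?m * sqrt ?b * ?Q" using p P by (intro mult_right_mono)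
    finally have 2: "?P - ?Q \<le> 2 ^ ?m * sqrt ?b * ?Q" .
    have "0 \<le> 2 ^ ?m * sqrt ?b * ?P" "0 \<le> 2 ^ ?m * sqrt ?b * ?Q" using P b by auto
    with 1 2 show ?thesis unfolding distrib_left by linarith
  next
    case False
    have "1 * 1 \<le> 2 ^ ?m * sqrt ?b" using False one by (intro mult_mono) auto
    then have "1 * (?P + ?Q) \<le> 2 ^ ?m * sqrt ?b * (?P + ?Q)" using P by (intro mult_right_mono) auto
    then have "?P + ?Q \<le> 2 ^ ?m * sqrt ?b * (?P + ?Q)" by (simp only: mult_1_left)
    moreover have "\<bar>?P - ?Q\<bar> \<le> ?P + ?Q" using P by linarith
    ultimately show ?thesis by (rule order_trans[rotated])
  qed
qed

lemma poisson_translation_L1: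
  fixes h :: "'b::euclidean_space"
  assumes s: "s > 0"
  shows "(\<integral>\<^sup>+y. ennreal \<bar>poisson_kernel s y - poisson_kernel s (y - h)\<bar> \<partial>lborel)
    \<le> ennreal (2 ^ Suc DIM('b) * sqrt (norm h / s) * (2 * poisson_mass TYPE('b)))"
proof -
  have P: "has_bochner_integral lborel (poisson_kernel s :: 'b \<Rightarrow> real) (poisson_mass TYPE('b))" by (rule poisson_integral[OF s])
  have P': "has_bochner_integral lborel (\<lambda>y::'b. poisson_kernel s (y - h)) (poisson_mass TYPE('b))"
    using P integral_lborel_translate(1)[of "poisson_kernel s :: 'b \<Rightarrow> real" "- h"] integrable_lborel_translate(1)[of "poisson_kernel s :: 'b \<Rightarrow> real" "- h"]
    by (simp add: has_bochner_integral_iff)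
  let ?c = "2 ^ Suc DIM('b) * sqrt (norm h / s)"
  have c: "?c \<ge> 0" using s by simp
  have i: "has_bochner_integral lborel (\<lambda>y. ?c * (poisson_kernel s y + poisson_kernel s (y - h))) (?c * (poisson_mass TYPE('b) + poisson_mass TYPE('b)))"
    by (intro has_bochner_integral_mult_right has_bochner_integral_add P P')
  have "(\<integral>\<^sup>+y. ennreal \<bar>poisson_kernel s y - poisson_kernel s (y - h)\<bar> \<partial>lborel)
    \<le> (\<integral>\<^sup>+y. ennreal (?c * (poisson_kernel s y + poisson_kernel s (y - h))) \<partial>lborel)"
    by (intro nn_integral_mono ennreal_leI poisson_kernel_diff s)
  also have "\<dots> = ennreal (\<integral>y. ?c * (poisson_kernel s y + poisson_kernel s (y - h)) \<partial>lborel)"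
    using i c s by (intro nn_integral_eq_integral AE_I2 mult_nonneg_nonneg add_nonneg_nonneg poisson_kernel_nonneg)
      (auto simp: has_bochner_integral_iff)
  also have "(\<integral>y. ?c * (poisson_kernel s y + poisson_kernel s (y - h)) \<partial>lborel) = ?c * (2 * poisson_mass TYPE('b))"
    using i by (simp only: has_bochner_integral_iff mult_2)
  finally show ?thesis .
qed

lemma time_singularity_bound:
  assumes "R \<ge> 0"
  shows "(\<integral>\<^sup>+t. ennreal (indicator {-R..R} t * (indicator {0<..} (w - t) * (1 / sqrt (w - t)))) \<partial>lborel)
    \<le> ennreal (2 * R + (\<integral>s. indicator {0<..<1} s * (1 / sqrt s) \<partial>lborel))"
proof -
  let ?q = "\<lambda>s::real. indicator {0<..<1} s * (1 / sqrt s) :: real"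
  have q0: "?q s \<ge> 0" for s by (auto simp: indicator_def)
  have [measurable]: "?q \<in> borel_measurable borel" by measurable
  \<comment> \<open>Away from the singularity, for w - t \<ge> 1, the factor is at most 1 and the
    time window bounds the integral; near it the integrand is at most a reflected translate of an
    integrable function.\<close>
  have pt: "indicator {-R..R} t * (indicator {0<..} (w - t) * (1 / sqrt (w - t))) \<le> indicator {-R..R} t + ?q (w - t)" for t :: real
  proof (cases "w - t \<ge> 1")
    case True
    then have "1 / sqrt (w - t) \<le> 1" by simp
    then show ?thesis using True by (auto simp: indicator_def)
  next
    case False
    then show ?thesis by (auto simp: indicator_def)
  qed
  have "(\<integral>\<^sup>+t. ennreal (indicator {-R..R} t * (indicator {0<..} (w - t) * (1 / sqrt (w - t)))) \<partial>lborel)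
      \<le> (\<integral>\<^sup>+t. ennreal (indicator {-R..R} t) + ennreal (?q (w - t)) \<partial>lborel)"
    using q0 by (intro nn_integral_mono) (simp only: ennreal_plus[symmetric] indicator_pos_le ennreal_leI[OF pt])
  also have "\<dots> = (\<integral>\<^sup>+t. ennreal (indicator {-R..R} (t::real)) \<partial>lborel) + (\<integral>\<^sup>+t. ennreal (?q (w - t)) \<partial>lborel)"
    by (intro nn_integral_add) measurable
  also have "(\<integral>\<^sup>+t. ennreal (indicator {-R..R} (t::real)) \<partial>lborel) = ennreal (2 * R)"
    using assms by (simp add: ennreal_indicator)
  also have "(\<integral>\<^sup>+t. ennreal (?q (w - t)) \<partial>lborel) = (\<integral>\<^sup>+s. ennreal (?q s) \<partial>lborel)"
    by (rule nn_integral_lborel_translate(3)[of "\<lambda>s. ennreal (?q s)"]) measurable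
  also have "\<dots> = ennreal (\<integral>s. ?q s \<partial>lborel)"
    by (rule nn_integral_eq_integral[OF integrable_inverse_sqrt]) (use q0 in simp)
  finally show ?thesis using assms q0 by (simp only: ennreal_plus[symmetric] mult_nonneg_nonneg zero_le_numeral Bochner_Integration.integral_nonneg)
qed

lemma heat_adjoint_alt:
  fixes \<psi> :: "(real^'n) \<times> real \<Rightarrow> real"
  assumes \<psi>: "test_function \<psi>"
  shows "heat_adjoint \<psi> z = (\<integral>w. half_heat_kernel (w - z) * \<psi> w \<partial>lborel)"
    and "integrable lborel (\<lambda>w. half_heat_kernel (w - z) * \<psi> w)"
proof -
  have [measurable]: "\<psi> \<in> borel_measurable borel" by (intro smooth_borel_measurable test_function_smooth \<psi>)
  have m: "(\<lambda>w. half_heat_kernel (w - z) * \<psi> w) \<in> borel_measurable borel" by measurable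
  obtain R where R: "time_bounded R \<psi>" using test_function_time_bounded[OF \<psi>] by blast
  show "heat_adjoint \<psi> z = (\<integral>w. half_heat_kernel (w - z) * \<psi> w \<partial>lborel)"
    using integral_lborel_translate(1)[OF m, of z] by (simp add: heat_adjoint_def translate_avg_def)
  show "integrable lborel (\<lambda>w. half_heat_kernel (w - z) * \<psi> w)"
    using integrable_lborel_translate(1)[OF m, of z] heat_adjoint_integrable[OF R, of z] by simp
qed

text \<open>For fixed \<open>h\<close> the space integral is controlled by the L^1 translation
  estimate, giving sqrt(|h| / s) with s the elapsed time. The time integral of s^(-1/2) runs over
  the bounded time support of \<phi>, and the remaining function of \<open>h\<close> is a multiple
  of \<open>frac_weight\<close>. Every bound is uniform in \<open>w\<close>.\<close>

lemma field_kernel_bound: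
  fixes \<phi> f :: "(real^'n) \<times> real \<Rightarrow> real"
  assumes \<phi>: "test_function \<phi>" and f: "f \<in> borel_measurable borel" "\<And>z. \<bar>f z\<bar> \<le> M"
  shows "\<exists>C\<ge>0. \<forall>w. (\<integral>\<^sup>+p. ennreal \<bar>f (fst p) * (2 * half_levy (snd p) * (\<phi> (fst p) - \<phi> (fst p + (snd p, 0)))) *
    (half_heat_kernel (w - fst p) - half_heat_kernel (w - fst p - (snd p, 0)))\<bar> \<partial>lborel) \<le> ennreal C"
proof -
  let ?\<kappa> = "poisson_mass TYPE(real^'n)" and ?N = "CARD('n)"
  let ?K = "half_heat_kernel :: (real^'n) \<times> real \<Rightarrow> real"
  note [measurable] = f(1)
  have [measurable]: "\<phi> \<in> borel_measurable borel" by (intro smooth_borel_measurable test_function_smooth \<phi>)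
  have M: "M \<ge> 0" using order_trans[OF abs_ge_zero f(2)] .
  obtain R where R: "R \<ge> 0" "time_bounded R \<phi>" using test_function_time_bounded[OF \<phi>] by blast
  obtain B where B: "B \<ge> 0" "\<And>z h. \<bar>\<phi> z - \<phi> (z + h)\<bar> \<le> B * min (norm h) 1"
    using smooth_bounded_lipschitz[OF test_function_smooth_bounded[OF \<phi>]] by metis
  define I where "I = 2 * R + (\<integral>s. indicator {0<..<1} s * (1 / sqrt s) \<partial>lborel)"
  have I: "I \<ge> 0" unfolding I_def using R by (intro add_nonneg_nonneg Bochner_Integration.integral_nonneg) (auto simp: indicator_def)
  define c2 where "c2 = 2 ^ Suc ?N * (2 * ?\<kappa>)"
  have c2: "c2 \<ge> 0" using poisson_mass_pos[where 'a = "real^'n"] by (simp add: c2_def)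
  define A where "A = (\<lambda>h :: real^'n. M * (2 * half_levy h * (B * min (norm h) 1)))"
  have A: "A h \<ge> 0" for h using M B by (simp add: A_def half_levy_nonneg)
  have frac: "A h * (c2 * sqrt (norm h) * I) = (2 * M * B * c2 * I / (2 * ?\<kappa>)) * frac_weight h" for h
    by (simp add: A_def half_levy_def riesz_kernel_def frac_weight_def field_simps)
  define C where "C = (\<integral>h. (2 * M * B * c2 * I / (2 * ?\<kappa>)) * frac_weight (h :: real^'n) \<partial>lborel)"
  have K0: "2 * M * B * c2 * I / (2 * ?\<kappa>) \<ge> 0" using M B c2 I poisson_mass_pos[where 'a = "real^'n"] by simp
  have C: "C \<ge> 0" unfolding C_def using K0 by (intro Bochner_Integration.integral_nonneg mult_nonneg_nonneg frac_weight_nonneg)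
  have "(\<integral>\<^sup>+p. ennreal \<bar>f (fst p) * (2 * half_levy (snd p) * (\<phi> (fst p) - \<phi> (fst p + (snd p, 0)))) *
    (?K (w - fst p) - ?K (w - fst p - (snd p, 0)))\<bar> \<partial>lborel) \<le> ennreal C" for w
  proof -
    obtain wx wt where w: "w = (wx, wt)" by (cases w)
    let ?G = "\<lambda>z h. f z * (2 * half_levy h * (\<phi> z - \<phi> (z + (h, 0)))) * (?K (w - z) - ?K (w - z - (h, 0)))"
    let ?D = "\<lambda>z h. ?K (w - z) - ?K (w - z - (h, 0))"
    have "(\<lambda>p. ?G (fst p) (snd p)) \<in> borel_measurable (borel \<Otimes>\<^sub>M borel)" by measurable
    then have Gm: "(\<lambda>p. ennreal \<bar>?G (fst p) (snd p)\<bar>) \<in> borel_measurable borel" by (simp add: borel_prod)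
    have inner: "(\<integral>\<^sup>+z. ennreal \<bar>?G z h\<bar> \<partial>lborel) \<le> ennreal (A h * (c2 * sqrt (norm h) * I))" for h
    proof -
      have pt: "\<bar>?G z h\<bar> \<le> A h * (indicator {-R..R} (snd z) * \<bar>?D z h\<bar>)" for z
      proof (cases "\<bar>snd z\<bar> \<le> R")
        case True
        have "\<bar>?G z h\<bar> = \<bar>f z\<bar> * (2 * half_levy h * \<bar>\<phi> z - \<phi> (z + (h, 0))\<bar>) * \<bar>?D z h\<bar>"
          by (simp add: abs_mult half_levy_nonneg)
        also have "\<dots> \<le> (M * (2 * half_levy h * (B * min (norm h) 1))) * \<bar>?D z h\<bar>"
          using f(2)[of z] B(2)[of z "(h, 0)"] M half_levy_nonneg[of h]
          by (intro mult_right_mono mult_mono mult_left_mono) (auto simp: norm_Pair)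
        finally show ?thesis using True by (simp add: A_def indicator_def abs_le_iff)
      next
        case False
        then have "\<phi> z = 0" "\<phi> (z + (h, 0)) = 0"
          using time_bounded_zero[OF R(2), of z] time_bounded_zero[OF R(2), of "z + (h, 0)"] by auto
        then show ?thesis using A[of h] by (simp add: indicator_def)
      qed
      have [measurable]: "(snd :: (real^'n) \<times> real \<Rightarrow> real) \<in> borel_measurable borel"
        by (intro borel_measurable_continuous_onI continuous_intros)
      have Dm: "(\<lambda>z. ennreal (indicator {-R..R} (snd z) * \<bar>?D z h\<bar>)) \<in> borel_measurable borel"
        by measurable
      have xt: "(\<integral>\<^sup>+x. ennreal (indicator {-R..R} (snd (x, t)) * \<bar>?D (x, t) h\<bar>) \<partial>lborel)
         \<le> ennreal (c2 * sqrt (norm h)) * ennreal (indicator {-R..R} t * (indicator {0<..} (wt - t) * (1 / sqrt (wt - t))))" for t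
      proof (cases "wt - t > 0 \<and> t \<in> {-R..R}")
        case True
        let ?s = "wt - t"
        let ?q = "\<lambda>y :: real^'n. ennreal \<bar>poisson_kernel ?s y - poisson_kernel ?s (y - h)\<bar>"
        have "(\<integral>\<^sup>+x. ennreal (indicator {-R..R} (snd (x, t)) * \<bar>?D (x, t) h\<bar>) \<partial>lborel) = (\<integral>\<^sup>+x. ?q (wx - x) \<partial>lborel)"
          using True by (simp add: w half_heat_kernel_poisson)
        also have "\<dots> = (\<integral>\<^sup>+x. ?q x \<partial>lborel)"
          by (rule nn_integral_lborel_translate(3)) measurable
        also have "\<dots> \<le> ennreal (2 ^ Suc ?N * sqrt (norm h / ?s) * (2 * ?\<kappa>))"
          using poisson_translation_L1[of ?s h] True by simp
        also have "2 ^ Suc ?N * sqrt (norm h / ?s) * (2 * ?\<kappa>) = (c2 * sqrt (norm h)) * (1 / sqrt ?s)"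
          by (simp add: c2_def real_sqrt_divide)
        also have "ennreal \<dots> = ennreal (c2 * sqrt (norm h)) * ennreal (1 / sqrt ?s)"
          using c2 True by (intro ennreal_mult) auto
        finally show ?thesis using True by simp
      next
        case False
        \<comment> \<open>For wt \<le> t both kernel values vanish, because the shift by
          \<open>h\<close> is purely spatial.\<close>
        then have "indicator {-R..R} (snd (x, t)) * \<bar>?D (x, t) h\<bar> = 0" for x
          by (auto simp: w half_heat_kernel_poisson)
        then have z: "(\<integral>\<^sup>+x. ennreal (indicator {-R..R} (snd (x, t)) * \<bar>?D (x, t) h\<bar>) \<partial>lborel) = 0"
          by (simp only: ennreal_0 nn_integral_const mult_zero_left)
        show ?thesis unfolding z by simp
      qed
      have "(\<integral>\<^sup>+z. ennreal \<bar>?G z h\<bar> \<partial>lborel) \<le> (\<integral>\<^sup>+z. ennreal (A h) * ennreal (indicator {-R..R} (snd z) * \<bar>?D z h\<bar>) \<partial>lborel)"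
        using pt A by (intro nn_integral_mono) (simp only: ennreal_mult''[symmetric] mult_nonneg_nonneg indicator_pos_le abs_ge_zero ennreal_leI)
      also have "\<dots> = ennreal (A h) * (\<integral>\<^sup>+z. ennreal (indicator {-R..R} (snd z) * \<bar>?D z h\<bar>) \<partial>lborel)"
        using Dm by (intro nn_integral_cmult) simp
      also have "(\<integral>\<^sup>+z. ennreal (indicator {-R..R} (snd z) * \<bar>?D z h\<bar>) \<partial>lborel)
         = (\<integral>\<^sup>+t. \<integral>\<^sup>+x. ennreal (indicator {-R..R} (snd (x, t)) * \<bar>?D (x, t) h\<bar>) \<partial>lborel \<partial>lborel)"
        by (rule nn_integral_lborel_pair(2)[OF Dm])
      also have "\<dots> \<le> (\<integral>\<^sup>+t. ennreal (c2 * sqrt (norm h)) * ennreal (indicator {-R..R} t * (indicator {0<..} (wt - t) * (1 / sqrt (wt - t)))) \<partial>lborel)"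
        by (intro nn_integral_mono xt)
      also have "\<dots> = ennreal (c2 * sqrt (norm h)) * (\<integral>\<^sup>+t. ennreal (indicator {-R..R} t * (indicator {0<..} (wt - t) * (1 / sqrt (wt - t)))) \<partial>lborel)"
        by (intro nn_integral_cmult) measurable
      also have "\<dots> \<le> ennreal (c2 * sqrt (norm h)) * ennreal I"
        unfolding I_def by (intro mult_left_mono time_singularity_bound R) auto
      also have "ennreal (A h) * (ennreal (c2 * sqrt (norm h)) * ennreal I) = ennreal (A h * (c2 * sqrt (norm h) * I))"
        using A[of h] c2 I by (simp add: ennreal_mult)
      finally show ?thesis by (simp add: mult_left_mono)
    qed
    have "(\<integral>\<^sup>+p. ennreal \<bar>?G (fst p) (snd p)\<bar> \<partial>lborel) = (\<integral>\<^sup>+h. \<integral>\<^sup>+z. ennreal \<bar>?G z h\<bar> \<partial>lborel \<partial>lborel)"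
      using nn_integral_lborel_pair(2)[OF Gm] by simp
    also have "\<dots> \<le> (\<integral>\<^sup>+h. ennreal (A h * (c2 * sqrt (norm h) * I)) \<partial>lborel)"
      by (intro nn_integral_mono inner)
    also have "\<dots> = ennreal C"
      unfolding C_def frac
      by (intro nn_integral_eq_integral integrable_mult_right integrable_frac_weight AE_I2 mult_nonneg_nonneg K0 frac_weight_nonneg)
    finally show ?thesis .
  qed
  then show ?thesis using C by blast
qed

text \<open>The product rule moves the cutoff onto the adjoint potential, and each of the three resulting terms
  is integration against an explicit bounded function.\<close>

theorem localization:
  fixes \<phi> f :: "(real^'n) \<times> real \<Rightarrow> real"
  assumes \<phi>: "test_function \<phi>" and f: "f \<in> borel_measurable borel" "\<And>z. \<bar>f z\<bar> \<le> M"
  shows "\<exists>g\<in>borel_measurable borel. \<exists>C\<ge>0. (\<forall>w. \<bar>g w\<bar> \<le> C) \<and>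
    (\<forall>\<psi>. test_function \<psi> \<longrightarrow> (\<integral>z. f z * heat_dual (\<lambda>z. \<phi> z * heat_adjoint \<psi> z) z \<partial>lborel) = (\<integral>w. g w * \<psi> w \<partial>lborel))"
proof -
  let ?\<kappa> = "poisson_mass TYPE(real^'n)"
  let ?K = "half_heat_kernel :: (real^'n) \<times> real \<Rightarrow> real"
  note [measurable] = f(1)
  have \<kappa>: "?\<kappa> > 0" by (rule poisson_mass_pos)
  have [measurable]: "\<phi> \<in> borel_measurable borel" by (intro smooth_borel_measurable test_function_smooth \<phi>)
  have M: "M \<ge> 0" using order_trans[OF abs_ge_zero f(2)] .
  obtain R where R: "R \<ge> 0" "time_bounded R \<phi>" using test_function_time_bounded[OF \<phi>] by blast
  obtain B0 where B0: "\<And>z. \<bar>\<phi> z\<bar> \<le> B0" using test_function_bounded[OF \<phi>] by blast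
  have B00: "B0 \<ge> 0" using order_trans[OF abs_ge_zero B0] .
  have hd: "heat_dual \<phi> = (\<lambda>z. levy_op half_levy \<phi> z - dirderiv (0, 1) \<phi> z)"
    by (simp add: heat_dual_eq[OF \<phi>] half_laplacian_levy_op[OF \<phi>])
  have l_tb: "time_bounded R (levy_op half_levy \<phi>)" by (rule time_bounded_levy_op[OF levy_kernel_half_levy R(2)])
  have d_tb: "time_bounded R (dirderiv (0, 1) \<phi>)" by (rule time_bounded_dirderiv[OF R(2)])
  have hd0: "heat_dual \<phi> z = 0" if "\<bar>snd z\<bar> > R" for z
    unfolding hd using time_bounded_zero[OF l_tb that] time_bounded_zero[OF d_tb that] by simp
  have [measurable]: "heat_dual \<phi> \<in> borel_measurable borel"
    using borel_measurable_integrable[OF heat_dual_integrable[OF \<phi>]] by simp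
  obtain B1 where B1: "\<And>z. \<bar>levy_op half_levy \<phi> z\<bar> \<le> B1"
    using smooth_bounded_bound l_tb unfolding time_bounded_def by blast
  obtain B2 where B2: "\<And>z. \<bar>dirderiv (0, 1) \<phi> z\<bar> \<le> B2"
    using smooth_bounded_bound d_tb unfolding time_bounded_def by blast
  define B where "B = B1 + B2"
  have B: "\<bar>heat_dual \<phi> z\<bar> \<le> B" for z
    unfolding hd B_def by (rule order_trans[OF abs_triangle_ineq4 add_mono[OF B1 B2]])
  have Bn: "B \<ge> 0" using order_trans[OF abs_ge_zero B] .
  \<comment> \<open>Kernel of the term with the operator on the cutoff.
    \<open>heat_dual \<phi>\<close> is bounded and vanishes off a time slab, so the integral over
    \<open>z\<close> sees only a time window of the heat kernel.\<close>
  let ?G2 = "\<lambda>q. f (fst q) * heat_dual \<phi> (fst q) * ?K (snd q - fst q)"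
  have "?G2 \<in> borel_measurable (borel \<Otimes>\<^sub>M borel)" by measurable
  then have G2m: "?G2 \<in> borel_measurable borel" by (simp add: borel_prod)
  define C2 where "C2 = M * B * (?\<kappa> * (2 * R))"
  have C2: "C2 \<ge> 0" using M Bn \<kappa> R by (simp add: C2_def)
  have G2b: "(\<integral>\<^sup>+z. ennreal \<bar>?G2 (z, w)\<bar> \<partial>lborel) \<le> ennreal C2" for w
  proof -
    let ?A = "{snd w - R..snd w + R}"
    let ?W = "heat_window ?A :: (real^'n) \<times> real \<Rightarrow> real"
    have W0: "?W y \<ge> 0" for y by (simp add: heat_window_def half_heat_kernel_nonneg)
    have Wi: "integrable lborel ?W" by (rule heat_window_integral) auto
    have "(\<integral>y. ?W y \<partial>lborel) \<le> ?\<kappa> * measure lborel ?A" by (rule heat_window_integral) auto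
    then have Wl: "(\<integral>y. ?W y \<partial>lborel) \<le> ?\<kappa> * (2 * R)" using R by simp
    have [measurable]: "?W \<in> borel_measurable borel" using Wi by auto
    have "\<bar>?G2 (z, w)\<bar> \<le> (M * B) * ?W (w - z)" for z
    proof (cases "\<bar>snd z\<bar> \<le> R")
      case True
      have "\<bar>?G2 (z, w)\<bar> = \<bar>f z\<bar> * \<bar>heat_dual \<phi> z\<bar> * ?K (w - z)" by (simp add: abs_mult half_heat_kernel_nonneg)
      also have "\<dots> \<le> (M * B) * ?K (w - z)"
        using f(2) B M by (intro mult_right_mono mult_mono half_heat_kernel_nonneg) auto
      finally show ?thesis using True by (simp add: heat_window_def indicator_def abs_le_iff)
    next
      case False
      then show ?thesis using hd0[of z] M Bn W0[of "w - z"] by simp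
    qed
    then have "(\<integral>\<^sup>+z. ennreal \<bar>?G2 (z, w)\<bar> \<partial>lborel) \<le> (\<integral>\<^sup>+z. ennreal ((M * B) * ?W (w - z)) \<partial>lborel)"
      by (intro nn_integral_mono ennreal_leI)
    also have "\<dots> = (\<integral>\<^sup>+z. ennreal ((M * B) * ?W z) \<partial>lborel)"
      by (rule nn_integral_lborel_translate(3)[of "\<lambda>z. ennreal ((M * B) * ?W z)"]) measurable
    also have "\<dots> = ennreal (\<integral>z. (M * B) * ?W z \<partial>lborel)"
      using M Bn W0 by (intro nn_integral_eq_integral integrable_mult_right Wi AE_I2 mult_nonneg_nonneg) auto
    also have "\<dots> \<le> ennreal C2"
    proof (rule ennreal_leI)
      have "(\<integral>z. (M * B) * ?W z \<partial>lborel) = (M * B) * (\<integral>z. ?W z \<partial>lborel)" by (rule integral_mult_right_zero)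
      also have "\<dots> \<le> C2" unfolding C2_def using Wl M Bn by (intro mult_left_mono) auto
      finally show "(\<integral>z. (M * B) * ?W z \<partial>lborel) \<le> C2" .
    qed
    finally show ?thesis .
  qed
  \<comment> \<open>Kernel of the bilinear term on pairs of a point and a jump; the increment of the
    adjoint potential has become an increment of the heat kernel.\<close>
  let ?G3 = "\<lambda>q. f (fst (fst q)) * (2 * half_levy (snd (fst q)) * (\<phi> (fst (fst q)) - \<phi> (fst (fst q) + (snd (fst q), 0)))) *
    (?K (snd q - fst (fst q)) - ?K (snd q - fst (fst q) - (snd (fst q), 0)))"
  have "?G3 \<in> borel_measurable ((borel \<Otimes>\<^sub>M borel) \<Otimes>\<^sub>M borel)" by measurable
  then have G3m: "?G3 \<in> borel_measurable borel" by (simp add: borel_prod)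
  obtain C3 where C3: "C3 \<ge> 0" and G3b: "\<And>w. (\<integral>\<^sup>+p. ennreal \<bar>?G3 (p, w)\<bar> \<partial>lborel) \<le> ennreal C3"
    using field_kernel_bound[OF \<phi> f] by auto
  \<comment> \<open>In effect this is the potential P * (\<phi> \<Theta>^(1/2) f), written as the
    sum of its three bounded pieces.\<close>
  define g where "g = (\<lambda>w. f w * (?\<kappa> * \<phi> w) + (\<integral>z. ?G2 (z, w) \<partial>lborel) - (\<integral>p. ?G3 (p, w) \<partial>lborel))"
  \<comment> \<open>A dummy density: the bound and the measurability in \<open>kernel_swap\<close>
    concern \<open>G\<close> alone.\<close>
  have zi: "integrable lborel (\<lambda>w :: (real^'n) \<times> real. 0 :: real)" by simp
  have g2m [measurable]: "(\<lambda>w. \<integral>z. ?G2 (z, w) \<partial>lborel) \<in> borel_measurable borel"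
    by (rule kernel_swap(3)[OF G2m G2b C2 zi])
  have g3m [measurable]: "(\<lambda>w. \<integral>p. ?G3 (p, w) \<partial>lborel) \<in> borel_measurable borel"
    by (rule kernel_swap(3)[OF G3m G3b C3 zi])
  have g2b: "\<bar>\<integral>z. ?G2 (z, w) \<partial>lborel\<bar> \<le> C2" for w by (rule kernel_swap(2)[OF G2m G2b C2 zi])
  have g3b: "\<bar>\<integral>p. ?G3 (p, w) \<partial>lborel\<bar> \<le> C3" for w by (rule kernel_swap(2)[OF G3m G3b C3 zi])
  have g1b: "\<bar>f w * (?\<kappa> * \<phi> w)\<bar> \<le> M * (?\<kappa> * B0)" for w
    using f(2)[of w] B0[of w] M \<kappa> by (auto simp: abs_mult intro!: mult_mono mult_nonneg_nonneg)
  have gm: "g \<in> borel_measurable borel" unfolding g_def by measurable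
  have gb: "\<bar>g w\<bar> \<le> M * (?\<kappa> * B0) + C2 + C3" for w
    using g1b[of w] g2b[of w] g3b[of w] unfolding g_def by linarith
  have main: "(\<integral>z. f z * heat_dual (\<lambda>z. \<phi> z * heat_adjoint \<psi> z) z \<partial>lborel) = (\<integral>w. g w * \<psi> w \<partial>lborel)"
    if \<psi>: "test_function \<psi>" for \<psi>
  proof -
    have \<psi>i: "integrable lborel \<psi>" by (rule test_function_integrable[OF \<psi>])
    let ?u = "heat_adjoint \<psi>"
    have k2: "(\<integral>w. ?G2 (z, w) * \<psi> w \<partial>lborel) = f z * (heat_dual \<phi> z * ?u z)" for z
    proof -
      have "(\<integral>w. ?G2 (z, w) * \<psi> w \<partial>lborel) = (\<integral>w. (f z * heat_dual \<phi> z) * (?K (w - z) * \<psi> w) \<partial>lborel)"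
        by (simp add: mult_ac)
      also have "\<dots> = (f z * heat_dual \<phi> z) * ?u z" by (simp only: integral_mult_right_zero heat_adjoint_alt(1)[OF \<psi>])
      finally show ?thesis by simp
    qed
    have k3: "(\<integral>w. ?G3 ((z, h), w) * \<psi> w \<partial>lborel)
       = f z * (2 * half_levy h * ((\<phi> z - \<phi> (z + (h, 0))) * (?u z - ?u (z + (h, 0)))))" for z h
    proof -
      have "(\<integral>w. ?G3 ((z, h), w) * \<psi> w \<partial>lborel) = (\<integral>w. (f z * (2 * half_levy h * (\<phi> z - \<phi> (z + (h, 0))))) *
         (?K (w - z) * \<psi> w - ?K (w - (z + (h, 0))) * \<psi> w) \<partial>lborel)"
        by (simp add: algebra_simps)
      also have "\<dots> = (f z * (2 * half_levy h * (\<phi> z - \<phi> (z + (h, 0))))) * (?u z - ?u (z + (h, 0)))"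
        unfolding integral_mult_right_zero heat_adjoint_alt(1)[OF \<psi>]
        by (subst Bochner_Integration.integral_diff) (simp_all only: heat_adjoint_alt(2)[OF \<psi>])
      finally show ?thesis by (simp only: mult.assoc)
    qed
    have i1: "integrable lborel (\<lambda>w. (f w * (?\<kappa> * \<phi> w)) * \<psi> w)"
      using integrable_mult_bounded[OF \<psi>i _ g1b] by (simp add: mult.commute)
    have i2: "integrable lborel (\<lambda>z. f z * (heat_dual \<phi> z * ?u z))"
      using kernel_swap(4)[OF G2m G2b C2 \<psi>i] by (simp only: k2)
    have i3p: "integrable lborel (\<lambda>p. \<integral>w. ?G3 (p, w) * \<psi> w \<partial>lborel)" by (rule kernel_swap(4)[OF G3m G3b C3 \<psi>i])
    have sf: "(\<integral>h. (\<integral>w. ?G3 ((z, h), w) * \<psi> w \<partial>lborel) \<partial>lborel) = f z * square_field \<phi> ?u z" for z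
      by (simp only: k3 square_field_def integral_mult_right_zero)
    have i3: "integrable lborel (\<lambda>z. f z * square_field \<phi> ?u z)"
      using lborel_pair.integrable_fst'[of "\<lambda>p. \<integral>w. ?G3 (p, w) * \<psi> w \<partial>lborel"] i3p
      by (simp only: lborel_prod sf)
    have "(\<integral>z. f z * heat_dual (\<lambda>z. \<phi> z * ?u z) z \<partial>lborel)
       = (\<integral>z. ((f z * (?\<kappa> * \<phi> z)) * \<psi> z + f z * (heat_dual \<phi> z * ?u z)) - f z * square_field \<phi> ?u z \<partial>lborel)"
      by (intro Bochner_Integration.integral_cong refl) (simp add: heat_dual_mult[OF \<phi> \<psi>] algebra_simps)
    also have "\<dots> = (\<integral>z. (f z * (?\<kappa> * \<phi> z)) * \<psi> z \<partial>lborel) + (\<integral>z. f z * (heat_dual \<phi> z * ?u z) \<partial>lborel) - (\<integral>z. f z * square_field \<phi> ?u z \<partial>lborel)"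
      by (subst Bochner_Integration.integral_diff[OF Bochner_Integration.integrable_add[OF i1 i2] i3],
          subst Bochner_Integration.integral_add[OF i1 i2]) (rule refl)
    also have "(\<integral>z. f z * (heat_dual \<phi> z * ?u z) \<partial>lborel) = (\<integral>w. (\<integral>z. ?G2 (z, w) \<partial>lborel) * \<psi> w \<partial>lborel)"
      using kernel_swap(1)[OF G2m G2b C2 \<psi>i] by (simp only: k2)
    also have "(\<integral>z. f z * square_field \<phi> ?u z \<partial>lborel) = (\<integral>w. (\<integral>p. ?G3 (p, w) \<partial>lborel) * \<psi> w \<partial>lborel)"
      using kernel_swap(1)[OF G3m G3b C3 \<psi>i] integral_lborel_pair(1)[OF i3p] by (simp only: sf)
    also have "(\<integral>z. (f z * (?\<kappa> * \<phi> z)) * \<psi> z \<partial>lborel) + (\<integral>w. (\<integral>z. ?G2 (z, w) \<partial>lborel) * \<psi> w \<partial>lborel)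
        - (\<integral>w. (\<integral>p. ?G3 (p, w) \<partial>lborel) * \<psi> w \<partial>lborel) = (\<integral>w. g w * \<psi> w \<partial>lborel)"
    proof -
      have j2: "integrable lborel (\<lambda>w. (\<integral>z. ?G2 (z, w) \<partial>lborel) * \<psi> w)"
        using integrable_mult_bounded[OF \<psi>i _ g2b] g2m by (simp add: mult.commute)
      have j3: "integrable lborel (\<lambda>w. (\<integral>p. ?G3 (p, w) \<partial>lborel) * \<psi> w)"
        using integrable_mult_bounded[OF \<psi>i _ g3b] g3m by (simp add: mult.commute)
      show ?thesis unfolding g_def left_diff_distrib distrib_right
        by (subst Bochner_Integration.integral_diff[OF Bochner_Integration.integrable_add[OF i1 j2] j3],
          subst Bochner_Integration.integral_add[OF i1 j2]) (rule refl)
    qed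
    finally show ?thesis .
  qed
  have "M * (?\<kappa> * B0) + C2 + C3 \<ge> 0" using M \<kappa> B00 C2 C3 by simp
  with gm gb main show ?thesis by blast
qed

section \<open>The equivalence\<close>

lemma heat_dual_add:
  assumes \<phi>: "test_function \<phi>" and \<psi>: "test_function \<psi>"
  shows "heat_dual (\<lambda>z. \<phi> z + \<psi> z) z = heat_dual \<phi> z + heat_dual \<psi> z"
proof -
  have "levy_op half_levy (\<lambda>z. \<phi> z + \<psi> z) z =
      (\<integral>h. half_levy h * sdiff (h, 0) \<phi> z + half_levy h * sdiff (h, 0) \<psi> z \<partial>lborel)"
    unfolding levy_op_def by (intro Bochner_Integration.integral_cong refl) (simp add: sdiff_def algebra_simps)
  also have "\<dots> = levy_op half_levy \<phi> z + levy_op half_levy \<psi> z"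
    unfolding levy_op_def
    by (intro Bochner_Integration.integral_add levy_op_integrable levy_kernel_half_levy test_function_smooth_bounded assms)
  finally show ?thesis
    by (simp add: heat_dual_eq half_laplacian_levy_op test_function_add assms dirderiv_add
        smooth_differentiable test_function_smooth)
qed

lemma heat_dual_cmult:
  assumes \<phi>: "test_function \<phi>"
  shows "heat_dual (\<lambda>z. c * \<phi> z) z = c * heat_dual \<phi> z"
proof -
  have "levy_op half_levy (\<lambda>z. c * \<phi> z) z = (\<integral>h. c * (half_levy h * sdiff (h, 0) \<phi> z) \<partial>lborel)"
    unfolding levy_op_def by (intro Bochner_Integration.integral_cong refl) (simp add: sdiff_def algebra_simps)
  then have "levy_op half_levy (\<lambda>z. c * \<phi> z) z = c * levy_op half_levy \<phi> z"
    by (simp add: levy_op_def)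
  then show ?thesis
    by (simp add: heat_dual_eq half_laplacian_levy_op test_function_cmult assms dirderiv_cmult
        smooth_differentiable test_function_smooth right_diff_distrib)
qed

lemma Ck_norm_nonneg:
  assumes "test_function (\<phi> :: 'a::euclidean_space \<Rightarrow> real)"
  shows "0 \<le> Ck_norm m \<phi>"
  using order_trans[OF abs_ge_zero Ck_norm_upper[OF test_function_smooth_bounded[OF assms], of "[]" m undefined]] by simp

text \<open>A bounded f is integrated against \<open>heat_dual \<phi>\<close> over all of
  space-time, so continuity of \<Theta>^(1/2) f as a distribution rests on an L^1 bound by a
  seminorm. Order 2 comes from the second differences; the time derivative costs order 1.\<close>

lemma heat_dual_L1_bound:
  fixes K0 :: "((real^'n) \<times> real) set"
  assumes K0: "compact K0"
  shows "\<exists>A\<ge>0. \<forall>\<phi>. test_function \<phi> \<longrightarrow> fun_support \<phi> \<subseteq> K0 \<longrightarrow>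
    (\<integral>z. \<bar>heat_dual \<phi> z\<bar> \<partial>lborel) \<le> A * Ck_norm 2 \<phi>"
proof -
  let ?D = "real DIM((real^'n) \<times> real)"
  let ?w = "\<integral>h. half_levy h * min ((norm (h :: real^'n))\<^sup>2) 1 \<partial>lborel"
  let ?m = "measure lborel K0"
  have w0: "?w \<ge> 0" by (intro Bochner_Integration.integral_nonneg mult_nonneg_nonneg half_levy_nonneg) auto
  \<comment> \<open>The 3 counts the support and its two translates, 4 + D^2 is the constant of
    \<open>sdiff_bound\<close> with arbitrary directions expressed in the basis, and the last term
    bounds the time derivative.\<close>
  define A where "A = 3 * (4 + ?D ^ 2) * ?m * ?w + ?m"
  have A: "A \<ge> 0" unfolding A_def using w0 by (intro add_nonneg_nonneg mult_nonneg_nonneg) auto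
  have fin: "emeasure lborel K0 < \<infinity>" by (intro emeasure_bounded_finite compact_imp_bounded K0)
  have sK: "K0 \<in> sets lborel" using K0 by (simp add: compact_imp_closed borel_closed)
  have "(\<integral>z. \<bar>heat_dual \<phi> z\<bar> \<partial>lborel) \<le> A * Ck_norm 2 \<phi>" if \<phi>: "test_function \<phi>" and sup: "fun_support \<phi> \<subseteq> K0" for \<phi>
  proof -
    let ?n = "Ck_norm 2 \<phi>" and ?d = "dirderiv (0, 1) \<phi>"
    have sb: "smooth_bounded \<phi>" by (rule test_function_smooth_bounded[OF \<phi>])
    have n0: "?n \<ge> 0" by (rule Ck_norm_nonneg[OF \<phi>])
    have d: "test_function ?d" by (rule test_function_dirderiv[OF \<phi>])
    have sd: "\<bar>sdiff h \<phi> z\<bar> \<le> (4 * ?n + ?D ^ 2 * ?n) * min ((norm h)\<^sup>2) 1" for h z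
    proof (rule sdiff_bound[OF test_function_smooth[OF \<phi>]])
      show "\<bar>\<phi> z\<bar> \<le> ?n" for z using Ck_norm_upper[OF sb, of "[]" 2 z] by simp
      show "\<bar>iter_deriv [u, v] \<phi> z\<bar> \<le> ?D ^ 2 * ?n * norm u * norm v" for u v z
        using iter_deriv_bound[OF test_function_smooth[OF \<phi>], where k = 2 and B = ?n and vs = "[u, v]" and x = z] Ck_norm_upper[OF sb]
        by (simp add: mult.assoc del: iter_deriv.simps)
    qed (use n0 in simp)
    have mono: "measure lborel (fun_support \<phi>) \<le> ?m"
      unfolding measure_def using fin sup sK by (intro enn2real_mono emeasure_mono) (auto simp: less_top)
    have "(\<integral>z. \<bar>levy_op half_levy \<phi> z\<bar> \<partial>lborel) \<le> 3 * (4 * ?n + ?D ^ 2 * ?n) * measure lborel (fun_support \<phi>) * ?w"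
      by (rule levy_op_L1(4)[OF \<phi> levy_kernel_half_levy _ sd]) (use n0 in simp)
    also have "\<dots> \<le> 3 * (4 * ?n + ?D ^ 2 * ?n) * ?m * ?w"
      using mono w0 n0 by (intro mult_right_mono mult_left_mono) auto
    finally have 1: "(\<integral>z. \<bar>levy_op half_levy \<phi> z\<bar> \<partial>lborel) \<le> 3 * (4 * ?n + ?D ^ 2 * ?n) * ?m * ?w" .
    have di: "integrable lborel ?d" by (rule test_function_integrable[OF d])
    have "(\<integral>z. \<bar>?d z\<bar> \<partial>lborel) \<le> (\<integral>z. ?n * indicator K0 z \<partial>lborel)"
    proof (rule Bochner_Integration.integral_mono)
      show "integrable lborel (\<lambda>z. \<bar>?d z\<bar>)" using di by simp
      show "integrable lborel (\<lambda>z. ?n * indicator K0 z)"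
        using sK fin by (intro integrable_mult_right integrable_real_indicator) auto
      show "\<bar>?d z\<bar> \<le> ?n * indicator K0 z" for z
      proof (cases "z \<in> K0")
        case True
        have "(0 :: real^'n, 1 :: real) \<in> Basis" by (simp add: Basis_prod_def)
        then show ?thesis using True Ck_norm_upper[OF sb, of "[(0, 1)]" 2 z] by (simp add: dirderiv_def)
      next
        case False
        then have "?d z = 0"
          using not_in_fun_support[of z ?d] fun_support_dirderiv[OF test_function_smooth[OF \<phi>], of "(0, 1)"] sup by blast
        then show ?thesis using False by simp
      qed
    qed
    also have "\<dots> = ?n * ?m" using sK by simp
    finally have 2: "(\<integral>z. \<bar>?d z\<bar> \<partial>lborel) \<le> ?n * ?m" .
    have li: "integrable lborel (levy_op half_levy \<phi>)"
      using half_laplacian_integrable[OF \<phi>] by (simp add: half_laplacian_levy_op[OF \<phi>])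
    have "(\<integral>z. \<bar>heat_dual \<phi> z\<bar> \<partial>lborel) \<le> (\<integral>z. \<bar>levy_op half_levy \<phi> z\<bar> + \<bar>?d z\<bar> \<partial>lborel)"
      using li di by (intro Bochner_Integration.integral_mono)
        (auto simp: heat_dual_eq[OF \<phi>] half_laplacian_levy_op[OF \<phi>] abs_triangle_ineq4)
    also have "\<dots> = (\<integral>z. \<bar>levy_op half_levy \<phi> z\<bar> \<partial>lborel) + (\<integral>z. \<bar>?d z\<bar> \<partial>lborel)"
      using li di by simp
    also have "\<dots> \<le> A * ?n" using 1 2 by (simp add: A_def algebra_simps)
    finally show ?thesis .
  qed
  with A show ?thesis by blast
qed

theorem capacity_zero_imp_removable:
  fixes E :: "((real^'n) \<times> real) set"
  assumes E: "compact E" and cap: "half_caloric_capacity E = 0"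
  shows "half_caloric_removable E"
  unfolding half_caloric_removable_def
proof (intro ballI impI)
  fix f :: "(real^'n) \<times> real \<Rightarrow> real"
  assume f: "f \<in> borel_measurable lebesgue" and Lf: "Linfty_norm f < \<infinity>" and cal: "half_caloric_on (- E) f"
  obtain M where M: "M \<ge> 0" "Linfty_norm f \<le> ereal M"
  proof (cases "Linfty_norm f")
    case (real r)
    then show ?thesis using that[of "max r 0"] by simp
  qed (use Lf that[of 0] in auto)
  obtain f' where f': "f' \<in> borel_measurable borel" "\<And>z. \<bar>f' z\<bar> \<le> M" "AE z in lebesgue. f z = f' z"
    using Linfty_representative[OF f M(2,1)] by auto
  define T where "T = (\<lambda>\<phi>. \<integral>z. f' z * heat_dual \<phi> z \<partial>lborel)"
  have Th: "Theta_half f \<phi> = T \<phi>" if "test_function \<phi>" for \<phi>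
    unfolding T_def by (rule Theta_half_representative[OF f f'(1,3) that])
  have Ti: "integrable lborel (\<lambda>z. f' z * heat_dual \<phi> z)" if "test_function \<phi>" for \<phi>
  proof -
    have "integrable lborel (\<lambda>z. heat_dual \<phi> z * f' z)"
      by (rule integrable_mult_bounded[OF heat_dual_integrable[OF that] _ f'(2)]) (use f'(1) in simp)
    then show ?thesis by (simp add: mult.commute)
  qed
  have T_add: "T (\<lambda>z. \<phi> z + \<psi> z) = T \<phi> + T \<psi>" if "test_function \<phi>" "test_function \<psi>" for \<phi> \<psi>
    unfolding T_def using Ti[OF that(1)] Ti[OF that(2)] by (simp add: heat_dual_add[OF that] distrib_left)
  have T_cmult: "T (\<lambda>z. c * \<phi> z) = c * T \<phi>" if "test_function \<phi>" for c \<phi>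
    unfolding T_def by (simp add: heat_dual_cmult[OF that] mult.left_commute)
  have "Theta_half f \<phi>0 = 0" if \<phi>0: "test_function \<phi>0" for \<phi>0
  proof (rule ccontr)
    assume "Theta_half f \<phi>0 \<noteq> 0"
    then have nz: "T \<phi>0 \<noteq> 0" using Th[OF \<phi>0] by simp
    have s0: "smooth \<phi>0" by (rule test_function_smooth[OF \<phi>0])
    obtain g C where g: "g \<in> borel_measurable borel" "C \<ge> 0" "\<And>w. \<bar>g w\<bar> \<le> C"
      and loc: "\<And>\<psi>. test_function \<psi> \<Longrightarrow> (\<integral>z. f' z * heat_dual (\<lambda>z. \<phi>0 z * heat_adjoint \<psi> z) z \<partial>lborel) = (\<integral>w. g w * \<psi> w \<partial>lborel)"
      using localization[OF \<phi>0 f'(1,2)] by blast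
    \<comment> \<open>Scales the localized potential to sup norm at most 1; the added 1 keeps the
      denominator positive.\<close>
    define c where "c = 1 / (C + 1)"
    have c: "c > 0" using g(2) by (simp add: c_def)
    \<comment> \<open>Multiplying a distribution by a smooth function means multiplying its test
      functions, so this is \<phi>0 \<Theta>^(1/2) f up to scale.\<close>
    define \<nu> where "\<nu> = (\<lambda>\<phi>. c * T (\<lambda>z. \<phi>0 z * \<phi> z))"
    have t0: "test_function (\<lambda>z. \<phi>0 z * \<phi> z)" if "smooth \<phi>" for \<phi> by (rule test_function_mult(1)[OF \<phi>0 that])
    have dist: "distribution \<nu>"
      unfolding distribution_def
    proof (intro conjI allI impI)
      fix \<phi> \<psi> :: "(real^'n) \<times> real \<Rightarrow> real" assume t: "test_function \<phi>" "test_function \<psi>"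
      show "\<nu> (\<lambda>x. \<phi> x + \<psi> x) = \<nu> \<phi> + \<nu> \<psi>"
        unfolding \<nu>_def using T_add[OF t0 t0, of \<phi> \<psi>] t by (simp add: distrib_left test_function_smooth)
    next
      fix a and \<phi> :: "(real^'n) \<times> real \<Rightarrow> real" assume t: "test_function \<phi>"
      show "\<nu> (\<lambda>x. a * \<phi> x) = a * \<nu> \<phi>"
        unfolding \<nu>_def using T_cmult[OF t0, of \<phi> a] t by (simp add: mult.left_commute test_function_smooth)
    next
      fix K :: "((real^'n) \<times> real) set" assume "compact K"
      have "compact (fun_support \<phi>0)" using \<phi>0 by (simp add: test_function_def)
      then obtain A where A: "A \<ge> 0" "\<And>\<phi>. test_function \<phi> \<Longrightarrow> fun_support \<phi> \<subseteq> fun_support \<phi>0 \<Longrightarrow>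
          (\<integral>z. \<bar>heat_dual \<phi> z\<bar> \<partial>lborel) \<le> A * Ck_norm 2 \<phi>"
        using heat_dual_L1_bound by metis
      let ?q = "real (card {vs::((real^'n) \<times> real) list. set vs \<subseteq> Basis \<and> length vs \<le> 2})"
      \<comment> \<open>One constant serves all compact sets: whatever \<phi> is, the product is
        supported in the fixed compact support of \<phi>0.\<close>
      have "\<bar>\<nu> \<phi>\<bar> \<le> (c * (M * (A * (?q * (2 ^ 2 * Ck_norm 2 \<phi>0))))) * Ck_norm 2 \<phi>" if t: "test_function \<phi>" for \<phi>
      proof -
        let ?\<chi> = "\<lambda>z. \<phi>0 z * \<phi> z"
        have s: "smooth \<phi>" by (rule test_function_smooth[OF t])
        have sup: "fun_support ?\<chi> \<subseteq> fun_support \<phi>0"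
          by (rule fun_support_subset[OF closed_fun_support]) (use not_in_fun_support[of _ \<phi>0] in force)
        have "norm (T ?\<chi>) \<le> (\<integral>z. M * \<bar>heat_dual ?\<chi> z\<bar> \<partial>lborel)"
          unfolding T_def
          by (rule bochner_integral_norm_le[OF Ti[OF t0[OF s]]])
             (use heat_dual_integrable[OF t0[OF s]] f'(2) in \<open>auto simp: abs_mult intro!: mult_right_mono\<close>)
        also have "\<dots> = M * (\<integral>z. \<bar>heat_dual ?\<chi> z\<bar> \<partial>lborel)" by simp
        also have "\<dots> \<le> M * (A * Ck_norm 2 ?\<chi>)" by (rule mult_left_mono[OF A(2)[OF t0[OF s] sup] M(1)])
        also have "\<dots> \<le> M * (A * (?q * (2 ^ 2 * (Ck_norm 2 \<phi>0 * Ck_norm 2 \<phi>))))"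
          by (intro mult_left_mono M A(1) Ck_norm_le iter_deriv_mult_bound Ck_norm_upper test_function_smooth_bounded \<phi>0 t s0 s) auto
        finally have "c * \<bar>T ?\<chi>\<bar> \<le> c * (M * (A * (?q * (2 ^ 2 * (Ck_norm 2 \<phi>0 * Ck_norm 2 \<phi>)))))"
          using c by (intro mult_left_mono) auto
        then show ?thesis using c by (simp add: \<nu>_def abs_mult mult.assoc)
      qed
      then show "\<exists>C m. \<forall>\<phi>. test_function \<phi> \<longrightarrow> fun_support \<phi> \<subseteq> K \<longrightarrow> \<bar>\<nu> \<phi>\<bar> \<le> C * Ck_norm m \<phi>"
        by blast
    qed
    have "vanishes_on \<nu> (- E)"
      unfolding vanishes_on_def
    proof (intro allI impI)
      fix \<phi> :: "(real^'n) \<times> real \<Rightarrow> real" assume t: "test_function \<phi>" and sup: "fun_support \<phi> \<subseteq> - E"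
      have "fun_support (\<lambda>z. \<phi>0 z * \<phi> z) \<subseteq> fun_support \<phi>"
        by (rule fun_support_subset[OF closed_fun_support]) (use not_in_fun_support[of _ \<phi>] in force)
      then have "Theta_half f (\<lambda>z. \<phi>0 z * \<phi> z) = 0"
        using cal sup t0[OF test_function_smooth[OF t]] unfolding half_caloric_on_def vanishes_on_def by blast
      then show "\<nu> \<phi> = 0" using Th[OF t0[OF test_function_smooth[OF t]]] by (simp add: \<nu>_def)
    qed
    moreover have "open (- E)" using E by (simp add: compact_imp_closed open_Compl)
    ultimately have sub: "dist_support \<nu> \<subseteq> E" unfolding dist_support_def by blast
    have cs: "compact (dist_support \<nu>)" using E sub closed_dist_support by (metis closed_Int_compact inf.absorb1)
    obtain \<eta> where \<eta>: "cutoff_near (dist_support \<nu>) \<eta>" "\<And>\<psi>. dist_pairing \<nu> \<psi> = \<nu> (\<lambda>x. \<eta> x * \<psi> x)"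
      using dist_pairing_cutoff[OF cs] by metis
    have fc: "compact (fun_support \<phi>0)" using \<phi>0 by (simp add: test_function_def)
    \<comment> \<open>An auxiliary cutoff equal to 1 on the support of \<phi>0: it turns a smooth
      function into a test function and is invisible to \<nu>.\<close>
    obtain \<theta> V where \<theta>: "test_function \<theta>" "fun_support \<phi>0 \<subseteq> V" "\<forall>x\<in>V. \<theta> x = 1"
      using exists_cutoff[OF fc open_UNIV subset_UNIV] by metis
    have \<theta>1: "\<phi>0 z * (\<theta> z * a) = \<phi>0 z * a" for z a
      using \<theta>(2,3) not_in_fun_support[of z \<phi>0] by (cases "z \<in> fun_support \<phi>0") auto
    text \<open>Since \<open>\<phi>0\<close> already has compact support, pairing with a smooth function needs no cutoff.\<close>
    have pair: "dist_pairing \<nu> u = c * T (\<lambda>z. \<phi>0 z * u z)" if u: "smooth u" for u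
    proof -
      have "dist_pairing \<nu> u = \<nu> (\<lambda>x. \<eta> x * (\<theta> x * u x))"
      proof -
        have "\<phi>0 x * (\<eta> x * (\<theta> x * u x)) = \<phi>0 x * (\<eta> x * u x)" for x
          using \<theta>1[of x "\<eta> x * u x"] by (simp only: mult.left_commute[of "\<eta> x" "\<theta> x"])
        then have "\<nu> (\<lambda>x. \<eta> x * u x) = \<nu> (\<lambda>x. \<eta> x * (\<theta> x * u x))" by (simp only: \<nu>_def)
        then show ?thesis by (simp only: \<eta>(2))
      qed
      also have "\<dots> = \<nu> (\<lambda>x. \<theta> x * u x)"
        by (rule distribution_cutoff_mult[OF dist \<eta>(1) test_function_mult(1)[OF \<theta>(1) u]])
      finally show ?thesis by (simp add: \<nu>_def \<theta>1)
    qed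
    have conv: "kernel_conv \<nu> \<psi> = (LINT x|lebesgue. (c * g x) * \<psi> x)" if \<psi>: "test_function \<psi>" for \<psi>
    proof -
      obtain R where R: "time_bounded R \<psi>" using test_function_time_bounded[OF \<psi>] by blast
      have [measurable]: "g \<in> borel_measurable borel" "\<psi> \<in> borel_measurable borel"
        using g(1) smooth_borel_measurable[OF test_function_smooth[OF \<psi>]] by auto
      have "kernel_conv \<nu> \<psi> = c * T (\<lambda>z. \<phi>0 z * heat_adjoint \<psi> z)"
        unfolding kernel_conv_eq[OF \<psi>] by (rule pair[OF heat_adjoint_smooth(1)[OF R]])
      also have "\<dots> = c * (\<integral>w. g w * \<psi> w \<partial>lborel)" unfolding T_def loc[OF \<psi>] ..
      also have "\<dots> = (\<integral>w. (c * g w) * \<psi> w \<partial>lborel)" by (simp add: mult.assoc)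
      also have "\<dots> = (LINT x|lebesgue. (c * g x) * \<psi> x)"
        by (rule integral_completion[symmetric]) measurable
      finally show ?thesis .
    qed
    have gm: "(\<lambda>x. c * g x) \<in> borel_measurable lebesgue"
      using g(1) by (intro measurable_completion) simp
    have "\<bar>c * g x\<bar> \<le> 1" for x
      using g(2) g(3)[of x] c by (simp add: abs_mult c_def divide_le_eq)
    then have "Linfty_norm (\<lambda>x. c * g x) \<le> ereal 1"
      unfolding Linfty_norm_def using gm by (intro esssup_I) (auto simp: one_ereal_def)
    then have "dist_Linfty_le (kernel_conv \<nu>) 1"
      unfolding dist_Linfty_le_def using gm conv by blast
    then have "admissible E \<nu>" using dist sub by (simp add: admissible_def)
    then have "ennreal \<bar>dist_pairing \<nu> (\<lambda>_. 1)\<bar> \<le> half_caloric_capacity E"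
      unfolding half_caloric_capacity_def by (intro SUP_upper) simp
    then have "dist_pairing \<nu> (\<lambda>_. 1) = 0" using cap by simp
    moreover have "dist_pairing \<nu> (\<lambda>_. 1) = c * T \<phi>0" using pair[OF smooth_const[of 1]] by simp
    ultimately show False using c nz by simp
  qed
  then show "half_caloric_on UNIV f" unfolding half_caloric_on_def vanishes_on_def by blast
qed

theorem theorem4p2:
  fixes E :: "((real^'n) \<times> real) set"
  assumes "compact E"
  shows "half_caloric_removable E \<longleftrightarrow> half_caloric_capacity E = 0"
  using removable_imp_capacity_zero[OF assms] capacity_zero_imp_removable[OF assms] by blast

end
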